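(* Let $\alpha$ be irrational and $Tx=x+\alpha$ on $\mathbb{T}=\mathbb{R}/\mathbb{Z}$. Let $\varphi:\mathbb{T}\to SU(2)$ be a $C^2$-cocycle over $T$ with degree $d(\varphi)\neq 0$. Suppose that the sequence $\{\frac1n D\varphi^{(n)}(\varphi^{(n)})^{-1}\}_{n\in\mathbb{N}}$ is uniformly convergent and that $\{D(\frac1n D\varphi^{(n)}(\varphi^{(n)})^{-1})\}_{n\in\mathbb{N}}$ is bounded in $L^1(\mathbb{T},\mathfrak{su}(2))$. Then the Lebesgue component in the spectrum of the skew product $T_\varphi:\mathbb{T}\times SU(2)\to\mathbb{T}\times SU(2)$, $T_\varphi(x,g)=(Tx,g\,\varphi(x))$, has countable multiplicity. Moreover, if $\gamma=\gamma(\varphi):\mathbb{T}\to S^1=\{z\in\mathbb{C}:|z|=1\}$ is a measurable cocycle such that $\varphi$ is cohomologous to $\begin{pmatrix}\gamma&0\\0&\gamma^{-1}\end{pmatrix}$, then the Lebesgue component in the spectrum of $T_\gamma:\mathbb{T}\times S^1\to\mathbb{T}\times S^1$, $T_\gamma(x,z)=(Tx,z\,\gamma(x))$, has countable multiplicity, too.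
   Context: A $C^k$-cocycle over $T$ is a $C^k$ function $\varphi:\mathbb{T}\to SU(2)$; for $n\ge 1$, $\varphi^{(n)}(x)=\varphi(x)\varphi(Tx)\cdots\varphi(T^{n-1}x)$. $D$ denotes differentiation in $x$, and $D\varphi^{(n)}(x)\,\varphi^{(n)}(x)^{-1}$ lies in the Lie algebra $\mathfrak{su}(2)$ of traceless skew-Hermitian $2\times 2$ matrices, normed by $\|A\|=\sqrt{\det A}$. $L^1(\mathbb{T},\mathfrak{su}(2))$ has norm $\|f\|_{L^1}=\int_{\mathbb{T}}\|f(x)\|dx$. For every $C^1$-cocycle, $\frac1n D\varphi^{(n)}(\varphi^{(n)})^{-1}$ converges in $L^2(\mathbb{T},\mathfrak{su}(2))$ and a.e. to some $\psi$ with $\|\psi(x)\|$ a.e. constant; the degree $d(\varphi)$ is this constant. Two measurable cocycles $\varphi,\delta:\mathbb{T}\to SU(2)$ are cohomologous if there is a measurable $p:\mathbb{T}\to SU(2)$ with $\varphi(x)=p(x)^{-1}\delta(x)p(Tx)$ a.e. When $d(\varphi)\ne0$, a $\gamma$ as in the claim exists. For a unitary operator $U$ on a separable Hilbert space $\mathcal H$ and $f\in\mathcal H$, the cyclic space $\mathbb{Z}(f)$ is the closed span of $\{U^nf:n\in\mathbb{Z}\}$ and the spectral measure $\sigma_f$ is the Borel measure on $\mathbb{T}$ with $\int_{\mathbb{T}}e^{2\pi inx}d\sigma_f(x)=\langle U^nf,f\rangle$ for all $n\in\mathbb{Z}$. The Lebesgue component in the spectrum of $U$ has countable multiplicity if there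 is an infinite sequence $\{g_n\}_{n\in\mathbb{N}}$ in $\mathcal H$ such that the cyclic spaces $\mathbb{Z}(g_n)$ are pairwise orthogonal and every $\sigma_{g_n}$ is equivalent to Lebesgue measure. For a measure-preserving automorphism this refers to its Koopman operator on $L^2$ (with respect to the product of normalized Haar measures). *)

theory Defs
  imports "HOL-Analysis.Analysis"
begin

text \<open>
  The circle R/Z is represented by its fundamental domain [0,1), with Haar measure the
  restriction of Lebesgue measure; differentiable functions on it are 1-periodic functions on the
  real line.
\<close>

definition circle :: "real measure" where
  "circle = restrict_space lborel {0..<1}"

definition rot :: "real \<Rightarrow> real \<Rightarrow> real" where
  "rot \<alpha> x = frac (x + \<alpha>)"

type_synonym cmat2 = "complex ^ 2 ^ 2"

definition adjoint_mat :: "cmat2 \<Rightarrow> cmat2" where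
  "adjoint_mat A = (\<chi> i j. cnj (A $ j $ i))"

definition SU2 :: "cmat2 set" where
  "SU2 = {A. A ** adjoint_mat A = mat 1 \<and> adjoint_mat A ** A = mat 1 \<and> det A = 1}"

definition su2 :: "cmat2 set" where
  "su2 = {A. adjoint_mat A = - A \<and> trace A = 0}"

text \<open>On \<^const>\<open>su2\<close> the determinant is a nonnegative real number, whence the real part.\<close>

definition su2_norm :: "cmat2 \<Rightarrow> real" where
  "su2_norm A = sqrt (Re (det A))"

text \<open>
  The normalized Haar measure of a compact group (a subset \<open>G\<close> of a topological space with
  multiplication \<open>m\<close>): the left-invariant Borel probability measure.
\<close>

definition normalized_haar ::
    "('a::topological_space \<Rightarrow> 'a \<Rightarrow> 'a) \<Rightarrow> 'a set \<Rightarrow> 'a measure \<Rightarrow> bool" where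
  "normalized_haar m G \<mu> \<longleftrightarrow>
     sets \<mu> = sets (restrict_space borel G) \<and>
     emeasure \<mu> (space \<mu>) = 1 \<and>
     (\<forall>g\<in>G. distr \<mu> \<mu> (m g) = \<mu>)"

abbreviation D :: "(real \<Rightarrow> cmat2) \<Rightarrow> real \<Rightarrow> cmat2" where
  "D f \<equiv> \<lambda>x. vector_derivative f (at x)"

primrec Ck :: "nat \<Rightarrow> (real \<Rightarrow> cmat2) \<Rightarrow> bool" where
  "Ck 0 f \<longleftrightarrow> continuous_on UNIV f"
| "Ck (Suc k) f \<longleftrightarrow> (\<forall>x. f differentiable (at x)) \<and> Ck k (D f)"

definition Ck_cocycle :: "nat \<Rightarrow> (real \<Rightarrow> cmat2) \<Rightarrow> bool" where
  "Ck_cocycle k \<phi> \<longleftrightarrow> (\<forall>x. \<phi> x \<in> SU2) \<and> (\<forall>x. \<phi> (x + 1) = \<phi> x) \<and> Ck k \<phi>"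

text \<open>No reduction modulo 1 is needed here, as the cocycle is 1-periodic on the real line.\<close>

primrec cocycle_iter :: "real \<Rightarrow> (real \<Rightarrow> cmat2) \<Rightarrow> nat \<Rightarrow> real \<Rightarrow> cmat2" where
  "cocycle_iter \<alpha> \<phi> 0 x = mat 1"
| "cocycle_iter \<alpha> \<phi> (Suc n) x = cocycle_iter \<alpha> \<phi> n x ** \<phi> (x + real n * \<alpha>)"

definition mean_log_deriv :: "real \<Rightarrow> (real \<Rightarrow> cmat2) \<Rightarrow> nat \<Rightarrow> real \<Rightarrow> cmat2" where
  "mean_log_deriv \<alpha> \<phi> n x =
     (1 / real n) *\<^sub>R (D (cocycle_iter \<alpha> \<phi> n) x ** matrix_inv (cocycle_iter \<alpha> \<phi> n x))"

definition su2_L1_norm :: "(real \<Rightarrow> cmat2) \<Rightarrow> real" where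
  "su2_L1_norm f = (LINT x|circle. su2_norm (f x))"

definition has_degree :: "real \<Rightarrow> (real \<Rightarrow> cmat2) \<Rightarrow> real \<Rightarrow> bool" where
  "has_degree \<alpha> \<phi> d \<longleftrightarrow> (\<exists>\<psi>.
     \<psi> \<in> borel_measurable circle \<and> (\<forall>x\<in>space circle. \<psi> x \<in> su2) \<and>
     integrable circle (\<lambda>x. (su2_norm (\<psi> x))\<^sup>2) \<and>
     (\<lambda>n. LINT x|circle. (su2_norm (mean_log_deriv \<alpha> \<phi> n x - \<psi> x))\<^sup>2) \<longlonglongrightarrow> 0 \<and>
     (AE x in circle. (\<lambda>n. mean_log_deriv \<alpha> \<phi> n x) \<longlonglongrightarrow> \<psi> x) \<and>
     (AE x in circle. su2_norm (\<psi> x) = d))"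

definition cocycle_degree :: "real \<Rightarrow> (real \<Rightarrow> cmat2) \<Rightarrow> real" where
  "cocycle_degree \<alpha> \<phi> = (THE d. has_degree \<alpha> \<phi> d)"

definition cohomologous :: "real \<Rightarrow> (real \<Rightarrow> cmat2) \<Rightarrow> (real \<Rightarrow> cmat2) \<Rightarrow> bool" where
  "cohomologous \<alpha> \<phi> \<delta> \<longleftrightarrow> (\<exists>p \<in> measurable circle (restrict_space borel SU2).
     AE x in circle. \<phi> x = matrix_inv (p x) ** \<delta> x ** p (rot \<alpha> x))"

definition diag_cocycle :: "(real \<Rightarrow> complex) \<Rightarrow> real \<Rightarrow> cmat2" where
  "diag_cocycle \<gamma> x = vector [vector [\<gamma> x, 0], vector [0, inverse (\<gamma> x)]]"

definition skew_product ::
    "('a \<Rightarrow> 'a \<Rightarrow> 'a) \<Rightarrow> real \<Rightarrow> (real \<Rightarrow> 'a) \<Rightarrow> real \<times> 'a \<Rightarrow> real \<times> 'a" where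
  "skew_product m \<alpha> \<phi> = (\<lambda>(x, g). (rot \<alpha> x, m g (\<phi> x)))"

text \<open>
  Elements of the Hilbert space L2(M) are represented by square-integrable functions. A unitary
  operator on it is given by the family \<open>U n\<close> of its integer powers.
\<close>

definition L2 :: "'a measure \<Rightarrow> ('a \<Rightarrow> complex) set" where
  "L2 M = {f \<in> borel_measurable M. integrable M (\<lambda>x. (cmod (f x))\<^sup>2)}"

definition L2_inner :: "'a measure \<Rightarrow> ('a \<Rightarrow> complex) \<Rightarrow> ('a \<Rightarrow> complex) \<Rightarrow> complex" where
  "L2_inner M f g = (LINT x|M. f x * cnj (g x))"

definition L2_norm :: "'a measure \<Rightarrow> ('a \<Rightarrow> complex) \<Rightarrow> real" where
  "L2_norm M f = sqrt (LINT x|M. (cmod (f x))\<^sup>2)"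

definition cyclic_space ::
    "'a measure \<Rightarrow> (int \<Rightarrow> ('a \<Rightarrow> complex) \<Rightarrow> 'a \<Rightarrow> complex) \<Rightarrow> ('a \<Rightarrow> complex) \<Rightarrow> ('a \<Rightarrow> complex) set"
  where
  "cyclic_space M U f = {h \<in> L2 M. \<forall>\<epsilon>>0. \<exists>(F::int set) c. finite F \<and>
     L2_norm M (\<lambda>x. h x - (\<Sum>n\<in>F. c n * U n f x)) < \<epsilon>}"

definition is_spectral_measure ::
    "'a measure \<Rightarrow> (int \<Rightarrow> ('a \<Rightarrow> complex) \<Rightarrow> 'a \<Rightarrow> complex) \<Rightarrow> ('a \<Rightarrow> complex) \<Rightarrow> real measure \<Rightarrow> bool"
  where
  "is_spectral_measure M U f \<sigma> \<longleftrightarrow>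
     sets \<sigma> = sets circle \<and> finite_measure \<sigma> \<and>
     (\<forall>n::int. (LINT x|\<sigma>. cis (2 * pi * of_int n * x)) = L2_inner M (U n f) f)"

definition lebesgue_countable_multiplicity ::
    "'a measure \<Rightarrow> (int \<Rightarrow> ('a \<Rightarrow> complex) \<Rightarrow> 'a \<Rightarrow> complex) \<Rightarrow> bool" where
  "lebesgue_countable_multiplicity M U \<longleftrightarrow> (\<exists>g :: nat \<Rightarrow> 'a \<Rightarrow> complex.
     (\<forall>n. g n \<in> L2 M) \<and>
     (\<forall>m n. m \<noteq> n \<longrightarrow>
        (\<forall>h\<in>cyclic_space M U (g m). \<forall>k\<in>cyclic_space M U (g n). L2_inner M h k = 0)) \<and>
     (\<forall>n. \<exists>\<sigma>. is_spectral_measure M U (g n) \<sigma> \<and>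
        absolutely_continuous circle \<sigma> \<and> absolutely_continuous \<sigma> circle))"

text \<open>
  The integer powers of the Koopman operator of an invertible transformation \<open>S\<close> of the
  underlying space of \<open>M\<close>.
\<close>

definition koopman ::
    "'a measure \<Rightarrow> ('a \<Rightarrow> 'a) \<Rightarrow> int \<Rightarrow> ('a \<Rightarrow> complex) \<Rightarrow> 'a \<Rightarrow> complex" where
  "koopman M S n f = (if n \<ge> 0 then f \<circ> (S ^^ nat n)
     else f \<circ> (inv_into (space M) S ^^ nat (- n)))"

end

theory Submission
  imports Defs "HOL-Probability.Probability_Measure"
begin

text \<open>
  The limit \<open>\<psi>\<close> of the logarithmic derivatives satisfies \<open>\<psi> x = \<phi> x \<psi>(Tx) \<phi>(x)\<inverse>\<close> and has constant norm \<open>d > 0\<close>,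
  so its \<open>i d\<close>-eigenlines are carried to each other by the cocycle. For a unit section \<open>s\<close> of these
  lines over a short interval and a bump function \<open>v\<close> there, the functions \<open>v(x) (g s(x))\<^sub>1 ^ m\<close> have the
  correlations \<open>\<integral> v(x) v(T\<^sup>n x) \<Gamma>\<^sub>n(x) ^ m dx\<close> where \<open>\<Gamma>\<^sub>n = \<langle>\<phi>\<^sup>n s(T\<^sup>n x), s(x)\<rangle>\<close> is unimodular with
  logarithmic derivative close to \<open>i n d\<close>. Integrating by parts against smooth approximants of \<open>s\<close> built from
  the logarithmic derivatives themselves bounds the correlations by \<open>\<epsilon>/n\<close> times their value at \<open>0\<close>,
  once \<open>m\<close> is large: the bounded variation enters with a factor \<open>1/m\<close>, and the rotation of the
  section is negligible on an interval where the total variation is proportional to its length.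
  Hence the spectral measure has a density that is \<open>L\<^sup>1\<close>-close to a constant. Functions with
  different \<open>m\<close> are orthogonal, so infinite orthogonal sums over disjoint families of exponents \<open>m\<close> have
  almost everywhere positive densities. For the circle extension, \<open>s\<close> is compared with the section
  given by the transfer function; ergodicity of the rotation selects \<open>\<gamma>\<close> or its conjugate.
\<close>

subsection \<open>Integration on the circle\<close>

text \<open>The obstacle is regularity. \<open>\<psi>\<close> is a uniform limit and only
  continuous, so its eigenline section has no derivative, while integration by parts needs one; of
  the derivatives of the \<open>a k\<close> only the L1 norms are controlled. Therefore n is fixed,
  the section is built from \<open>a k\<close>, every estimate sees the derivative of
  \<open>a k\<close> only through its integral over an interval, and k tends to infinity last. The
  error caused by the turning of the section gains no factor 1/m, because differentiating an m-th
  power gives the m back. It has to be small against the correlation at 0, that is, against the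
  length of the interval, and this dictates how the interval is chosen. A density close to a
  constant in L1 may still vanish on a small set, so no single packet suffices: each generator is a
  series of packets with relative errors 2^-j, whose zero sets have only a null set in common. To
  obtain infinitely many generators the exponents are grouped by the exact power of 2 that divides
  them; one fibre symmetry then acts by -1 on one group and by 1 on all groups with a higher
  power.\<close>

lemma AE_summable_norm:
  fixes f :: "nat \<Rightarrow> 'a \<Rightarrow> 'b::{banach,second_countable_topology}"
  assumes int: "\<And>i. integrable M (f i)" and sum: "summable (\<lambda>i. \<integral>x. norm (f i x) \<partial>M)"
  shows "AE x in M. summable (\<lambda>i. norm (f i x))"
proof -
  have [measurable]: "\<And>i. f i \<in> borel_measurable M" using int by auto
  have "(\<integral>\<^sup>+x. (\<Sum>i. ennreal (norm (f i x))) \<partial>M) = (\<Sum>i. \<integral>\<^sup>+x. ennreal (norm (f i x)) \<partial>M)"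
    by (intro nn_integral_suminf) measurable
  also have "\<dots> = (\<Sum>i. ennreal (\<integral>x. norm (f i x) \<partial>M))"
    by (simp add: nn_integral_eq_integral int)
  also have "\<dots> \<noteq> \<infinity>"
    using ennreal_suminf_neq_top[OF sum] unfolding infinity_ennreal_def by (metis integral_nonneg_AE AE_I2 norm_ge_zero)
  finally have "AE x in M. (\<Sum>i. ennreal (norm (f i x))) \<noteq> \<infinity>"
    by (intro nn_integral_PInf_AE) auto
  thus ?thesis
    by eventually_elim (intro summable_suminf_not_top, auto)
qed

lemma space_circle [simp]: "space circle = {0..<1}"
  by (simp add: circle_def space_restrict_space)

lemma sets_circle: "sets circle = sets (restrict_space borel {0..<1::real})"
  unfolding circle_def by (intro sets_restrict_space_cong) simp

lemma prob_space_circle: "prob_space circle"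
  by standard (simp add: circle_def emeasure_restrict_space space_restrict_space)

lemma borel_measurable_circle:
  "f \<in> measurable borel M \<Longrightarrow> f \<in> measurable circle M"
  unfolding circle_def by (intro measurable_restrict_space1) simp

lemma integral_circle:
  fixes f :: "real \<Rightarrow> 'b::{banach,second_countable_topology}"
  shows "(LINT x|circle. f x) = (\<integral>x. indicator {0..<1} x *\<^sub>R f x \<partial>lborel)"
  unfolding circle_def by (rule integral_restrict_space) simp

lemma integral_circle_Icc:
  fixes f :: "real \<Rightarrow> 'b::{banach,second_countable_topology}"
  assumes "f \<in> borel_measurable borel"
  shows "(LINT x|circle. f x) = (\<integral>x. indicator {0..1} x *\<^sub>R f x \<partial>lborel)"
  unfolding integral_circle
proof (rule integral_cong_AE)
  show "AE x in lborel. indicator {0..<1} x *\<^sub>R f x = indicator {0..1} x *\<^sub>R f x"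
    using AE_lborel_singleton[of "1::real"] by eventually_elim (auto simp: indicator_def)
qed (use assms in measurable)

lemma integrable_circle_bounded:
  fixes f :: "real \<Rightarrow> 'b::{banach,second_countable_topology}"
  assumes "f \<in> borel_measurable circle" "\<And>x. x \<in> {0..<1} \<Longrightarrow> norm (f x) \<le> B"
  shows "integrable circle f"
proof -
  interpret prob_space circle by (rule prob_space_circle)
  show ?thesis
    by (rule integrable_const_bound[of _ B]) (use assms in \<open>auto intro!: AE_I2\<close>)
qed

lemma integral_circle_FTC:
  fixes F :: "real \<Rightarrow> 'b::euclidean_space"
  assumes "\<And>x. (F has_vector_derivative f x) (at x)" "continuous_on UNIV f"
  shows "(LINT x|circle. f x) = F 1 - F 0"
proof -
  have "f \<in> borel_measurable borel"
    using assms(2) by (rule borel_measurable_continuous_onI)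
  hence "(LINT x|circle. f x) = (\<integral>x. indicator {0..1} x *\<^sub>R f x \<partial>lborel)"
    by (rule integral_circle_Icc)
  also have "\<dots> = F 1 - F 0"
    by (rule integral_FTC_Icc)
       (use assms in \<open>auto intro: has_vector_derivative_at_within continuous_on_subset\<close>)
  finally show ?thesis .
qed

lemma continuous_on_cis_mult: "continuous_on A (\<lambda>x. cis (r * x))"
  by (intro continuous_intros)

lemma borel_measurable_cis_mult [measurable]: "(\<lambda>x. cis (r * x)) \<in> borel_measurable borel"
  by (intro borel_measurable_continuous_onI continuous_on_cis_mult)

lemma borel_measurable_cis_mult_circle [measurable]: "(\<lambda>x. cis (r * x)) \<in> borel_measurable circle"
  by (intro borel_measurable_circle borel_measurable_cis_mult)

lemma integral_circle_cis:
  "(LINT x|circle. cis (2 * pi * of_int k * x)) = (if k = 0 then 1 else 0)"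
proof (cases "k = 0")
  case True
  interpret prob_space circle by (rule prob_space_circle)
  show ?thesis using True prob_space by simp
next
  case False
  let ?r = "2 * pi * of_int k :: real"
  have r: "?r \<noteq> 0" using False by simp
  have "(LINT x|circle. cis (?r * x)) = cis (?r * 1) / (\<i> * ?r) - cis (?r * 0) / (\<i> * ?r)"
  proof (rule integral_circle_FTC)
    fix x
    have "((\<lambda>x. exp (\<i> * complex_of_real (?r * x))) has_vector_derivative
            (\<i> * ?r) * exp (\<i> * complex_of_real (?r * x))) (at x)"
    proof -
      have "((\<lambda>x. \<i> * ?r * x) has_vector_derivative \<i> * ?r) (at (x::real))"
        by (auto intro!: derivative_eq_intros)
      from field_vector_diff_chain_at[OF this DERIV_exp]
      show ?thesis by (simp add: o_def algebra_simps)
    qed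
    hence "((\<lambda>x. exp (\<i> * complex_of_real (?r * x)) / (\<i> * ?r)) has_vector_derivative
            ((\<i> * ?r) * exp (\<i> * complex_of_real (?r * x))) / (\<i> * ?r)) (at x)"
      by (rule has_vector_derivative_divide)
    thus "((\<lambda>x. cis (?r * x) / (\<i> * ?r)) has_vector_derivative cis (?r * x)) (at x)"
      using r by (simp add: cis_conv_exp)
  qed (rule continuous_on_cis_mult)
  also have "cis (?r * 1) = 1"
    using cis_multiple_2pi[of "of_int k"] by simp
  finally show ?thesis using False by simp
qed

lemma integrable_circle_cis [simp]: "integrable circle (\<lambda>x. c * cis (r * x))"
  by (rule integrable_circle_bounded[of _ "norm c"]) (auto simp: norm_mult)

lemma trig_Parseval:
  fixes \<beta> :: "nat \<Rightarrow> complex"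
  shows "(LINT x|circle. (cmod (\<Sum>k<N. \<beta> k * cis (- (2 * pi * real k * x))))\<^sup>2) = (\<Sum>k<N. (cmod (\<beta> k))\<^sup>2)"
proof -
  let ?p = "\<lambda>x. \<Sum>k<N. \<beta> k * cis (- (2 * pi * real k * x))"
  have *: "of_real ((cmod (?p x))\<^sup>2)
     = (\<Sum>k<N. \<Sum>l<N. (\<beta> k * cnj (\<beta> l)) * cis (2 * pi * of_int (int l - int k) * x))" for x
  proof -
    have "of_real ((cmod (?p x))\<^sup>2) = ?p x * cnj (?p x)"
      using complex_norm_square by simp
    also have "\<dots> = (\<Sum>k<N. \<Sum>l<N. (\<beta> k * cis (- (2 * pi * real k * x))) * (cnj (\<beta> l) * cis (2 * pi * real l * x)))"
      by (simp add: sum_product cis_cnj)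
    also have "\<dots> = (\<Sum>k<N. \<Sum>l<N. (\<beta> k * cnj (\<beta> l)) * cis (2 * pi * of_int (int l - int k) * x))"
    proof (intro sum.cong refl)
      fix k l
      have "cis (2 * pi * of_int (int l - int k) * x) = cis (- (2 * pi * real k * x)) * cis (2 * pi * real l * x)"
        by (simp add: cis_mult algebra_simps)
      thus "(\<beta> k * cis (- (2 * pi * real k * x))) * (cnj (\<beta> l) * cis (2 * pi * real l * x))
        = (\<beta> k * cnj (\<beta> l)) * cis (2 * pi * of_int (int l - int k) * x)" by (simp only: mult_ac)
    qed
    finally show ?thesis .
  qed
  have "complex_of_real (LINT x|circle. (cmod (?p x))\<^sup>2) = (LINT x|circle. of_real ((cmod (?p x))\<^sup>2))"
    by (rule integral_complex_of_real[symmetric])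
  also have "\<dots> = (\<Sum>k<N. \<Sum>l<N. (\<beta> k * cnj (\<beta> l)) * (if l = k then 1 else 0))"
    unfolding *
    by (subst Bochner_Integration.integral_sum, (intro Bochner_Integration.integrable_sum integrable_circle_cis))+
       (simp only: integral_mult_right_zero integral_circle_cis, simp)
  also have "\<dots> = (\<Sum>k<N. of_real ((cmod (\<beta> k))\<^sup>2))"
    by (intro sum.cong refl) (simp add: if_distrib complex_norm_square del: of_real_power cong: if_cong)
  also have "\<dots> = of_real (\<Sum>k<N. (cmod (\<beta> k))\<^sup>2)" by simp
  finally show ?thesis using of_real_eq_iff by blast
qed

text \<open>Cauchy-Schwarz on a probability space, obtained by integrating 2 t |f| <= t^2 +
  f^2.\<close>

lemma (in prob_space) integral_le_of_square:
  fixes f :: "'a \<Rightarrow> real"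
  assumes "integrable M f" "integrable M (\<lambda>x. (f x)\<^sup>2)" "(LINT x|M. (f x)\<^sup>2) \<le> t\<^sup>2" "t > 0"
  shows "(LINT x|M. \<bar>f x\<bar>) \<le> t"
proof -
  have "(LINT x|M. \<bar>f x\<bar>) \<le> (LINT x|M. (t + (f x)\<^sup>2 / t) / 2)"
  proof (rule integral_mono)
    fix x
    have "0 \<le> (t - \<bar>f x\<bar>)\<^sup>2" by simp
    hence "2 * t * \<bar>f x\<bar> \<le> t\<^sup>2 + (f x)\<^sup>2" by (simp add: power2_diff)
    thus "\<bar>f x\<bar> \<le> (t + (f x)\<^sup>2 / t) / 2"
      using assms(4) by (simp add: field_simps power2_eq_square)
  qed (use assms in auto)
  also have "\<dots> = (t + (LINT x|M. (f x)\<^sup>2) / t) / 2"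
    using assms by (simp add: prob_space)
  also have "\<dots> \<le> t" using assms(3,4) by (simp add: field_simps power2_eq_square)
  finally show ?thesis .
qed

lemma trig_L1_bound:
  fixes \<beta> :: "nat \<Rightarrow> complex"
  assumes "(\<Sum>k<N. (cmod (\<beta> k))\<^sup>2) \<le> t\<^sup>2" "t > 0"
  shows "(LINT x|circle. cmod (\<Sum>k<N. \<beta> k * cis (- (2 * pi * real k * x)))) \<le> t"
proof -
  interpret prob_space circle by (rule prob_space_circle)
  let ?p = "\<lambda>x. \<Sum>k<N. \<beta> k * cis (- (2 * pi * real k * x))"
  have "(\<lambda>x. cis (- (2 * pi * real k * x))) \<in> borel_measurable borel" for k
    using borel_measurable_cis_mult[of "- (2 * pi * real k)"] by simp
  hence "?p \<in> borel_measurable borel" by (intro borel_measurable_sum borel_measurable_times) auto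
  hence [measurable]: "?p \<in> borel_measurable circle" by (rule borel_measurable_circle)
  have b: "norm (?p x) \<le> (\<Sum>k<N. cmod (\<beta> k))" for x
    by (rule order_trans[OF norm_sum]) (simp add: norm_mult)
  have "(LINT x|circle. \<bar>cmod (?p x)\<bar>) \<le> t"
  proof (rule integral_le_of_square)
    show "integrable circle (\<lambda>x. cmod (?p x))"
      by (rule integrable_circle_bounded) (measurable, use b in simp)
    show "integrable circle (\<lambda>x. (cmod (?p x))\<^sup>2)"
    proof (rule integrable_circle_bounded)
      show "norm ((cmod (?p x))\<^sup>2) \<le> (\<Sum>k<N. cmod (\<beta> k))\<^sup>2" for x
        using b[of x] by (simp add: power_mono)
    qed measurable
    show "(LINT x|circle. (cmod (?p x))\<^sup>2) \<le> t\<^sup>2"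
      using assms by (simp only: trig_Parseval)
  qed fact
  thus ?thesis by simp
qed

subsection \<open>Densities from decaying positive definite sequences\<close>

text \<open>\<open>pos\<close> says that N times the N-th Fejer mean of the series with coefficients
  \<open>c\<close> is nonnegative. Along N = 2^j consecutive means differ in L1 by a geometrically
  small amount, so their differences form an absolutely convergent series in L1, whose sum gives the
  density. The rate 1/n enters here: it bounds each of the 2^(j+1) coefficients of the j-th
  difference by \<open>\<delta>\<close> / 2^j, and Parseval then gives the decay 2^(-j/2).\<close>

lemma Fejer_density:
  fixes c :: "nat \<Rightarrow> complex" and \<delta> :: real
  assumes pos: "\<And>N x. 0 \<le> real N * Re (c 0)
      + 2 * (\<Sum>k=1..<N. (real N - real k) * Re (c k * cis (- (2 * pi * real k * x))))"
    and c0: "Im (c 0) = 0" and bound: "\<And>n. n \<ge> 1 \<Longrightarrow> cmod (c n) \<le> \<delta> / real n" and "\<delta> > 0"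
  obtains h :: "real \<Rightarrow> real" where "integrable circle h" "\<And>x. 0 \<le> h x"
    "\<And>n. (LINT x|circle. of_real (h x) * cis (2 * pi * real n * x)) = c n"
    "(LINT x|circle. \<bar>h x - Re (c 0)\<bar>) \<le> 5 * \<delta>"
proof -
  interpret prob_space circle by (rule prob_space_circle)
  \<comment> \<open>Fejer weights for N = 2^j without the index 0: the constant term is the same in
    all means. Since \<open>w 0\<close> vanishes identically, the telescoping sum of the
    \<open>d j\<close> starts from zero.\<close>
  define w where "w j k = (if k = 0 \<or> k \<ge> 2 ^ j then 0 else 1 - real k / 2 ^ j)" for j k :: nat
  define \<beta> where "\<beta> j k = complex_of_real (2 * (w (Suc j) k - w j k)) * c k" for j k
  define P where "P j x = (\<Sum>k<2 ^ Suc j. \<beta> j k * cis (- (2 * pi * real k * x)))" for j x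
  define d where "d j x = Re (P j x)" for j x
  \<comment> \<open>The square root of 2^(j+1) times (\<open>\<delta>\<close> / 2^j)^2, the bound
    that \<open>sq\<close> gives for the sum of the squared coefficients.\<close>
  define t where "t j = \<delta> * sqrt 2 * (1 / sqrt 2) ^ j" for j :: nat
  have t0: "t j > 0" for j using \<open>\<delta> > 0\<close> by (simp add: t_def)
  \<comment> \<open>Below 2^j the difference equals k / 2^(j+1). From 2^j up to 2^(j+1) it is 1 - k
    / 2^(j+1), which is no larger because k >= 2^j.\<close>
  have wd: "\<bar>w (Suc j) k - w j k\<bar> \<le> real k / 2 ^ Suc j" for j k
  proof -
    consider "k = 0" | "k > 0" "k < 2 ^ j" | "2 ^ j \<le> k" "k < 2 ^ Suc j" | "2 ^ Suc j \<le> k" by linarith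
    thus ?thesis
    proof cases
      case 3
      have "real (2 ^ j) \<le> real k" "real k < real (2 ^ Suc j)" using 3 by (simp_all only: of_nat_le_iff of_nat_less_iff)
      thus ?thesis using 3 by (simp add: w_def field_simps)
    qed (auto simp: w_def field_simps)
  qed
  have \<beta>b: "cmod (\<beta> j k) \<le> \<delta> / 2 ^ j" for j k
  proof (cases "k = 0")
    case False
    have "cmod (\<beta> j k) = 2 * \<bar>w (Suc j) k - w j k\<bar> * cmod (c k)"
      unfolding \<beta>_def norm_mult norm_of_real abs_mult by simp
    also have "\<dots> \<le> 2 * (real k / 2 ^ Suc j) * (\<delta> / real k)"
      using wd[of j k] bound[of k] False by (intro mult_mono) auto
    also have "\<dots> = \<delta> / 2 ^ j" using False by (simp add: field_simps)
    finally show ?thesis .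
  qed (use \<open>\<delta> > 0\<close> in \<open>simp add: \<beta>_def w_def\<close>)
  have sq: "(\<Sum>k<2 ^ Suc j. (cmod (\<beta> j k))\<^sup>2) \<le> (t j)\<^sup>2" for j
  proof -
    have "(\<Sum>k<2 ^ Suc j. (cmod (\<beta> j k))\<^sup>2) \<le> (\<Sum>k<(2::nat) ^ Suc j. (\<delta> / 2 ^ j)\<^sup>2)"
      by (intro sum_mono power_mono \<beta>b) auto
    also have "\<dots> = 2 * \<delta>\<^sup>2 / 2 ^ j" by (simp add: field_simps power2_eq_square)
    also have "\<dots> = (t j)\<^sup>2"
      by (simp add: t_def power_mult_distrib power_divide power_even_eq[symmetric] power_mult[symmetric] mult.commute[of j 2])
         (simp add: power_mult)
    finally show ?thesis .
  qed
  have "(\<lambda>x. cis (- (2 * pi * real k * x))) \<in> borel_measurable borel" for k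
    using borel_measurable_cis_mult[of "- (2 * pi * real k)"] by simp
  hence "(\<lambda>x. P j x) \<in> borel_measurable borel" for j
    unfolding P_def by (intro borel_measurable_sum borel_measurable_times) auto
  hence [measurable]: "P j \<in> borel_measurable circle" for j
    using borel_measurable_circle by blast
  have [measurable]: "d j \<in> borel_measurable circle" for j
    unfolding d_def by measurable
  have Pb: "cmod (P j x) \<le> (\<Sum>k<2 ^ Suc j. cmod (\<beta> j k))" for j x
    unfolding P_def by (rule order_trans[OF norm_sum]) (simp add: norm_mult)
  have Pint: "integrable circle (P j)" for j
    by (rule integrable_circle_bounded) (measurable, rule Pb)
  have dint: "integrable circle (d j)" for j
    unfolding d_def using Pint by (rule integrable_Re)
  have dL1: "(LINT x|circle. norm (d j x)) \<le> t j" for j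
  proof -
    have "(LINT x|circle. norm (d j x)) \<le> (LINT x|circle. cmod (P j x))"
      using dint Pint by (intro integral_mono) (auto simp: d_def abs_Re_le_cmod)
    also have "\<dots> \<le> t j"
      unfolding P_def using sq t0 by (rule trig_L1_bound)
    finally show ?thesis .
  qed
  have q: "norm (1 / sqrt 2 :: real) < 1" by (simp add: real_less_lsqrt)
  have tsum: "t sums (\<delta> * sqrt 2 * (1 / (1 - 1 / sqrt 2)))"
    unfolding t_def by (intro sums_mult geometric_sums q)
  \<comment> \<open>The geometric sum equals 2 \<open>\<delta>\<close> / (sqrt 2 - 1), and sqrt 2 >=
    7/5 turns this into 5 \<open>\<delta>\<close>.\<close>
  have tle: "(\<Sum>j. t j) \<le> 5 * \<delta>"
  proof -
    have s: "sqrt 2 > 1" by simp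
    have "sqrt 2 \<ge> 7 / (5::real)" by (rule real_le_rsqrt) (auto simp: power2_eq_square)
    hence "sqrt 2 * (1 / (1 - 1 / sqrt 2)) \<le> (5::real)"
      using s by (simp add: field_simps)
    from mult_left_mono[OF this, of \<delta>] show ?thesis
      using tsum \<open>\<delta> > 0\<close> by (simp add: sums_iff mult_ac)
  qed
  have dsum: "summable (\<lambda>j. LINT x|circle. norm (d j x))"
    by (rule summable_comparison_test'[OF sums_summable[OF tsum], of 0]) (use dL1 in auto)
  have AEs: "AE x in circle. summable (\<lambda>j. norm (d j x))"
    by (rule AE_summable_norm[OF dint dsum])
  define g where "g x = (\<Sum>j. d j x)" for x
  have gint: "integrable circle g"
    unfolding g_def by (rule integrable_suminf[OF dint AEs dsum])
  \<comment> \<open>The partial sum telescopes to the Fejer mean for N = 2^j, to which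
    \<open>pos\<close> applies.\<close>
  have pd: "0 \<le> Re (c 0) + (\<Sum>i<j. d i x)" for j x
  proof -
    define e where "e k = Re (c k * cis (- (2 * pi * real k * x)))" for k
    have sg: "(\<Sum>k<2 ^ Suc i. w i k * e k) = (\<Sum>k<2 ^ i. w i k * e k)" for i
      by (rule sum.mono_neutral_right) (auto simp: w_def)
    have di: "d i x = 2 * (\<Sum>k<2 ^ Suc i. w (Suc i) k * e k) - 2 * (\<Sum>k<2 ^ i. w i k * e k)" for i
    proof -
      have "d i x = (\<Sum>k<2 ^ Suc i. Re (complex_of_real (2 * (w (Suc i) k - w i k)) * (c k * cis (- (2 * pi * real k * x)))))"
        unfolding d_def P_def \<beta>_def Re_sum by (simp only: mult.assoc)
      also have "\<dots> = (\<Sum>k<2 ^ Suc i. 2 * (w (Suc i) k * e k) - 2 * (w i k * e k))"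
      proof (intro sum.cong refl)
        fix k
        have "Re (complex_of_real r * z) = r * Re z" for r z by simp
        thus "Re (complex_of_real (2 * (w (Suc i) k - w i k)) * (c k * cis (- (2 * pi * real k * x))))
          = 2 * (w (Suc i) k * e k) - 2 * (w i k * e k)"
          unfolding e_def by (simp only:) (simp only: right_diff_distrib left_diff_distrib mult.assoc)
      qed
      also have "\<dots> = 2 * (\<Sum>k<2 ^ Suc i. w (Suc i) k * e k) - 2 * (\<Sum>k<2 ^ Suc i. w i k * e k)"
        by (simp add: sum_subtractf sum_distrib_left)
      finally show ?thesis using sg by simp
    qed
    have "(\<Sum>i<j. d i x) = 2 * (\<Sum>k<2 ^ j. w j k * e k) - 2 * (\<Sum>k<2 ^ 0. w 0 k * e k)"
      unfolding di by (rule sum_lessThan_telescope)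
    also have "(\<Sum>k<2 ^ 0. w 0 k * e k) = 0" by (simp add: w_def)
    also have "(\<Sum>k<2 ^ j. w j k * e k) = (\<Sum>k=1..<2 ^ j. w j k * e k)"
      by (rule sum.mono_neutral_right) (auto simp: w_def)
    also have "\<dots> = (\<Sum>k=1..<2 ^ j. (1 - real k / 2 ^ j) * e k)"
      by (rule sum.cong) (auto simp: w_def)
    also have "\<dots> = (\<Sum>k=1..<2 ^ j. (real (2 ^ j) - real k) * e k) / 2 ^ j"
      by (simp add: sum_divide_distrib field_simps)
    finally have "Re (c 0) + (\<Sum>i<j. d i x)
        = (real (2 ^ j) * Re (c 0) + 2 * (\<Sum>k=1..<2 ^ j. (real (2 ^ j) - real k) * e k)) / 2 ^ j"
      by (simp add: field_simps)
    thus ?thesis using pos[of "2 ^ j" x] unfolding e_def by simp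
  qed
  have g0: "AE x in circle. 0 \<le> Re (c 0) + g x"
    using AEs
  proof eventually_elim
    case (elim x)
    hence "(\<lambda>j. Re (c 0) + (\<Sum>i<j. d i x)) \<longlonglongrightarrow> Re (c 0) + g x"
      unfolding g_def by (intro tendsto_add[OF tendsto_const] summable_LIMSEQ) (rule summable_norm_cancel)
    thus ?case by (rule LIMSEQ_le_const) (use pd in auto)
  qed
  \<comment> \<open>The truncation changes the limit only on a null set, by \<open>g0\<close>, and
    makes it nonnegative everywhere.\<close>
  define h where "h x = max 0 (Re (c 0) + g x)" for x
  have hg: "AE x in circle. h x = Re (c 0) + g x"
    using g0 by eventually_elim (simp add: h_def)
  have [measurable]: "g \<in> borel_measurable circle" using gint by auto
  have [measurable]: "h \<in> borel_measurable circle" unfolding h_def by measurable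
  have hint: "integrable circle h"
    by (subst integrable_cong_AE[OF _ _ hg]) (use gint in auto)
  show thesis
  proof
    show "integrable circle h" by fact
    show "0 \<le> h x" for x by (simp add: h_def)
    have "(LINT x|circle. \<bar>h x - Re (c 0)\<bar>) = (LINT x|circle. norm (g x))"
      by (rule integral_cong_AE) (measurable, use hg in \<open>eventually_elim, simp\<close>)
    also have "\<dots> \<le> (\<Sum>j. LINT x|circle. norm (d j x))"
    proof -
      have "(LINT x|circle. norm (g x)) \<le> (LINT x|circle. (\<Sum>j. norm (d j x)))"
      proof (rule integral_mono_AE)
        show "integrable circle (\<lambda>x. \<Sum>j. norm (d j x))"
          by (rule integrable_suminf[OF integrable_norm[OF dint]]) (use AEs dsum in simp_all)
        show "AE x in circle. norm (g x) \<le> (\<Sum>j. norm (d j x))"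
          using AEs by eventually_elim (unfold g_def, rule summable_norm)
      qed (use gint in auto)
      also have "\<dots> = (\<Sum>j. LINT x|circle. norm (d j x))"
        by (rule integral_suminf[OF integrable_norm[OF dint]]) (use AEs dsum in simp_all)
      finally show ?thesis .
    qed
    also have "\<dots> \<le> (\<Sum>j. t j)"
      using dL1 dsum sums_summable[OF tsum] by (rule suminf_le)
    finally show "(LINT x|circle. \<bar>h x - Re (c 0)\<bar>) \<le> 5 * \<delta>" using tle by linarith
    fix n :: nat
    let ?E = "\<lambda>x. cis (2 * pi * real n * x)"
    have gE: "(\<lambda>j. LINT x|circle. of_real (d j x) * ?E x) sums (LINT x|circle. (\<Sum>j. of_real (d j x) * ?E x))"
    proof (rule sums_integral)
      show "integrable circle (\<lambda>x. complex_of_real (d j x) * ?E x)" for j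
      proof (rule Bochner_Integration.integrable_bound[OF dint[of j]])
      qed (auto simp: norm_mult)
    qed (use AEs dsum in \<open>simp_all add: norm_mult\<close>)
    have dE: "(LINT x|circle. of_real (d j x) * ?E x)
        = (if n = 0 then 0 else of_real (w (Suc j) n) * c n - of_real (w j n) * c n)" for j
    proof -
      have 1: "of_real (d j x) * ?E x = (\<Sum>k<2 ^ Suc j. \<beta> j k / 2 * cis (2 * pi * of_int (int n - int k) * x)
          + cnj (\<beta> j k) / 2 * cis (2 * pi * of_int (int n + int k) * x))" for x
      proof -
        have "of_real (d j x) = (P j x + cnj (P j x)) / 2"
          by (simp add: complex_add_cnj d_def)
        also have "\<dots> = (\<Sum>k<2 ^ Suc j. \<beta> j k / 2 * cis (- (2 * pi * real k * x)) + cnj (\<beta> j k) / 2 * cis (2 * pi * real k * x))"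
          unfolding P_def by (simp add: sum.distrib[symmetric] sum_divide_distrib add_divide_distrib cis_cnj)
        finally have "of_real (d j x) * ?E x = (\<Sum>k<2 ^ Suc j. (\<beta> j k / 2 * cis (- (2 * pi * real k * x)) + cnj (\<beta> j k) / 2 * cis (2 * pi * real k * x)) * ?E x)"
          by (simp only: sum_distrib_right)
        also have "\<dots> = (\<Sum>k<2 ^ Suc j. \<beta> j k / 2 * cis (2 * pi * of_int (int n - int k) * x)
          + cnj (\<beta> j k) / 2 * cis (2 * pi * of_int (int n + int k) * x))"
        proof (intro sum.cong refl)
          fix k
          have a: "cis (2 * pi * of_int (int n - int k) * x) = cis (- (2 * pi * real k * x)) * ?E x"
            by (simp add: cis_mult algebra_simps)
          have b: "cis (2 * pi * of_int (int n + int k) * x) = cis (2 * pi * real k * x) * ?E x"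
            by (simp add: cis_mult algebra_simps)
          show "(\<beta> j k / 2 * cis (- (2 * pi * real k * x)) + cnj (\<beta> j k) / 2 * cis (2 * pi * real k * x)) * ?E x
            = \<beta> j k / 2 * cis (2 * pi * of_int (int n - int k) * x)
          + cnj (\<beta> j k) / 2 * cis (2 * pi * of_int (int n + int k) * x)"
            unfolding a b by (simp add: algebra_simps)
        qed
        finally show ?thesis .
      qed
      have "(LINT x|circle. of_real (d j x) * ?E x)
        = (\<Sum>k<2 ^ Suc j. \<beta> j k / 2 * (if int n - int k = 0 then 1 else 0) + cnj (\<beta> j k) / 2 * (if int n + int k = 0 then 1 else 0))"
        unfolding 1
        by (subst Bochner_Integration.integral_sum)
           (intro Bochner_Integration.integrable_add integrable_circle_cis,
            simp only: Bochner_Integration.integral_add[OF integrable_circle_cis integrable_circle_cis] integral_mult_right_zero integral_circle_cis)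
      \<comment> \<open>The conjugate half has frequency n + k and could contribute only for n = k =
        0, where \<open>\<beta>\<close> vanishes.\<close>
      also have "\<dots> = (\<Sum>k<2 ^ Suc j. if k = n then \<beta> j k / 2 else 0)"
        by (intro sum.cong refl) (auto simp: \<beta>_def w_def)
      also have "\<dots> = \<beta> j n / 2" by (auto simp: \<beta>_def w_def)
      also have "\<beta> j n / 2 = of_real (w (Suc j) n) * c n - of_real (w j n) * c n"
        by (simp add: \<beta>_def field_simps)
      also have "\<dots> = (if n = 0 then 0 else of_real (w (Suc j) n) * c n - of_real (w j n) * c n)"
        by (simp add: w_def)
      finally show ?thesis .
    qed
    have gn: "(LINT x|circle. (\<Sum>j. of_real (d j x) * ?E x)) = (if n = 0 then 0 else c n)"
    proof (cases "n = 0")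
      case True
      thus ?thesis using gE sums_unique2[OF gE, of 0] unfolding dE by simp
    next
      case False
      have "(\<lambda>j. w j n) \<longlonglongrightarrow> 1"
      proof -
        have "(\<lambda>j. real n / 2 ^ j) \<longlonglongrightarrow> 0"
          using tendsto_mult[OF tendsto_const[of "real n"] LIMSEQ_inverse_realpow_zero[of 2]] by (simp add: field_simps)
        hence "(\<lambda>j. 1 - real n / 2 ^ j) \<longlonglongrightarrow> 1 - 0" by (intro tendsto_intros)
        moreover have "\<forall>\<^sub>F j in sequentially. 1 - real n / 2 ^ j = w j n"
        proof (rule eventually_sequentiallyI[of n])
          fix j assume "n \<le> j"
          hence "n < 2 ^ j" using less_exp[of j] by linarith
          thus "1 - real n / 2 ^ j = w j n" using False by (simp add: w_def)
        qed
        ultimately show ?thesis by (simp add: tendsto_cong)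
      qed
      hence "(\<lambda>j. of_real (w j n) * c n) \<longlonglongrightarrow> of_real 1 * c n" by (intro tendsto_intros)
      \<comment> \<open>The n-th coefficients of the differences telescope from \<open>w 0 n\<close>
        = 0 to the limit 1 of the Fejer weights.\<close>
      from telescope_sums[OF this] have "(\<lambda>j. LINT x|circle. of_real (d j x) * ?E x) sums (c n)"
        unfolding dE using False by (simp add: w_def[of 0])
      from sums_unique2[OF gE this] show ?thesis using False by simp
    qed
    have "(LINT x|circle. of_real (h x) * ?E x) = (LINT x|circle. of_real (Re (c 0)) * ?E x + (\<Sum>j. of_real (d j x) * ?E x))"
    proof (rule integral_cong_AE)
      show "AE x in circle. of_real (h x) * ?E x = of_real (Re (c 0)) * ?E x + (\<Sum>j. of_real (d j x) * ?E x)"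
        using hg AEs
      proof eventually_elim
        case (elim x)
        hence "summable (\<lambda>j. complex_of_real (d j x))" by (intro summable_norm_cancel[of "\<lambda>j. complex_of_real (d j x)"]) simp
        moreover have "summable (\<lambda>j. d j x)" using elim(2) by (rule summable_norm_cancel)
        ultimately have "(\<Sum>j. of_real (d j x) * ?E x) = of_real (g x) * ?E x"
          using suminf_mult2[of "\<lambda>j. complex_of_real (d j x)" "?E x"]
            bounded_linear.suminf[OF bounded_linear_of_real[where ?'a=complex], of "\<lambda>j. d j x"]
          by (simp add: g_def)
        thus ?case using elim(1) by (simp add: distrib_right)
      qed
    qed measurable
    also have "\<dots> = (LINT x|circle. of_real (Re (c 0)) * ?E x) + (LINT x|circle. (\<Sum>j. of_real (d j x) * ?E x))"
    proof (rule Bochner_Integration.integral_add)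
      show "integrable circle (\<lambda>x. \<Sum>j. complex_of_real (d j x) * ?E x)"
      proof (rule integrable_suminf)
        show "integrable circle (\<lambda>x. complex_of_real (d j x) * ?E x)" for j
        proof (rule Bochner_Integration.integrable_bound[OF dint[of j]])
        qed (auto simp: norm_mult)
      qed (use AEs dsum in \<open>simp_all add: norm_mult\<close>)
    qed (rule integrable_circle_cis)
    also have "(LINT x|circle. of_real (Re (c 0)) * ?E x) = (if n = 0 then c 0 else 0)"
    proof -
      have "(LINT x|circle. of_real (Re (c 0)) * ?E x) = of_real (Re (c 0)) * (LINT x|circle. ?E x)"
        by (rule integral_mult_right_zero)
      also have "(LINT x|circle. ?E x) = (if n = 0 then 1 else 0)"
        using integral_circle_cis[of "int n"] by simp
      also have "of_real (Re (c 0)) * (if n = 0 then 1 else 0) = (if n = 0 then c 0 else 0)"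
        using c0 by (auto simp: complex_eq_iff)
      finally show ?thesis .
    qed
    finally show "(LINT x|circle. of_real (h x) * ?E x) = c n" unfolding gn by simp
  qed
qed

subsection \<open>Automorphisms with a circle symmetry\<close>

lemma borel_measurable_cnj [measurable (raw)]:
  "f \<in> borel_measurable M \<Longrightarrow> (\<lambda>x. cnj (f x)) \<in> borel_measurable M"
  by (rule borel_measurable_continuous_on[of cnj]) (intro continuous_intros)

lemma (in prob_space) sums_integral_dominated:
  fixes f :: "nat \<Rightarrow> 'a \<Rightarrow> 'b::{banach,second_countable_topology}"
  assumes [measurable]: "\<And>j. f j \<in> borel_measurable M"
    and b: "\<And>j y. y \<in> space M \<Longrightarrow> norm (f j y) \<le> b j" and sb: "summable b"
  shows "(\<lambda>j. \<integral>y. f j y \<partial>M) sums (\<integral>y. (\<Sum>j. f j y) \<partial>M)"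
proof (rule sums_integral)
  show int: "integrable M (f j)" for j
    by (rule integrable_const_bound[of _ "b j"]) (auto intro!: AE_I2 b)
  show "AE y in M. summable (\<lambda>j. norm (f j y))"
    by (intro AE_I2 summable_comparison_test'[OF sb, of 0]) (use b in auto)
  show "summable (\<lambda>j. \<integral>y. norm (f j y) \<partial>M)"
  proof (rule summable_comparison_test'[OF sb, of 0])
    fix j
    have "(\<integral>y. norm (f j y) \<partial>M) \<le> (\<integral>y. b j \<partial>M)"
      using int b by (intro integral_mono) auto
    thus "norm (\<integral>y. norm (f j y) \<partial>M) \<le> b j" by (simp add: prob_space)
  qed
qed

text \<open>The diagonals at distance k from the main one have N - k entries on either side. The
  induction adds the last row and the last column.\<close>

lemma Toeplitz_double_sum:
  fixes e :: "nat \<Rightarrow> real"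
  shows "(\<Sum>a<N. \<Sum>b<N. e (if b \<le> a then a - b else b - a))
    = real N * e 0 + 2 * (\<Sum>k=1..<N. (real N - real k) * e k)"
proof (induction N)
  case (Suc N)
  have r: "(\<Sum>a<N. e (N - a)) = (\<Sum>k=1..<Suc N. e k)"
    by (rule sum.reindex_bij_witness[of _ "\<lambda>k. N - k" "\<lambda>a. N - a"]) auto
  have "(\<Sum>a<Suc N. \<Sum>b<Suc N. e (if b \<le> a then a - b else b - a))
    = (\<Sum>a<N. \<Sum>b<N. e (if b \<le> a then a - b else b - a)) + (\<Sum>a<N. e (N - a)) + (\<Sum>b<N. e (N - b)) + e 0"
    by (simp add: sum.distrib)
  also have "\<dots> = real N * e 0 + 2 * (\<Sum>k=1..<N. (real N - real k) * e k) + 2 * (\<Sum>k=1..<Suc N. e k) + e 0"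
    unfolding Suc.IH r by simp
  also have "(\<Sum>k=1..<N. (real N - real k) * e k) = (\<Sum>k=1..<Suc N. (real N - real k) * e k)"
    by (cases "N = 0") (auto simp: sum.atLeastLessThan_Suc)
  also have "real N * e 0 + 2 * \<dots> + 2 * (\<Sum>k=1..<Suc N. e k) + e 0
    = real (Suc N) * e 0 + 2 * (\<Sum>k=1..<Suc N. (real (Suc N) - real k) * e k)"
    by (simp add: algebra_simps sum.distrib sum_distrib_left sum_subtractf del: sum.op_ivl_Suc)
  finally show ?case .
qed simp

text \<open>The setting shared by the two skew products. \<open>S'\<close> is a measurable inverse
  that replaces the \<open>inv_into\<close> of \<open>koopman\<close>; the symmetries
  \<open>R u\<close> commute with \<open>S\<close> and separate functions in L2 by the scalar that
  they produce.\<close>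

locale circle_symmetric_automorphism = prob_space M for M :: "'a measure" +
  fixes S S' :: "'a \<Rightarrow> 'a" and R :: "complex \<Rightarrow> 'a \<Rightarrow> 'a"
  assumes S_meas [measurable]: "S \<in> measurable M M"
    and S'_meas [measurable]: "S' \<in> measurable M M"
    and S'_S: "\<And>y. y \<in> space M \<Longrightarrow> S' (S y) = y"
    and S_S': "\<And>y. y \<in> space M \<Longrightarrow> S (S' y) = y"
    and S_pres: "distr M M S = M"
    and R_meas: "\<And>u. cmod u = 1 \<Longrightarrow> R u \<in> measurable M M"
    and R_pres: "\<And>u. cmod u = 1 \<Longrightarrow> distr M M (R u) = M"
    and R_S: "\<And>u y. cmod u = 1 \<Longrightarrow> y \<in> space M \<Longrightarrow> R u (S y) = S (R u y)"
begin

definition flow :: "int \<Rightarrow> 'a \<Rightarrow> 'a" where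
  "flow n = (if n \<ge> 0 then S ^^ nat n else S' ^^ nat (- n))"

lemma S'_space: "y \<in> space M \<Longrightarrow> S' y \<in> space M"
  using S'_meas by (rule measurable_space)

lemma pow_meas [measurable]: "(S ^^ k) \<in> measurable M M" "(S' ^^ k) \<in> measurable M M"
  by (induction k) (auto simp del: funpow.simps simp: funpow.simps(1) funpow_Suc_right intro: measurable_comp[OF S_meas] measurable_comp[OF S'_meas])

lemma pow_pres:
  assumes [measurable]: "T \<in> measurable M M" and "distr M M T = M"
  shows "(T ^^ k) \<in> measurable M M \<and> distr M M (T ^^ k) = M"
proof (induction k)
  case (Suc k)
  hence [measurable]: "(T ^^ k) \<in> measurable M M" by simp
  have "distr M M (T \<circ> (T ^^ k)) = distr (distr M M (T ^^ k)) M T"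
    by (rule distr_distr[symmetric]) measurable
  moreover have "T \<circ> (T ^^ k) \<in> measurable M M" using \<open>(T ^^ k) \<in> measurable M M\<close> assms(1) by (rule measurable_comp)
  ultimately show ?case using Suc assms(2) by (simp add: o_def)
qed (auto simp: distr_id2 id_def)

lemma flow_meas [measurable]: "flow n \<in> measurable M M"
  by (simp add: flow_def)

lemma flow_space: "y \<in> space M \<Longrightarrow> flow n y \<in> space M"
  using flow_meas by (rule measurable_space)

lemma integral_pres:
  fixes f :: "'a \<Rightarrow> 'b::{banach,second_countable_topology}"
  assumes "T \<in> measurable M M" "distr M M T = M" "f \<in> borel_measurable M"
  shows "(\<integral>y. f (T y) \<partial>M) = (\<integral>y. f y \<partial>M)"
  using integral_distr[OF assms(1,3)] assms(2) by simp

lemma R_space: "cmod u = 1 \<Longrightarrow> y \<in> space M \<Longrightarrow> R u y \<in> space M"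
  using R_meas by (rule measurable_space)

lemma R_S':
  assumes "cmod u = 1" "y \<in> space M"
  shows "R u (S' y) = S' (R u y)"
  by (metis R_S R_space S'_S S'_space S_S' assms)

lemma R_flow:
  assumes "cmod u = 1" "y \<in> space M"
  shows "R u (flow n y) = flow n (R u y)"
proof -
  have "R u ((S ^^ k) y) = (S ^^ k) (R u y)" for k
    by (induction k) (use assms in \<open>auto simp: R_S measurable_space[OF pow_meas(1)]\<close>)
  moreover have "R u ((S' ^^ k) y) = (S' ^^ k) (R u y)" for k
    by (induction k) (use assms in \<open>auto simp: R_S' measurable_space[OF pow_meas(2)]\<close>)
  ultimately show ?thesis by (simp add: flow_def)
qed

text \<open>Restricted to the space of \<open>M\<close>, because only there
  \<open>inv_into (space M) S\<close> coincides with \<open>S'\<close>.\<close>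

lemma koopman_eq:
  assumes "y \<in> space M"
  shows "koopman M S n f y = f (flow n y)"
proof -
  have i: "inv_into (space M) S z = S' z" if "z \<in> space M" for z
  proof -
    have "inj_on S (space M)" by (metis S'_S inj_onI)
    from inv_into_f_f[OF this S'_space[OF that]] show ?thesis using that by (simp add: S_S')
  qed
  have "(inv_into (space M) S ^^ k) y = (S' ^^ k) y" for k
    by (induction k) (use assms in \<open>auto simp: i measurable_space[OF pow_meas(2)]\<close>)
  thus ?thesis by (simp add: koopman_def flow_def)
qed

text \<open>These are the Fourier coefficients with nonnegative index of the spectral measure of
  \<open>F\<close>; the others are their conjugates, by \<open>corr_koopman\<close>.\<close>

definition corr :: "('a \<Rightarrow> complex) \<Rightarrow> nat \<Rightarrow> complex" where
  "corr F n = (\<integral>y. F ((S ^^ n) y) * cnj (F y) \<partial>M)"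

lemma integrable_bounded:
  fixes f :: "'a \<Rightarrow> 'b::{banach,second_countable_topology}"
  assumes "f \<in> borel_measurable M" "\<And>y. y \<in> space M \<Longrightarrow> norm (f y) \<le> B"
  shows "integrable M f"
  by (rule integrable_const_bound[of _ B]) (use assms in \<open>auto intro!: AE_I2\<close>)

lemma corr_shift:
  assumes [measurable]: "F \<in> borel_measurable M"
  shows "(\<integral>y. F ((S ^^ a) y) * cnj (F ((S ^^ b) y)) \<partial>M)
    = (if b \<le> a then corr F (a - b) else cnj (corr F (b - a)))"
proof -
  have 1: "(\<integral>y. F ((S ^^ a) y) * cnj (F ((S ^^ b) y)) \<partial>M) = corr F (a - b)" if "b \<le> a" for a b
  proof -
    have "(\<integral>y. F ((S ^^ (a - b)) ((S ^^ b) y)) * cnj (F ((S ^^ b) y)) \<partial>M) = corr F (a - b)"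
      unfolding corr_def
      by (rule integral_pres[OF _ _ , where T="S ^^ b"]) (use pow_pres[OF S_meas S_pres, of b] in auto)
    moreover have "(S ^^ (a - b)) ((S ^^ b) y) = (S ^^ a) y" for y
      using funpow_add[of "a - b" b S] that by simp
    ultimately show ?thesis by simp
  qed
  show ?thesis
  proof (cases "b \<le> a")
    case False
    have "(\<integral>y. F ((S ^^ a) y) * cnj (F ((S ^^ b) y)) \<partial>M)
      = (\<integral>y. cnj (F ((S ^^ b) y) * cnj (F ((S ^^ a) y))) \<partial>M)" by (simp add: mult.commute)
    also have "\<dots> = cnj (\<integral>y. F ((S ^^ b) y) * cnj (F ((S ^^ a) y)) \<partial>M)" by (rule Bochner_Integration.integral_cnj)
    finally show ?thesis using False by (simp add: 1)
  qed (simp add: 1)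
qed

lemma corr_koopman:
  assumes [measurable]: "F \<in> borel_measurable M"
  shows "L2_inner M (koopman M S n F) F = (if n \<ge> 0 then corr F (nat n) else cnj (corr F (nat (- n))))"
proof -
  have e: "L2_inner M (koopman M S n F) F = (\<integral>y. F (flow n y) * cnj (F y) \<partial>M)"
    unfolding L2_inner_def by (rule Bochner_Integration.integral_cong) (auto simp: koopman_eq)
  show ?thesis
  proof (cases "n \<ge> 0")
    case True
    thus ?thesis by (simp add: e flow_def corr_def)
  next
    case False
    let ?k = "nat (- n)"
    have inv: "(S' ^^ k) ((S ^^ k) y) = y" if "y \<in> space M" for k y
    proof (induction k)
      case (Suc k)
      have "(S' ^^ Suc k) ((S ^^ Suc k) y) = (S' ^^ k) (S' (S ((S ^^ k) y)))"
        unfolding funpow_Suc_right[of k S'] funpow.simps(2)[of k S] o_apply ..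
      thus ?case using Suc that by (simp add: S'_S measurable_space[OF pow_meas(1)])
    qed simp
    have "(\<integral>y. F ((S' ^^ ?k) y) * cnj (F y) \<partial>M) = (\<integral>y. F ((S' ^^ ?k) ((S ^^ ?k) y)) * cnj (F ((S ^^ ?k) y)) \<partial>M)"
      by (rule integral_pres[symmetric]) (use pow_pres[OF S_meas S_pres, of ?k] in auto)
    also have "\<dots> = (\<integral>y. cnj (F ((S ^^ ?k) y) * cnj (F y)) \<partial>M)"
      by (rule Bochner_Integration.integral_cong) (auto simp: inv)
    also have "\<dots> = cnj (corr F ?k)" unfolding corr_def by (rule Bochner_Integration.integral_cnj)
    finally show ?thesis using False by (simp add: e flow_def)
  qed
qed

lemma corr_0:
  "corr F 0 = of_real (\<integral>y. (cmod (F y))\<^sup>2 \<partial>M)"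
proof -
  have "corr F 0 = (\<integral>y. complex_of_real ((cmod (F y))\<^sup>2) \<partial>M)"
    unfolding corr_def by (intro Bochner_Integration.integral_cong) (simp_all add: complex_norm_square del: of_real_power)
  thus ?thesis by (simp only: integral_complex_of_real)
qed

text \<open>Positive definiteness: the expression is the squared L2 norm of the sum over a < N of
  the translates of \<open>F\<close> by \<open>S ^^ a\<close> with phases \<open>z a\<close>,
  expanded as a Toeplitz form.\<close>

lemma corr_Fejer_nonneg:
  assumes [measurable]: "F \<in> borel_measurable M" and b: "\<And>y. y \<in> space M \<Longrightarrow> cmod (F y) \<le> B"
  shows "0 \<le> real N * Re (corr F 0)
      + 2 * (\<Sum>k=1..<N. (real N - real k) * Re (corr F k * cis (- (2 * pi * real k * x))))"
proof -
  define z where "z a = cis (- (2 * pi * real a * x))" for a :: nat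
  have zab: "z a * cnj (z b) = (if b \<le> a then z (a - b) else cnj (z (b - a)))" for a b
    by (auto simp: z_def cis_cnj cis_mult of_nat_diff algebra_simps)
  define G where "G y = (\<Sum>a<N. z a * F ((S ^^ a) y))" for y
  have [measurable]: "G \<in> borel_measurable M" unfolding G_def by measurable
  have int: "integrable M (\<lambda>y. F ((S ^^ a) y) * cnj (F ((S ^^ b) y)))" for a b
  proof (rule integrable_bounded[of _ "B * B"])
    fix y assume y: "y \<in> space M"
    have "0 \<le> B" using order_trans[OF norm_ge_zero b[OF y]] .
    thus "norm (F ((S ^^ a) y) * cnj (F ((S ^^ b) y))) \<le> B * B"
      unfolding norm_mult using y by (intro mult_mono) (auto intro!: b measurable_space[OF pow_meas(1)])
  qed measurable
  define e where "e k = Re (corr F k * z k)" for k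
  have "(\<integral>y. complex_of_real ((cmod (G y))\<^sup>2) \<partial>M) = (\<integral>y. (\<Sum>a<N. \<Sum>b<N. (z a * cnj (z b)) * (F ((S ^^ a) y) * cnj (F ((S ^^ b) y)))) \<partial>M)"
    unfolding complex_norm_square G_def
    by (simp add: sum_product mult_ac)
  also have "\<dots> = (\<Sum>a<N. \<Sum>b<N. (z a * cnj (z b)) * (\<integral>y. F ((S ^^ a) y) * cnj (F ((S ^^ b) y)) \<partial>M))"
    using int by (simp add: Bochner_Integration.integral_sum)
  also have "\<dots> = (\<Sum>a<N. \<Sum>b<N. if b \<le> a then corr F (a - b) * z (a - b) else cnj (corr F (b - a) * z (b - a)))"
    by (intro sum.cong refl) (simp add: corr_shift zab)
  finally have "complex_of_real (\<integral>y. (cmod (G y))\<^sup>2 \<partial>M)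
     = (\<Sum>a<N. \<Sum>b<N. if b \<le> a then corr F (a - b) * z (a - b) else cnj (corr F (b - a) * z (b - a)))"
    by (simp only: integral_complex_of_real)
  hence "(\<integral>y. (cmod (G y))\<^sup>2 \<partial>M) = Re (\<Sum>a<N. \<Sum>b<N. if b \<le> a then corr F (a - b) * z (a - b) else cnj (corr F (b - a) * z (b - a)))"
    by (metis Re_complex_of_real)
  also have "\<dots> = (\<Sum>a<N. \<Sum>b<N. e (if b \<le> a then a - b else b - a))"
    unfolding Re_sum by (intro sum.cong refl) (auto simp: e_def)
  also have "\<dots> = real N * e 0 + 2 * (\<Sum>k=1..<N. (real N - real k) * e k)"
    by (rule Toeplitz_double_sum)
  finally have "0 \<le> real N * e 0 + 2 * (\<Sum>k=1..<N. (real N - real k) * e k)"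
    by (metis (no_types, lifting) integral_nonneg_AE AE_I2 zero_le_power2)
  thus ?thesis by (simp add: e_def z_def)
qed

text \<open>Where the density vanishes, its distance from the constant \<open>corr F 0\<close> is
  this constant itself. Markov's inequality therefore turns the L1 estimate of
  \<open>Fejer_density\<close> into a bound for the zero set.\<close>

lemma corr_density:
  assumes [measurable]: "F \<in> borel_measurable M" and b: "\<And>y. y \<in> space M \<Longrightarrow> cmod (F y) \<le> B"
    and pos: "0 < (\<integral>y. (cmod (F y))\<^sup>2 \<partial>M)" and "\<epsilon> > 0"
    and c: "\<And>n. n \<ge> 1 \<Longrightarrow> cmod (corr F n) \<le> \<epsilon> * (\<integral>y. (cmod (F y))\<^sup>2 \<partial>M) / real n"
  obtains h :: "real \<Rightarrow> real" where "integrable circle h" "\<And>x. 0 \<le> h x"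
    "\<And>n. (LINT x|circle. of_real (h x) * cis (2 * pi * real n * x)) = corr F n"
    "measure circle {x \<in> space circle. h x = 0} \<le> 5 * \<epsilon>"
proof -
  interpret C: prob_space circle by (rule prob_space_circle)
  define I where "I = (\<integral>y. (cmod (F y))\<^sup>2 \<partial>M)"
  have I: "I > 0" using pos by (simp add: I_def)
  obtain h where h: "integrable circle h" "\<And>x. 0 \<le> h x"
    "\<And>n. (LINT x|circle. of_real (h x) * cis (2 * pi * real n * x)) = corr F n"
    "(LINT x|circle. \<bar>h x - Re (corr F 0)\<bar>) \<le> 5 * (\<epsilon> * I)"
  proof (rule Fejer_density[of "corr F" "\<epsilon> * I"])
    show "0 < \<epsilon> * I" using \<open>\<epsilon> > 0\<close> I by simp
    show "0 \<le> real N * Re (corr F 0) + 2 * (\<Sum>k=1..<N. (real N - real k) * Re (corr F k * cis (- (2 * pi * real k * x))))" for N x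
      using assms(1) b by (rule corr_Fejer_nonneg)
  qed (use c in \<open>auto simp: corr_0 I_def\<close>)
  have [measurable]: "h \<in> borel_measurable circle" using h(1) by auto
  have Z: "{x \<in> space circle. h x = 0} \<in> sets circle" by measurable
  have "I * measure circle {x \<in> space circle. h x = 0} = (LINT x|circle. I * indicator {x \<in> space circle. h x = 0} x)"
    using Z sets.sets_into_space[OF Z] by (simp add: Int_absorb2 del: space_circle)
  also have "\<dots> \<le> (LINT x|circle. \<bar>h x - Re (corr F 0)\<bar>)"
  proof (rule integral_mono)
    show "integrable circle (\<lambda>x. I * indicator {x \<in> space circle. h x = 0} x)"
      using integrable_real_indicator[OF Z] by (simp add: C.emeasure_eq_measure del: space_circle)
  next
    fix x assume "x \<in> space circle"
    show "I * indicator {x \<in> space circle. h x = 0} x \<le> \<bar>h x - Re (corr F 0)\<bar>"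
      using I by (auto simp: indicator_def corr_0 I_def)
  qed (use h(1) in auto)
  also have "\<dots> \<le> 5 * (\<epsilon> * I)" by fact
  finally have "measure circle {x \<in> space circle. h x = 0} \<le> 5 * \<epsilon>"
    using I by (simp add: field_simps)
  with h show thesis using that by blast
qed

text \<open>The relation passes from \<open>G\<close> to its translates because \<open>R u\<close>
  commutes with the flow, and to L2 limits because \<open>R u\<close> preserves the measure. Hence a
  whole cyclic space lies in one eigenspace of the symmetry.\<close>

lemma cyclic_space_equivariant:
  assumes [measurable]: "G \<in> borel_measurable M" and b: "\<And>y. y \<in> space M \<Longrightarrow> cmod (G y) \<le> B"
    and u: "cmod u = 1" and s: "cmod s = 1"
    and eq: "\<And>y. y \<in> space M \<Longrightarrow> G (R u y) = s * G y"
    and h: "h \<in> cyclic_space M (koopman M S) G"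
  shows "AE y in M. h (R u y) = s * h y"
proof -
  note [measurable] = R_meas[OF u]
  have [measurable]: "h \<in> borel_measurable M" and hi: "integrable M (\<lambda>y. (cmod (h y))\<^sup>2)"
    using h by (auto simp: cyclic_space_def L2_def)
  have sq2: "(cmod (x + y))\<^sup>2 \<le> 2 * (cmod x)\<^sup>2 + 2 * (cmod y)\<^sup>2" for x y
  proof -
    have "(cmod (x + y))\<^sup>2 \<le> (cmod x + cmod y)\<^sup>2" by (intro power_mono norm_triangle_ineq) simp
    also have "\<dots> \<le> 2 * (cmod x)\<^sup>2 + 2 * (cmod y)\<^sup>2"
      using sum_squares_ge_zero[of "cmod x - cmod y" 0] by (simp add: power2_eq_square algebra_simps)
    finally show ?thesis .
  qed
  have hRi: "integrable M (\<lambda>y. (cmod (h (R u y)))\<^sup>2)"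
    using integrable_distr_eq[OF R_meas[OF u], of "\<lambda>y. (cmod (h y))\<^sup>2"] hi R_pres[OF u] by simp
  have di: "integrable M (\<lambda>y. (cmod (h (R u y) - s * h y))\<^sup>2)"
  proof (rule Bochner_Integration.integrable_bound)
    show "integrable M (\<lambda>y. 2 * (cmod (h (R u y)))\<^sup>2 + 2 * (cmod (h y))\<^sup>2)" using hRi hi by simp
    show "AE y in M. norm ((cmod (h (R u y) - s * h y))\<^sup>2) \<le> norm (2 * (cmod (h (R u y)))\<^sup>2 + 2 * (cmod (h y))\<^sup>2)"
      using sq2[of "h (R u y)" "- s * h y" for y] s by (auto simp: norm_mult)
  qed measurable
  have "(\<integral>y. (cmod (h (R u y) - s * h y))\<^sup>2 \<partial>M) \<le> 4 * \<epsilon>\<^sup>2" if "\<epsilon> > 0" for \<epsilon>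
  proof -
    have "\<exists>(F::int set) c. finite F \<and> L2_norm M (\<lambda>x. h x - (\<Sum>n\<in>F. c n * koopman M S n G x)) < \<epsilon>"
      using h[unfolded cyclic_space_def, THEN CollectD, THEN conjunct2, rule_format, OF that] .
    then obtain Fs c where F: "finite (Fs :: int set)"
      "L2_norm M (\<lambda>x. h x - (\<Sum>n\<in>Fs. c n * koopman M S n G x)) < \<epsilon>" by (elim exE conjE)
    define A where "A y = (\<Sum>n\<in>Fs. c n * G (flow n y))" for y
    have [measurable]: "A \<in> borel_measurable M" unfolding A_def by measurable
    have Ab: "cmod (A y) \<le> (\<Sum>n\<in>Fs. cmod (c n) * B)" if "y \<in> space M" for y
      unfolding A_def using that
      by (intro order_trans[OF norm_sum] sum_mono) (auto simp: norm_mult intro!: mult_left_mono b flow_space)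
    have Ai: "integrable M (\<lambda>y. (cmod (A y))\<^sup>2)"
      by (rule integrable_bounded[of _ "(\<Sum>n\<in>Fs. cmod (c n) * B)\<^sup>2"]) (auto intro!: power_mono Ab)
    have hAi: "integrable M (\<lambda>y. (cmod (h y - A y))\<^sup>2)"
    proof (rule Bochner_Integration.integrable_bound)
      show "integrable M (\<lambda>y. 2 * (cmod (h y))\<^sup>2 + 2 * (cmod (A y))\<^sup>2)" using Ai hi by simp
      show "AE y in M. norm ((cmod (h y - A y))\<^sup>2) \<le> norm (2 * (cmod (h y))\<^sup>2 + 2 * (cmod (A y))\<^sup>2)"
        using sq2[of "h y" "- A y" for y] by auto
    qed measurable
    have hARi: "integrable M (\<lambda>y. (cmod (h (R u y) - A (R u y)))\<^sup>2)"
      using integrable_distr_eq[OF R_meas[OF u], of "\<lambda>y. (cmod (h y - A y))\<^sup>2"] hAi R_pres[OF u] by simp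
    have "sqrt (\<integral>y. (cmod (h y - A y))\<^sup>2 \<partial>M) = L2_norm M (\<lambda>x. h x - (\<Sum>n\<in>Fs. c n * koopman M S n G x))"
      unfolding L2_norm_def by (intro arg_cong[where f=sqrt] Bochner_Integration.integral_cong refl) (simp add: A_def koopman_eq)
    hence "sqrt (\<integral>y. (cmod (h y - A y))\<^sup>2 \<partial>M) < \<epsilon>" using F(2) by simp
    hence le: "(\<integral>y. (cmod (h y - A y))\<^sup>2 \<partial>M) \<le> \<epsilon>\<^sup>2"
      using real_sqrt_less_iff[of _ "\<epsilon>\<^sup>2"] that by simp
    have AR: "A (R u y) = s * A y" if "y \<in> space M" for y
      using that u by (simp add: A_def R_flow[symmetric] eq flow_space sum_distrib_left mult_ac)
    have "(\<integral>y. (cmod (h (R u y) - s * h y))\<^sup>2 \<partial>M) \<le> (\<integral>y. 2 * (cmod (h (R u y) - A (R u y)))\<^sup>2 + 2 * (cmod (h y - A y))\<^sup>2 \<partial>M)"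
    proof (rule integral_mono[OF di])
      fix y assume y: "y \<in> space M"
      have "cmod (s * (A y - h y)) = cmod (h y - A y)"
        using s by (simp add: norm_mult norm_minus_commute)
      thus "(cmod (h (R u y) - s * h y))\<^sup>2 \<le> 2 * (cmod (h (R u y) - A (R u y)))\<^sup>2 + 2 * (cmod (h y - A y))\<^sup>2"
        using sq2[of "h (R u y) - A (R u y)" "s * (A y - h y)"] AR[OF y] by (simp add: algebra_simps)
    qed (use hAi hARi in auto)
    also have "\<dots> = 2 * (\<integral>y. (cmod (h (R u y) - A (R u y)))\<^sup>2 \<partial>M) + 2 * (\<integral>y. (cmod (h y - A y))\<^sup>2 \<partial>M)"
      using hAi hARi by simp
    also have "(\<integral>y. (cmod (h (R u y) - A (R u y)))\<^sup>2 \<partial>M) = (\<integral>y. (cmod (h y - A y))\<^sup>2 \<partial>M)"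
      by (rule integral_pres[OF R_meas[OF u] R_pres[OF u], of "\<lambda>y. (cmod (h y - A y))\<^sup>2"]) measurable
    finally show ?thesis using le by simp
  qed
  note * = this
  have "(\<integral>y. (cmod (h (R u y) - s * h y))\<^sup>2 \<partial>M) \<le> 0"
  proof (rule field_le_epsilon)
    fix e :: real assume "e > 0"
    thus "(\<integral>y. (cmod (h (R u y) - s * h y))\<^sup>2 \<partial>M) \<le> 0 + e" using *[of "sqrt e / 2"] by (simp add: power_divide)
  qed
  hence "(\<integral>y. (cmod (h (R u y) - s * h y))\<^sup>2 \<partial>M) = 0"
    by (intro antisym integral_nonneg_AE) auto
  hence "AE y in M. (cmod (h (R u y) - s * h y))\<^sup>2 = 0"
    using integral_nonneg_eq_0_iff_AE[OF di] by auto
  thus ?thesis by eventually_elim simp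
qed

text \<open>The change of variables by \<open>R u\<close> multiplies the inner product by
  \<open>s * cnj t\<close>.\<close>

lemma equivariant_orthogonal:
  assumes [measurable]: "h \<in> borel_measurable M" "k \<in> borel_measurable M"
    and u: "cmod u = 1" and "s * cnj t \<noteq> 1"
    and h: "AE y in M. h (R u y) = s * h y" and k: "AE y in M. k (R u y) = t * k y"
  shows "(\<integral>y. h y * cnj (k y) \<partial>M) = 0"
proof -
  note [measurable] = R_meas[OF u]
  have "(\<integral>y. h y * cnj (k y) \<partial>M) = (\<integral>y. h (R u y) * cnj (k (R u y)) \<partial>M)"
    by (rule integral_pres[OF R_meas[OF u] R_pres[OF u], of "\<lambda>y. h y * cnj (k y)", symmetric]) measurable
  also have "\<dots> = (\<integral>y. (s * cnj t) * (h y * cnj (k y)) \<partial>M)"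
    by (rule integral_cong_AE) (measurable, use h k in \<open>eventually_elim, simp\<close>)
  also have "\<dots> = (s * cnj t) * (\<integral>y. h y * cnj (k y) \<partial>M)" by simp
  finally have "(1 - s * cnj t) * (\<integral>y. h y * cnj (k y) \<partial>M) = 0" by (simp add: algebra_simps)
  with assms(4) show ?thesis by simp
qed

end

section \<open>Packets of high weight and the generators built from them\<close>

context circle_symmetric_automorphism
begin

text \<open>\<open>m\<close> is the character by which the symmetries act, and
  \<open>\<epsilon>\<close> measures the correlations relative to the one at 0, so that scaling
  \<open>F\<close> does not matter. The bound 1 makes series of packets converge uniformly.\<close>

definition equivariant_packet :: "real \<Rightarrow> nat \<Rightarrow> ('a \<Rightarrow> complex) \<Rightarrow> bool" where
  "equivariant_packet \<epsilon> m F \<longleftrightarrow> F \<in> borel_measurable M \<and> (\<forall>y\<in>space M. cmod (F y) \<le> 1) \<and>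
     (\<forall>u. \<forall>y\<in>space M. cmod u = 1 \<longrightarrow> F (R u y) = u ^ m * F y) \<and>
     0 < (\<integral>y. (cmod (F y))\<^sup>2 \<partial>M) \<and>
     (\<forall>n\<ge>1. cmod (corr F n) \<le> \<epsilon> * (\<integral>y. (cmod (F y))\<^sup>2 \<partial>M) / real n)"

text \<open>Packets of different weight are orthogonal, also after translation, so the correlations
  of the series are sums of those of its terms and the spectral densities add up. The j-th density
  vanishes on a set of measure at most 5 / 2^j; the common zero set is null, which makes the total
  density positive almost everywhere.\<close>

lemma packet_series:
  assumes F: "\<And>j. equivariant_packet (1 / 2 ^ j) (m j) (F j)" and inj: "inj m"
  defines "g \<equiv> \<lambda>y. \<Sum>j. F j y / 2 ^ j"
  shows "g \<in> borel_measurable M" "\<And>y. y \<in> space M \<Longrightarrow> cmod (g y) \<le> 2"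
    "\<And>u s y. cmod u = 1 \<Longrightarrow> y \<in> space M \<Longrightarrow> (\<And>j. u ^ m j = s) \<Longrightarrow> g (R u y) = s * g y"
    "\<exists>\<sigma>. is_spectral_measure M (koopman M S) g \<sigma> \<and>
        absolutely_continuous circle \<sigma> \<and> absolutely_continuous \<sigma> circle"
proof -
  have Fm [measurable]: "F j \<in> borel_measurable M" and Fb: "y \<in> space M \<Longrightarrow> cmod (F j y) \<le> 1"
    and FR: "cmod u = 1 \<Longrightarrow> y \<in> space M \<Longrightarrow> F j (R u y) = u ^ m j * F j y"
    and Fpos: "0 < (\<integral>y. (cmod (F j y))\<^sup>2 \<partial>M)"
    and Fc: "n \<ge> 1 \<Longrightarrow> cmod (corr (F j) n) \<le> 1 / 2 ^ j * (\<integral>y. (cmod (F j y))\<^sup>2 \<partial>M) / real n" for j y u n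
    using F[of j] unfolding equivariant_packet_def by blast+
  show [measurable]: "g \<in> borel_measurable M" unfolding g_def by measurable
  have s2: "(\<lambda>j. (1 / 2) ^ j) sums (2::real)" using geometric_sums[of "1 / 2 :: real"] by simp
  have nF: "norm (F j y / 2 ^ j) \<le> (1 / 2) ^ j" if "y \<in> space M" for j y
    using Fb[OF that, of j] by (simp add: norm_divide norm_power field_simps)
  have sF: "summable (\<lambda>j. norm (F j y / 2 ^ j))" if "y \<in> space M" for y
    by (rule summable_comparison_test'[OF sums_summable[OF s2], of 0]) (use nF[OF that] in simp)
  show gb: "cmod (g y) \<le> 2" if "y \<in> space M" for y
  proof -
    have "cmod (g y) \<le> (\<Sum>j. norm (F j y / 2 ^ j))" unfolding g_def by (rule summable_norm[OF sF[OF that]])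
    also have "\<dots> \<le> (\<Sum>j. (1 / 2) ^ j)" using nF[OF that] sF[OF that] sums_summable[OF s2] by (rule suminf_le)
    finally show ?thesis using s2 by (simp add: sums_iff)
  qed
  show "g (R u y) = s * g y" if "cmod u = 1" "y \<in> space M" "\<And>j. u ^ m j = s" for u s y
  proof -
    have "g (R u y) = (\<Sum>j. s * (F j y / 2 ^ j))"
      unfolding g_def using that by (simp add: FR)
    also have "\<dots> = s * g y" unfolding g_def
      by (rule suminf_mult) (rule summable_norm_cancel[OF sF[OF that(2)]])
    finally show ?thesis .
  qed
  have cross: "(\<integral>y. F i ((S ^^ n) y) * cnj (F j y) \<partial>M) = 0" if "i \<noteq> j" for i j n
  proof -
    have ne: "m i \<noteq> m j" using inj that by (simp add: inj_eq)
    \<comment> \<open>Chosen so that the two characters at \<open>u\<close> differ by the factor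
      exp(i pi) = -1.\<close>
    define u where "u = cis (pi / (real (m i) - real (m j)))"
    have u: "cmod u = 1" by (simp add: u_def)
    show ?thesis
    proof (rule equivariant_orthogonal[OF _ _ u, where s="u ^ m i" and t="u ^ m j"])
      have "u ^ m i * cnj (u ^ m j) = cis ((real (m i) - real (m j)) * (pi / (real (m i) - real (m j))))"
        by (simp add: u_def Complex.DeMoivre cis_cnj cis_mult algebra_simps diff_divide_distrib)
      also have "\<dots> = -1" using ne by simp
      finally show "u ^ m i * cnj (u ^ m j) \<noteq> 1" by simp
      show "AE y in M. F i ((S ^^ n) (R u y)) = u ^ m i * F i ((S ^^ n) y)"
        using R_flow[OF u, of _ "int n"] FR[OF u flow_space, of _ i "int n"]
        by (intro AE_I2) (simp add: flow_def)
      show "AE y in M. F j (R u y) = u ^ m j * F j y"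
        using FR[OF u] by (intro AE_I2) simp
    qed measurable
  qed
  \<comment> \<open>Only the diagonal terms survive, and each carries 2^i twice, once from either
    factor of the correlation.\<close>
  have corrg: "(\<lambda>i. corr (F i) n / 4 ^ i) sums corr g n" for n
  proof -
    have inner: "(\<integral>y. F i ((S ^^ n) y) / 2 ^ i * cnj (g y) \<partial>M) = corr (F i) n / 4 ^ i" for i
    proof -
      have "(\<lambda>j. \<integral>y. F i ((S ^^ n) y) / 2 ^ i * cnj (F j y / 2 ^ j) \<partial>M) sums
        (\<integral>y. (\<Sum>j. F i ((S ^^ n) y) / 2 ^ i * cnj (F j y / 2 ^ j)) \<partial>M)"
      proof (rule sums_integral_dominated[OF _ _ sums_summable[OF s2]])
        fix j y assume y: "y \<in> space M"
        have "norm (F i ((S ^^ n) y) / 2 ^ i * cnj (F j y / 2 ^ j)) = norm (F i ((S ^^ n) y) / 2 ^ i) * norm (F j y / 2 ^ j)"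
          by (simp only: norm_mult complex_mod_cnj)
        also have "\<dots> \<le> 1 * (1 / 2) ^ j"
          using nF[OF measurable_space[OF pow_meas(1) y], of i n] power_le_one[of "1/2::real" i] y
          by (intro mult_mono nF) auto
        finally show "norm (F i ((S ^^ n) y) / 2 ^ i * cnj (F j y / 2 ^ j)) \<le> (1 / 2) ^ j" by simp
      qed measurable
      also have "(\<lambda>j. \<integral>y. F i ((S ^^ n) y) / 2 ^ i * cnj (F j y / 2 ^ j) \<partial>M)
        = (\<lambda>j. if j = i then corr (F j) n / 4 ^ j else 0)"
      proof
        fix j
        have "(\<integral>y. F i ((S ^^ n) y) / 2 ^ i * cnj (F j y / 2 ^ j) \<partial>M)
          = (\<integral>y. 1 / (2 ^ i * 2 ^ j) * (F i ((S ^^ n) y) * cnj (F j y)) \<partial>M)" by simp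
        also have "\<dots> = 1 / (2 ^ i * 2 ^ j) * (\<integral>y. F i ((S ^^ n) y) * cnj (F j y) \<partial>M)"
          by (rule integral_mult_right_zero)
        also have "\<dots> = (if j = i then corr (F j) n / 4 ^ j else 0)"
          using cross[of i j n] by (auto simp: corr_def power_mult_distrib[symmetric])
        finally show "(\<integral>y. F i ((S ^^ n) y) / 2 ^ i * cnj (F j y / 2 ^ j) \<partial>M) = (if j = i then corr (F j) n / 4 ^ j else 0)" .
      qed
      also have "(\<integral>y. (\<Sum>j. F i ((S ^^ n) y) / 2 ^ i * cnj (F j y / 2 ^ j)) \<partial>M) = (\<integral>y. F i ((S ^^ n) y) / 2 ^ i * cnj (g y) \<partial>M)"
      proof (rule Bochner_Integration.integral_cong[OF refl])
        fix y assume y: "y \<in> space M"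
        have "(\<lambda>j. F j y / 2 ^ j) sums g y"
          unfolding g_def by (rule summable_sums[OF summable_norm_cancel[OF sF[OF y]]])
        hence "(\<lambda>j. F i ((S ^^ n) y) / 2 ^ i * cnj (F j y / 2 ^ j)) sums (F i ((S ^^ n) y) / 2 ^ i * cnj (g y))"
          by (intro sums_mult bounded_linear.sums[OF bounded_linear_cnj])
        thus "(\<Sum>j. F i ((S ^^ n) y) / 2 ^ i * cnj (F j y / 2 ^ j)) = F i ((S ^^ n) y) / 2 ^ i * cnj (g y)"
          by (simp add: sums_iff)
      qed
      finally show ?thesis
        using sums_single[of i "\<lambda>j. corr (F j) n / 4 ^ j"] sums_unique2 by blast
    qed
    have "(\<lambda>i. \<integral>y. F i ((S ^^ n) y) / 2 ^ i * cnj (g y) \<partial>M) sums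
        (\<integral>y. (\<Sum>i. F i ((S ^^ n) y) / 2 ^ i * cnj (g y)) \<partial>M)"
    proof (rule sums_integral_dominated[OF _ _ sums_summable[OF sums_mult2[OF s2, of 2]]])
      fix i y assume y: "y \<in> space M"
      have "norm (F i ((S ^^ n) y) / 2 ^ i * cnj (g y)) = norm (F i ((S ^^ n) y) / 2 ^ i) * norm (g y)"
        by (simp only: norm_mult complex_mod_cnj)
      also have "\<dots> \<le> (1 / 2) ^ i * 2"
        using y by (intro mult_mono nF gb measurable_space[OF pow_meas(1)]) auto
      finally show "norm (F i ((S ^^ n) y) / 2 ^ i * cnj (g y)) \<le> (1 / 2) ^ i * 2" .
    qed measurable
    also have "(\<integral>y. (\<Sum>i. F i ((S ^^ n) y) / 2 ^ i * cnj (g y)) \<partial>M) = corr g n"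
      unfolding corr_def
    proof (rule Bochner_Integration.integral_cong[OF refl])
      fix y assume y: "y \<in> space M"
      have "(\<lambda>i. F i ((S ^^ n) y) / 2 ^ i) sums g ((S ^^ n) y)"
        unfolding g_def by (rule summable_sums[OF summable_norm_cancel[OF sF]]) (use y in \<open>auto intro: measurable_space[OF pow_meas(1)]\<close>)
      from sums_mult2[OF this, of "cnj (g y)"]
      show "(\<Sum>i. F i ((S ^^ n) y) / 2 ^ i * cnj (g y)) = g ((S ^^ n) y) * cnj (g y)" by (simp add: sums_iff)
    qed
    finally show ?thesis unfolding inner .
  qed
  have "\<exists>h. \<forall>j. integrable circle (h j) \<and> (\<forall>x. 0 \<le> h j x) \<and>
    (\<forall>n. (LINT x|circle. of_real (h j x) * cis (2 * pi * real n * x)) = corr (F j) n) \<and>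
    measure circle {x \<in> space circle. h j x = 0} \<le> 5 * (1 / 2 ^ j)"
  proof (rule choice, rule allI)
    fix j
    show "\<exists>h. integrable circle h \<and> (\<forall>x. 0 \<le> h x) \<and>
      (\<forall>n. (LINT x|circle. of_real (h x) * cis (2 * pi * real n * x)) = corr (F j) n) \<and>
      measure circle {x \<in> space circle. h x = 0} \<le> 5 * (1 / 2 ^ j)"
      by (rule corr_density[OF Fm Fb Fpos _ Fc]) (auto simp del: space_circle)
  qed
  then obtain h where hi: "\<And>j. integrable circle (h j)" and h0: "\<And>j x. 0 \<le> h j x"
    and hn: "\<And>j n. (LINT x|circle. of_real (h j x) * cis (2 * pi * real n * x)) = corr (F j) n"
    and hz: "\<And>j. measure circle {x \<in> space circle. h j x = 0} \<le> 5 * (1 / 2 ^ j)" by blast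
  interpret C: prob_space circle by (rule prob_space_circle)
  have hm [measurable]: "h j \<in> borel_measurable circle" for j using hi[of j] by auto
  have hint: "(LINT x|circle. h j x) \<le> 1" for j
  proof -
    have "complex_of_real (LINT x|circle. h j x) = corr (F j) 0"
      using hn[of j 0] by (simp add: integral_complex_of_real)
    also have "\<dots> = of_real (\<integral>y. (cmod (F j y))\<^sup>2 \<partial>M)" by (rule corr_0)
    finally have "(LINT x|circle. h j x) = (\<integral>y. (cmod (F j y))\<^sup>2 \<partial>M)" by (simp only: of_real_eq_iff)
    also have "\<dots> \<le> (\<integral>y. 1 \<partial>M)"
    proof (rule integral_mono)
      show "integrable M (\<lambda>y. (cmod (F j y))\<^sup>2)"
        by (rule integrable_bounded[of _ 1]) (use Fb in \<open>auto intro: power_le_one\<close>)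
    qed (use Fb in \<open>auto intro: power_le_one\<close>)
    finally show ?thesis by (simp add: prob_space)
  qed
  define f where "f j x = h j x / 4 ^ j" for j x
  have fi: "integrable circle (f j)" for j unfolding f_def using hi by simp
  have f0: "0 \<le> f j x" for j x by (simp add: f_def h0)
  have fsum: "summable (\<lambda>j. LINT x|circle. norm (f j x))"
  proof (rule summable_comparison_test'[OF sums_summable[OF s2], of 0])
    fix j
    have "(LINT x|circle. norm (f j x)) = (LINT x|circle. h j x) / 4 ^ j" using h0 by (simp add: f_def)
    also have "\<dots> \<le> 1 / 4 ^ j" using hint[of j] by (intro divide_right_mono) auto
    also have "\<dots> \<le> (1 / 2) ^ j" by (simp add: power_divide power_mono frac_le)
    finally show "norm (LINT x|circle. norm (f j x)) \<le> (1 / 2) ^ j" by simp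
  qed
  have fAE: "AE x in circle. summable (\<lambda>j. norm (f j x))" by (rule AE_summable_norm[OF fi fsum])
  define H where "H x = (\<Sum>j. f j x)" for x
  have Hi: "integrable circle H" unfolding H_def by (rule integrable_suminf[OF fi fAE fsum])
  have [measurable]: "H \<in> borel_measurable circle" using Hi by auto
  have H0: "AE x in circle. 0 \<le> H x"
    using fAE by eventually_elim (auto simp: H_def f0 intro!: suminf_nonneg)
  have "AE x in circle. \<exists>j. h j x \<noteq> 0"
  proof -
    let ?Z = "{x \<in> space circle. \<forall>j. h j x = 0}"
    have Zm: "?Z \<in> sets circle" by measurable
    have "measure circle ?Z \<le> 0"
    proof (rule LIMSEQ_le_const)
      show "(\<lambda>j. 5 * (1 / 2) ^ j) \<longlonglongrightarrow> (0::real)"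
        using tendsto_mult_right_zero[OF LIMSEQ_power_zero[of "1/2::real"], of 5] by simp
      have "measure circle ?Z \<le> measure circle {x \<in> space circle. h j x = 0}" for j
        by (rule C.finite_measure_mono) (auto simp del: space_circle)
      thus "\<exists>N. \<forall>j\<ge>N. measure circle ?Z \<le> 5 * (1 / 2) ^ j"
        by (intro exI[of _ 0] allI impI) (use hz order_trans in \<open>simp add: power_divide del: space_circle; blast\<close>)
    qed
    hence "?Z \<in> null_sets circle"
      using Zm antisym[OF _ measure_nonneg[of circle ?Z]]
      by (intro null_setsI) (simp_all add: C.emeasure_eq_measure del: space_circle)
    thus ?thesis by (rule AE_I') auto
  qed
  hence Hpos: "AE x in circle. 0 < H x" using fAE
  proof eventually_elim
    case (elim x)
    then obtain j where "h j x \<noteq> 0" by blast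
    hence "0 < f j x" using h0[of j x] by (simp add: f_def)
    moreover have "summable (\<lambda>j. f j x)" using elim(2) by (rule summable_norm_cancel)
    ultimately show "0 < H x" unfolding H_def using f0 by (intro suminf_pos2[where i=j]) auto
  qed
  define \<sigma> where "\<sigma> = density circle (\<lambda>x. ennreal (H x))"
  have spec: "(LINT x|\<sigma>. cis (2 * pi * real n * x)) = corr g n" for n
  proof -
    let ?E = "\<lambda>x. cis (2 * pi * real n * x)"
    have fE: "integrable circle (\<lambda>x. complex_of_real (f j x) * ?E x)" for j
    proof (rule Bochner_Integration.integrable_bound[OF fi[of j]])
    qed (auto simp: norm_mult norm_divide norm_power f_def)
    have "(LINT x|\<sigma>. ?E x) = (LINT x|circle. H x *\<^sub>R ?E x)"
      unfolding \<sigma>_def by (rule integral_density) (use H0 in auto)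
    also have "\<dots> = (LINT x|circle. (\<Sum>j. complex_of_real (f j x) * ?E x))"
    proof (rule integral_cong_AE)
      show "AE x in circle. H x *\<^sub>R ?E x = (\<Sum>j. complex_of_real (f j x) * ?E x)"
        using fAE
      proof eventually_elim
        case (elim x)
        hence "(\<lambda>j. f j x) sums H x" unfolding H_def by (intro summable_sums) (rule summable_norm_cancel)
        hence "(\<lambda>j. complex_of_real (f j x) * ?E x) sums (complex_of_real (H x) * ?E x)"
          by (intro sums_mult2 sums_of_real)
        thus ?case by (simp add: sums_iff scaleR_conv_of_real)
      qed
    qed (use fE in measurable)
    finally have *: "(\<lambda>j. LINT x|circle. complex_of_real (f j x) * ?E x) sums (LINT x|\<sigma>. ?E x)"
      using sums_integral[OF fE] fAE fsum by (simp add: norm_mult)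
    have "(LINT x|circle. complex_of_real (f j x) * ?E x) = corr (F j) n / 4 ^ j" for j
    proof -
      have "(LINT x|circle. complex_of_real (f j x) * ?E x) = (LINT x|circle. (1 / 4 ^ j) * (complex_of_real (h j x) * ?E x))"
        by (simp add: f_def)
      also have "\<dots> = (1 / 4 ^ j) * corr (F j) n" unfolding hn[symmetric] by (rule integral_mult_right_zero)
      finally show ?thesis by simp
    qed
    with * corrg[of n] show ?thesis by (simp add: sums_iff)
  qed
  show "\<exists>\<sigma>. is_spectral_measure M (koopman M S) g \<sigma> \<and>
        absolutely_continuous circle \<sigma> \<and> absolutely_continuous \<sigma> circle"
  proof (intro exI conjI)
    show "is_spectral_measure M (koopman M S) g \<sigma>"
      unfolding is_spectral_measure_def
    proof (intro conjI allI)
      show "sets \<sigma> = sets circle" by (simp add: \<sigma>_def)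
      show "finite_measure \<sigma>"
      proof
        have "emeasure \<sigma> (space \<sigma>) = (\<integral>\<^sup>+x. ennreal (H x) \<partial>circle)"
          unfolding \<sigma>_def by (subst emeasure_density) (auto intro!: nn_integral_cong simp del: space_circle)
        also have "\<dots> = ennreal (LINT x|circle. H x)" by (rule nn_integral_eq_integral[OF Hi H0])
        finally show "emeasure \<sigma> (space \<sigma>) \<noteq> \<infinity>" by simp
      qed
      fix n :: int
      show "(LINT x|\<sigma>. cis (2 * pi * real_of_int n * x)) = L2_inner M (koopman M S n g) g"
      proof (cases "n \<ge> 0")
        case True
        thus ?thesis using spec[of "nat n"] by (simp add: corr_koopman)
      next
        case False
        have "(LINT x|\<sigma>. cis (2 * pi * real_of_int n * x)) = (LINT x|\<sigma>. cnj (cis (2 * pi * real (nat (- n)) * x)))"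
          using False by (intro Bochner_Integration.integral_cong refl) (simp add: cis_cnj)
        also have "\<dots> = cnj (corr g (nat (- n)))" unfolding spec[symmetric] by (rule Bochner_Integration.integral_cnj)
        finally show ?thesis using False by (simp add: corr_koopman)
      qed
    qed
    show "absolutely_continuous circle \<sigma>" unfolding \<sigma>_def by (rule absolutely_continuousI_density) measurable
    show "absolutely_continuous \<sigma> circle"
      unfolding absolutely_continuous_def
    proof
      fix A assume "A \<in> null_sets \<sigma>"
      hence A: "A \<in> sets circle" "AE x in circle. x \<in> A \<longrightarrow> ennreal (H x) = 0"
        unfolding \<sigma>_def by (subst (asm) null_sets_density_iff, simp, simp)+
      from A(2) Hpos have "AE x in circle. x \<notin> A" by eventually_elim (auto simp: ennreal_eq_0_iff)
      thus "A \<in> null_sets circle" using A(1) by (simp add: AE_iff_null_sets)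
    qed
  qed
qed

text \<open>Packets exist for all large weights, so the weights can be split into infinitely many
  families, each with packets of errors 2^-j. Every family gives one generator through
  \<open>packet_series\<close>.\<close>

theorem lebesgue_countable_multiplicity_of_packets:
  assumes "\<And>\<epsilon>. \<epsilon> > 0 \<Longrightarrow> \<exists>N. \<forall>m\<ge>N. \<exists>F. equivariant_packet \<epsilon> m F"
  shows "lebesgue_countable_multiplicity M (koopman M S)"
proof -
  have "\<exists>N. \<forall>j. \<forall>m\<ge>N j. \<exists>F. equivariant_packet (1 / 2 ^ j) m F"
    using assms by (intro choice) simp
  then obtain N :: "nat \<Rightarrow> nat" where N: "\<And>j m. m \<ge> N j \<Longrightarrow> \<exists>F. equivariant_packet (1 / 2 ^ j) m F" by blast
  \<comment> \<open>Strictly increasing and at least \<open>N j\<close>: the weights of a family are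
    pairwise distinct and beyond the thresholds.\<close>
  define K where "K j = (\<Sum>i\<le>j. N i) + j" for j
  \<comment> \<open>The exact power of 2 dividing \<open>m a j\<close> is 2^a. At exp(i pi / 2^a)
    every weight of family a has the value -1 and every weight of a later family the value 1, so a
    single symmetry acts on the whole series by a scalar and tells two families apart.\<close>
  define m where "m a j = 2 ^ a * (2 * K j + 1)" for a j :: nat
  have "N j \<le> m a j" for a j
  proof -
    have "N j \<le> (\<Sum>i\<le>j. N i)" by (rule member_le_sum) auto
    also have "\<dots> \<le> 1 * (2 * K j + 1)" by (simp add: K_def)
    also have "\<dots> \<le> m a j" unfolding m_def by (intro mult_right_mono) auto
    finally show ?thesis .
  qed
  hence "\<forall>p. \<exists>F. equivariant_packet (1 / 2 ^ snd p) (m (fst p) (snd p)) F" using N by blast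
  from choice[OF this] obtain FF where FF: "\<And>p. equivariant_packet (1 / 2 ^ snd p) (m (fst p) (snd p)) (FF p)" by blast
  define F where "F a j = FF (a, j)" for a j
  have F: "equivariant_packet (1 / 2 ^ j) (m a j) (F a j)" for a j using FF[of "(a, j)"] by (simp add: F_def)
  have "strict_mono K" unfolding strict_mono_Suc_iff by (simp add: K_def)
  hence inj: "inj (m a)" for a
    by (auto simp: m_def inj_def strict_mono_eq)
  define g where "g a y = (\<Sum>j. F a j y / 2 ^ j)" for a y
  note P = packet_series[OF F inj, folded g_def]
  define u where "u a = cis (pi / 2 ^ a)" for a :: nat
  have u1: "cmod (u a) = 1" for a by (simp add: u_def)
  have ua: "u a ^ m a j = - 1" for a j
  proof -
    have "u a ^ m a j = cis (pi * real (2 * K j + 1))"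
      by (simp add: u_def Complex.DeMoivre m_def algebra_simps)
    also have "\<dots> = cis (2 * pi * real (K j)) * cis pi" unfolding cis_mult by (simp add: algebra_simps)
    also have "cis (2 * pi * real (K j)) = 1" by (rule cis_multiple_2pi) simp
    finally show ?thesis by simp
  qed
  have ub: "u a ^ m b j = 1" if "a < b" for a b j
  proof -
    have "b = Suc (a + (b - Suc a))" using that by simp
    then obtain c where c: "b = Suc (a + c)" by blast
    have "real (m b j) * (pi / 2 ^ a) = 2 * pi * real (2 ^ c * (2 * K j + 1))"
      by (simp add: m_def c power_add field_simps)
    hence "u a ^ m b j = cis (2 * pi * real (2 ^ c * (2 * K j + 1)))"
      unfolding u_def Complex.DeMoivre by (rule arg_cong)
    also have "\<dots> = 1" by (rule cis_multiple_2pi) (metis Ints_of_nat)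
    finally show ?thesis .
  qed
  show ?thesis
    unfolding lebesgue_countable_multiplicity_def
  proof (intro exI[of _ g] conjI allI impI ballI)
    fix a
    show "g a \<in> L2 M"
      unfolding L2_def
    proof (intro CollectI conjI)
      show "integrable M (\<lambda>y. (cmod (g a y))\<^sup>2)"
      proof (rule integrable_bounded)
        show "norm ((cmod (g a y))\<^sup>2) \<le> 2\<^sup>2" if "y \<in> space M" for y
          using power_mono[OF P(2)[OF that, of a], of 2] by simp
      qed (use P(1) in measurable)
    qed (rule P(1))
    show "\<exists>\<sigma>. is_spectral_measure M (koopman M S) (g a) \<sigma> \<and> absolutely_continuous circle \<sigma> \<and> absolutely_continuous \<sigma> circle"
      by (rule P(4))
  next
    fix a b h k assume ab: "a \<noteq> b" and h: "h \<in> cyclic_space M (koopman M S) (g a)"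
      and k: "k \<in> cyclic_space M (koopman M S) (g b)"
    have [measurable]: "h \<in> borel_measurable M" "k \<in> borel_measurable M"
      using h k by (auto simp: cyclic_space_def L2_def)
    \<comment> \<open>At the symmetry belonging to the smaller index, the two families have the
      scalars -1 and 1.\<close>
    define e where "e = min a b"
    define s where "s c = (if c = e then - 1 else 1 :: complex)" for c
    have se: "u e ^ m c j = s c" if "e \<le> c" for c j
      using that ua ub by (auto simp: s_def)
    have AEh: "AE y in M. h (R (u e) y) = s a * h y"
      by (rule cyclic_space_equivariant[OF P(1) P(2) u1 _ P(3)[OF u1 _ se] h]) (auto simp: s_def e_def)
    have AEk: "AE y in M. k (R (u e) y) = s b * k y"
      by (rule cyclic_space_equivariant[OF P(1) P(2) u1 _ P(3)[OF u1 _ se] k]) (auto simp: s_def e_def)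
    show "L2_inner M h k = 0"
      unfolding L2_inner_def
      by (rule equivariant_orthogonal[OF _ _ u1 _ AEh AEk]) (use ab in \<open>auto simp: s_def e_def min_def\<close>)
  qed
qed

end

subsection \<open>The group SU(2) and its Lie algebra\<close>

text \<open>The Hermitian inner product of C^2, linear in the first argument.\<close>

definition cin :: "complex ^ 2 \<Rightarrow> complex ^ 2 \<Rightarrow> complex" where
  "cin u w = u $ 1 * cnj (w $ 1) + u $ 2 * cnj (w $ 2)"

lemma norm_vec2: "(norm (u :: complex ^ 2))\<^sup>2 = (cmod (u $ 1))\<^sup>2 + (cmod (u $ 2))\<^sup>2"
  by (simp add: norm_vec_def L2_set_def sum_2)

lemma norm_mat2: "(norm (A :: cmat2))\<^sup>2
    = (cmod (A $ 1 $ 1))\<^sup>2 + (cmod (A $ 1 $ 2))\<^sup>2 + (cmod (A $ 2 $ 1))\<^sup>2 + (cmod (A $ 2 $ 2))\<^sup>2"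
proof -
  have "(norm A)\<^sup>2 = (norm (A $ 1))\<^sup>2 + (norm (A $ 2))\<^sup>2"
    by (simp add: norm_vec_def[of A] L2_set_def sum_2)
  thus ?thesis by (simp add: norm_vec2)
qed

lemma cin_self: "cin u u = of_real ((norm u)\<^sup>2)"
  unfolding norm_vec2 of_real_add complex_norm_square cin_def by simp

lemma cin_commute: "cin w u = cnj (cin u w)"
  by (simp add: cin_def)

lemma cin_add_left: "cin (u + v) w = cin u w + cin v w"
  by (simp add: cin_def algebra_simps)

lemma cin_add_right: "cin w (u + v) = cin w u + cin w v"
  by (simp add: cin_def algebra_simps)

lemma cin_diff_left: "cin (u - v) w = cin u w - cin v w"
  by (simp add: cin_def algebra_simps)

lemma cin_diff_right: "cin w (u - v) = cin w u - cin w v"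
  by (simp add: cin_def algebra_simps)

lemma cin_smult_left: "cin (c *s u) w = c * cin u w"
  by (simp add: cin_def algebra_simps)

lemma cin_smult_right: "cin u (c *s w) = cnj c * cin u w"
  by (simp add: cin_def algebra_simps)

lemma cin_scaleR_left: "cin (r *\<^sub>R u) w = of_real r * cin u w"
  by (simp add: cin_def scaleR_conv_of_real[where 'a=complex] algebra_simps)

lemma cin_scaleR_right: "cin u (r *\<^sub>R w) = of_real r * cin u w"
  by (simp add: cin_def scaleR_conv_of_real[where 'a=complex] algebra_simps)

lemma cin_zero [simp]: "cin 0 w = 0" "cin u 0 = 0" by (simp_all add: cin_def)

lemma Re_cin: "Re (cin u w) = inner u w"
  by (simp add: cin_def inner_vec_def sum_2 inner_complex_def)

lemma norm_smult_vec2: "norm (c *s (u :: complex ^ 2)) = cmod c * norm u"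
proof -
  have "(norm (c *s u))\<^sup>2 = (cmod c * norm u)\<^sup>2"
    by (simp only: norm_vec2 power_mult_distrib) (simp add: norm_mult power_mult_distrib distrib_left)
  thus ?thesis by (simp add: power2_eq_iff_nonneg)
qed

text \<open>Multiplying \<open>u\<close> by a phase makes the product real and nonnegative, where
  the real Cauchy-Schwarz inequality applies.\<close>

lemma cin_bound: "cmod (cin u w) \<le> norm u * norm w"
proof -
  define c where "c = cnj (sgn (cin u w))"
  have c: "c * cin u w = of_real (cmod (cin u w))"
    by (cases "cin u w = 0") (auto simp: c_def sgn_div_norm scaleR_conv_of_real[where 'a=complex] complex_norm_square[symmetric] field_simps power2_eq_square)
  have "cmod c \<le> 1" by (simp add: c_def norm_sgn)
  have "cmod (cin u w) = Re (cin (c *s u) w)" using c by (simp add: cin_smult_left)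
  also have "\<dots> \<le> norm (c *s u) * norm w" unfolding Re_cin by (rule norm_cauchy_schwarz)
  also have "\<dots> \<le> norm u * norm w"
    using \<open>cmod c \<le> 1\<close> by (intro mult_right_mono) (auto simp: norm_smult_vec2 mult_left_le_one_le)
  finally show ?thesis .
qed

lemma bounded_bilinear_cin: "bounded_bilinear cin"
  by standard (auto simp: cin_add_left cin_add_right cin_scaleR_left cin_scaleR_right scaleR_conv_of_real[where 'a=complex]
    simp del: vector_scaleR_component intro!: exI[of _ 1] cin_bound)

lemma mat2_mult_component: "((A :: cmat2) ** B) $ i $ j = A $ i $ 1 * B $ 1 $ j + A $ i $ 2 * B $ 2 $ j"
  by (simp add: matrix_matrix_mult_def sum_2)

lemma mat2_vec_component: "((A :: cmat2) *v u) $ i = A $ i $ 1 * u $ 1 + A $ i $ 2 * u $ 2"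
  by (simp add: matrix_vector_mult_def sum_2)

lemma bounded_bilinear_mat2_vec: "bounded_bilinear ((*v) :: cmat2 \<Rightarrow> complex ^ 2 \<Rightarrow> complex ^ 2)"
  unfolding bilinear_conv_bounded_bilinear[symmetric] bilinear_def
  by (auto intro!: linearI simp: vec_eq_iff mat2_vec_component scaleR_conv_of_real[where 'a=complex] algebra_simps)

lemma bounded_bilinear_mat2_mult: "bounded_bilinear ((**) :: cmat2 \<Rightarrow> cmat2 \<Rightarrow> cmat2)"
  unfolding bilinear_conv_bounded_bilinear[symmetric] bilinear_def
  by (auto intro!: linearI simp: vec_eq_iff mat2_mult_component scaleR_conv_of_real[where 'a=complex] algebra_simps)

lemma bounded_linear_adjoint_mat: "bounded_linear adjoint_mat"
  unfolding linear_conv_bounded_linear[symmetric]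
  by (intro linearI) (auto simp: vec_eq_iff adjoint_mat_def)

lemma adjoint_mat_component [simp]: "adjoint_mat A $ i $ j = cnj (A $ j $ i)"
  by (simp add: adjoint_mat_def)

lemma adjoint_mat_adjoint_mat [simp]: "adjoint_mat (adjoint_mat A) = A"
  by (simp add: vec_eq_iff)

lemma adjoint_mat_mult: "adjoint_mat (A ** B) = adjoint_mat B ** adjoint_mat A"
  by (simp add: vec_eq_iff mat2_mult_component mult.commute)

lemma cin_adjoint_mat: "cin (A *v u) w = cin u (adjoint_mat A *v w)"
  by (simp add: cin_def mat2_vec_component algebra_simps)

lemma smult_mat2_vec: "(A :: cmat2) *v (c *s u) = c *s (A *v u)"
  by (simp add: vec_eq_iff mat2_vec_component algebra_simps)

lemma scaleR_conv_smult: "r *\<^sub>R (u :: complex ^ 2) = of_real r *s u"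
  by (simp add: vec_eq_iff scaleR_conv_of_real[where 'a=complex])

lemma bounded_linear_smult_vec2: "bounded_linear (\<lambda>u :: complex ^ 2. c *s u)"
  unfolding linear_conv_bounded_linear[symmetric]
  by (intro linearI) (auto simp: vec_eq_iff scaleR_conv_of_real[where 'a=complex] algebra_simps)

lemma norm_axis_vec2: "norm (axis i 1 :: complex ^ 2) = 1"
proof -
  have "(norm (axis i 1 :: complex ^ 2))\<^sup>2 = 1\<^sup>2"
    using exhaust_2[of i] by (auto simp: norm_vec2 axis_def)
  thus ?thesis by (simp add: power2_eq_iff_nonneg)
qed

text \<open>Unitarity of the first row, orthogonality of the rows and det = 1 are linear equations
  for the second row, solved by suitable combinations.\<close>

lemma SU2_component:
  assumes "A \<in> SU2"
  shows "A $ 2 $ 2 = cnj (A $ 1 $ 1)" "A $ 2 $ 1 = - cnj (A $ 1 $ 2)"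
    "A $ 1 $ 1 * cnj (A $ 1 $ 1) + A $ 1 $ 2 * cnj (A $ 1 $ 2) = 1"
proof -
  let ?a = "A $ 1 $ 1" and ?b = "A $ 1 $ 2" and ?c = "A $ 2 $ 1" and ?e = "A $ 2 $ 2"
  have *: "(A ** adjoint_mat A) $ 1 $ 1 = 1" "(A ** adjoint_mat A) $ 2 $ 1 = 0" "det A = 1"
    using assms by (auto simp: SU2_def mat_def)
  show 1: "?a * cnj ?a + ?b * cnj ?b = 1" using *(1) by (simp add: mat2_mult_component)
  have 2: "?c * cnj ?a + ?e * cnj ?b = 0" using *(2) by (simp add: mat2_mult_component)
  have 3: "?a * ?e - ?b * ?c = 1" using *(3) by (simp add: det_2)
  have "?e = ?e * (?a * cnj ?a + ?b * cnj ?b)" by (simp add: 1)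
  also have "\<dots> = cnj ?a * (?a * ?e - ?b * ?c) + ?b * (?c * cnj ?a + ?e * cnj ?b)" by (simp add: algebra_simps)
  finally show "?e = cnj ?a" by (simp add: 2 3)
  have "?c = ?c * (?a * cnj ?a + ?b * cnj ?b)" by (simp add: 1)
  also have "\<dots> = ?a * (?c * cnj ?a + ?e * cnj ?b) - cnj ?b * (?a * ?e - ?b * ?c)" by (simp add: algebra_simps)
  finally show "?c = - cnj ?b" by (simp add: 2 3)
qed

lemma SU2_I:
  assumes "A $ 2 $ 2 = cnj (A $ 1 $ 1)" "A $ 2 $ 1 = - cnj (A $ 1 $ 2)"
    "A $ 1 $ 1 * cnj (A $ 1 $ 1) + A $ 1 $ 2 * cnj (A $ 1 $ 2) = 1"
  shows "A \<in> SU2"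
  unfolding SU2_def using assms
  by (simp add: vec_eq_iff mat2_mult_component mat_def forall_2 det_2 algebra_simps)

lemma SU2_mult: "A \<in> SU2 \<Longrightarrow> B \<in> SU2 \<Longrightarrow> A ** B \<in> SU2"
proof -
  assume A: "A \<in> SU2" and B: "B \<in> SU2"
  have "(A ** B) ** adjoint_mat (A ** B) = A ** (B ** adjoint_mat B) ** adjoint_mat A"
    by (simp add: adjoint_mat_mult matrix_mul_assoc)
  moreover have "adjoint_mat (A ** B) ** (A ** B) = adjoint_mat B ** (adjoint_mat A ** A) ** B"
    by (simp add: adjoint_mat_mult matrix_mul_assoc)
  ultimately show ?thesis using A B by (simp add: SU2_def det_mul)
qed

lemma SU2_adjoint: "A \<in> SU2 \<Longrightarrow> adjoint_mat A \<in> SU2"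
  by (rule SU2_I) (use SU2_component[of A] in \<open>auto simp: algebra_simps\<close>)

lemma SU2_one: "mat 1 \<in> SU2"
  by (rule SU2_I) (auto simp: mat_def)

lemma SU2_inverse: "A \<in> SU2 \<Longrightarrow> A ** adjoint_mat A = mat 1" "A \<in> SU2 \<Longrightarrow> adjoint_mat A ** A = mat 1"
  by (auto simp: SU2_def)

lemma SU2_cancel:
  assumes "A \<in> SU2"
  shows "A ** (adjoint_mat A ** B) = B" "adjoint_mat A ** (A ** B) = B"
    "B ** A ** adjoint_mat A = B" "B ** adjoint_mat A ** A = B"
    "A *v (adjoint_mat A *v u) = u" "adjoint_mat A *v (A *v u) = u"
  using SU2_inverse[OF assms]
  by (simp_all add: matrix_mul_assoc matrix_vector_mul_assoc matrix_mul_assoc[symmetric, of B])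

lemma matrix_inv_SU2: "A \<in> SU2 \<Longrightarrow> matrix_inv A = adjoint_mat A"
proof -
  assume A: "A \<in> SU2"
  have "\<exists>A'. A ** A' = mat 1 \<and> A' ** A = mat 1" using SU2_inverse[OF A] by blast
  hence "matrix_inv A ** A = mat 1" unfolding matrix_inv_def by (rule someI2_ex) simp
  hence "matrix_inv A ** A ** adjoint_mat A = adjoint_mat A" by simp
  thus ?thesis using SU2_cancel(3)[OF A] by simp
qed

lemma cin_SU2: "A \<in> SU2 \<Longrightarrow> cin (A *v u) (A *v w) = cin u w"
  by (simp add: cin_adjoint_mat SU2_cancel)

lemma norm_SU2_vec: "A \<in> SU2 \<Longrightarrow> norm (A *v u) = norm u"
proof -
  assume "A \<in> SU2"
  hence "complex_of_real ((norm (A *v u))\<^sup>2) = of_real ((norm u)\<^sup>2)"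
    using cin_SU2[of A u u] by (simp only: cin_self)
  thus ?thesis by (simp only: of_real_eq_iff power2_eq_iff_nonneg norm_ge_zero)
qed

lemma su2_component:
  assumes "A \<in> su2"
  shows "cnj (A $ 1 $ 1) = - A $ 1 $ 1" "A $ 2 $ 2 = - A $ 1 $ 1" "A $ 2 $ 1 = - cnj (A $ 1 $ 2)"
proof -
  have a: "adjoint_mat A $ i $ j = - (A $ i $ j)" for i j using assms by (simp add: su2_def)
  have t: "A $ 1 $ 1 + A $ 2 $ 2 = 0" using assms by (simp add: su2_def trace_def sum_2)
  show "cnj (A $ 1 $ 1) = - A $ 1 $ 1" using a[of 1 1] by simp
  show "A $ 2 $ 2 = - A $ 1 $ 1" using t by (simp add: add_eq_0_iff)
  show "A $ 2 $ 1 = - cnj (A $ 1 $ 2)" using a[of 2 1] by simp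
qed

lemma su2_I:
  assumes "cnj (A $ 1 $ 1) = - A $ 1 $ 1" "A $ 2 $ 2 = - A $ 1 $ 1" "A $ 2 $ 1 = - cnj (A $ 1 $ 2)"
  shows "A \<in> su2"
  using assms by (auto simp: su2_def vec_eq_iff forall_2 trace_def sum_2)

lemma det_su2:
  assumes "A \<in> su2"
  shows "det A = of_real ((cmod (A $ 1 $ 1))\<^sup>2 + (cmod (A $ 1 $ 2))\<^sup>2)"
proof -
  have "det A = A $ 1 $ 1 * cnj (A $ 1 $ 1) + A $ 1 $ 2 * cnj (A $ 1 $ 2)"
    using su2_component[OF assms] by (simp add: det_2)
  thus ?thesis by (simp only: of_real_add complex_norm_square)
qed

lemma su2_norm_sq:
  assumes "A \<in> su2"
  shows "(su2_norm A)\<^sup>2 = (cmod (A $ 1 $ 1))\<^sup>2 + (cmod (A $ 1 $ 2))\<^sup>2"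
  by (simp add: su2_norm_def det_su2[OF assms])

text \<open>Through this proportionality, continuity and limits for \<open>su2_norm\<close> are
  reduced to the Euclidean norm.\<close>

lemma su2_norm_eq:
  assumes "A \<in> su2"
  shows "su2_norm A = norm A / sqrt 2"
proof -
  have "(norm A)\<^sup>2 = 2 * (su2_norm A)\<^sup>2"
    using su2_component[OF assms] by (simp add: norm_mat2 su2_norm_sq[OF assms])
  hence "(su2_norm A)\<^sup>2 = (norm A / sqrt 2)\<^sup>2" by (simp add: power_divide)
  moreover have "su2_norm A \<ge> 0" by (simp add: su2_norm_def det_su2[OF assms])
  ultimately show ?thesis by (simp add: power2_eq_iff_nonneg)
qed

lemma subspace_su2: "subspace su2"
  unfolding subspace_def
  by (auto intro!: su2_I simp: su2_component algebra_simps scaleR_conv_of_real[where 'a=complex])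

lemma closed_su2: "closed su2"
  using subspace_su2 by (rule closed_subspace)

text \<open>Cayley-Hamilton for trace zero: the square of A is - det A. So the eigenvalues are i and
  - i times the norm, and A is an isometry up to scale.\<close>

lemma su2_square:
  assumes "A \<in> su2"
  shows "A *v (A *v u) = - ((su2_norm A)\<^sup>2 *\<^sub>R u)"
proof -
  have 1: "complex_of_real ((su2_norm A)\<^sup>2) = A $ 1 $ 1 * cnj (A $ 1 $ 1) + A $ 1 $ 2 * cnj (A $ 1 $ 2)"
    unfolding su2_norm_sq[OF assms] of_real_add complex_norm_square ..
  show ?thesis
    unfolding scaleR_conv_smult 1
    by (simp add: vec_eq_iff forall_2 mat2_vec_component su2_component[OF assms] algebra_simps)
qed

lemma cin_su2: "A \<in> su2 \<Longrightarrow> cin (A *v u) w = - cin u (A *v w)"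
  unfolding cin_adjoint_mat by (simp add: su2_def) (simp add: cin_def mat2_vec_component algebra_simps)

lemma norm_su2_vec:
  assumes "A \<in> su2"
  shows "norm (A *v u) = su2_norm A * norm u"
proof -
  have "complex_of_real ((norm (A *v u))\<^sup>2) = - cin u (A *v (A *v u))"
    unfolding cin_self[symmetric] by (rule cin_su2[OF assms])
  also have "\<dots> = of_real ((su2_norm A)\<^sup>2) * cin u u"
    unfolding su2_square[OF assms] by (simp add: cin_def scaleR_conv_of_real[where 'a=complex] algebra_simps)
  also have "\<dots> = of_real ((su2_norm A)\<^sup>2 * (norm u)\<^sup>2)" by (simp only: cin_self of_real_mult)
  finally have "(norm (A *v u))\<^sup>2 = (su2_norm A * norm u)\<^sup>2"
    by (simp only: of_real_eq_iff power_mult_distrib)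
  moreover have "su2_norm A \<ge> 0" using su2_norm_eq[OF assms] by simp
  ultimately show ?thesis by (simp add: power2_eq_iff_nonneg)
qed

lemma Re_cin_su2: "A \<in> su2 \<Longrightarrow> Re (cin (A *v u) u) = 0"
  using cin_su2[of A u u] cin_commute[of "A *v u" u] by (simp add: complex_eq_iff)

text \<open>The eigenspaces of a nonzero element of \<^const>\<open>su2\<close> are one-dimensional because its trace vanishes.\<close>
lemma su2_eigenline:
  assumes A: "A \<in> su2" and "c \<noteq> 0" and s: "A *v s = c *s s" and w: "A *v w = c *s w" and n: "norm s = 1"
  shows "w = cin w s *s s"
proof -
  have s1: "s $ 1 * cnj (s $ 1) + s $ 2 * cnj (s $ 2) = 1"
    using n cin_self[of s] by (simp add: cin_def)
  let ?x = "A $ 1 $ 1" and ?y = "A $ 1 $ 2"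
  have S: "(?x - c) * s $ 1 + ?y * s $ 2 = 0" "- cnj ?y * s $ 1 + (- ?x - c) * s $ 2 = 0"
    using s su2_component[OF A] by (auto simp: vec_eq_iff forall_2 mat2_vec_component algebra_simps add_eq_0_iff)
  have W: "(?x - c) * w $ 1 + ?y * w $ 2 = 0" "- cnj ?y * w $ 1 + (- ?x - c) * w $ 2 = 0"
    using w su2_component[OF A] by (auto simp: vec_eq_iff forall_2 mat2_vec_component algebra_simps add_eq_0_iff)
  \<comment> \<open>The vectors are parallel. One of the coefficients \<open>?x - c\<close> and
    \<open>- ?x - c\<close> is nonzero, as their sum is - 2 c.\<close>
  have d: "w $ 1 * s $ 2 = w $ 2 * s $ 1"
  proof (cases "?x = c")
    case False
    have "(?x - c) * (w $ 1 * s $ 2 - w $ 2 * s $ 1) = s $ 2 * ((?x - c) * w $ 1 + ?y * w $ 2) - w $ 2 * ((?x - c) * s $ 1 + ?y * s $ 2)"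
      by (simp add: algebra_simps)
    thus ?thesis using S W False by simp
  next
    case True
    have "(- ?x - c) * (w $ 1 * s $ 2 - w $ 2 * s $ 1) = w $ 1 * (- cnj ?y * s $ 1 + (- ?x - c) * s $ 2) - s $ 1 * (- cnj ?y * w $ 1 + (- ?x - c) * w $ 2)"
      by (simp add: algebra_simps)
    thus ?thesis using S W True \<open>c \<noteq> 0\<close> by (simp add: add_eq_0_iff)
  qed
  have "cin w s * s $ 1 = w $ 1 * (s $ 1 * cnj (s $ 1) + s $ 2 * cnj (s $ 2))"
    using d by (simp add: cin_def algebra_simps)
  moreover have "cin w s * s $ 2 = w $ 2 * (s $ 1 * cnj (s $ 1) + s $ 2 * cnj (s $ 2))"
    using d by (simp add: cin_def algebra_simps)
  ultimately show ?thesis using s1 by (simp add: vec_eq_iff forall_2)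
qed

text \<open>For A in \<open>su2\<close> with norm d > 0 this is twice the orthogonal projection of e
  to the eigenline for i d. The formula is affine in A and is applied also to matrices of slightly
  different norm, which makes it easy to differentiate along a curve.\<close>

definition eig_proj :: "real \<Rightarrow> complex ^ 2 \<Rightarrow> cmat2 \<Rightarrow> complex ^ 2" where
  "eig_proj d e A = e - (\<i> / of_real d) *s (A *v e)"

lemma eig_proj_eigenvector:
  assumes A: "A \<in> su2" and d: "su2_norm A = d" "d > 0"
  shows "A *v eig_proj d e A = (\<i> * of_real d) *s eig_proj d e A"
proof -
  have "A *v eig_proj d e A = A *v e - (\<i> / of_real d) *s (A *v (A *v e))"
    by (simp add: eig_proj_def matrix_vector_mult_diff_distrib smult_mat2_vec)
  also have "\<dots> = A *v e + (\<i> * of_real d) *s e"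
    unfolding su2_square[OF A] d(1) using d(2)
    by (simp add: vec_eq_iff scaleR_conv_of_real[where 'a=complex] power2_eq_square field_simps)
  also have "\<dots> = (\<i> * of_real d) *s eig_proj d e A"
    using d(2) by (simp add: eig_proj_def vec_eq_iff field_simps)
  finally show ?thesis .
qed

lemma su2_eigenvector_exists:
  assumes A: "A \<in> su2" and d: "su2_norm A = d" "d > 0"
  obtains e where "norm e = 1" "A *v e = (\<i> * of_real d) *s e"
proof -
  have "\<exists>e. eig_proj d e A \<noteq> 0"
  proof (rule ccontr)
    assume "\<nexists>e. eig_proj d e A \<noteq> 0"
    hence z: "eig_proj d (axis i 1) A $ i = 0" for i by (metis zero_index)
    \<comment> \<open>If the projection killed both axis vectors, the two diagonal entries would add
      up to 2 = (i / d) trace A = 0.\<close>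
    have "1 = (\<i> / of_real d) * A $ 1 $ 1" "1 = (\<i> / of_real d) * A $ 2 $ 2"
      using z[of 1] z[of 2] by (simp_all add: eig_proj_def mat2_vec_component axis_def)
    hence "1 + 1 = (\<i> / of_real d) * (A $ 1 $ 1 + A $ 2 $ 2)" by (simp only: distrib_left)
    thus False using su2_component(2)[OF A] by simp
  qed
  then obtain e where e: "eig_proj d e A \<noteq> 0" by blast
  let ?q = "eig_proj d e A"
  show thesis
  proof
    show "norm ((1 / norm ?q) *\<^sub>R ?q) = 1" using e by simp
    show "A *v ((1 / norm ?q) *\<^sub>R ?q) = (\<i> * of_real d) *s ((1 / norm ?q) *\<^sub>R ?q)"
      unfolding scaleR_conv_smult smult_mat2_vec eig_proj_eigenvector[OF assms] by (simp add: vec_eq_iff)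
  qed
qed

subsection \<open>The logarithmic derivative of the iterates\<close>

text \<open>Stated with witnesses for both derivatives, so that product and shift rules can supply
  them directly; \<open>C2_D\<close> returns to \<open>vector_derivative\<close>.\<close>

definition C2 :: "(real \<Rightarrow> cmat2) \<Rightarrow> bool" where
  "C2 f \<longleftrightarrow> (\<exists>f' f''. (\<forall>x. (f has_vector_derivative f' x) (at x)) \<and>
     (\<forall>x. (f' has_vector_derivative f'' x) (at x)) \<and> continuous_on UNIV f'')"

lemma C2_D:
  assumes "C2 f"
  shows "(f has_vector_derivative D f x) (at x)" "(D f has_vector_derivative D (D f) x) (at x)"
    "continuous_on UNIV (D (D f))"
proof -
  obtain f' f'' where f: "\<And>x. (f has_vector_derivative f' x) (at x)"
     "\<And>x. (f' has_vector_derivative f'' x) (at x)" "continuous_on UNIV f''"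
    using assms unfolding C2_def by blast
  have 1: "vector_derivative f (at x) = f' x" for x using f(1) by (simp add: vector_derivative_at)
  have 2: "vector_derivative f' (at x) = f'' x" for x using f(2) by (simp add: vector_derivative_at)
  show "(f has_vector_derivative D f x) (at x)" "(D f has_vector_derivative D (D f) x) (at x)"
    "continuous_on UNIV (D (D f))" using f by (simp_all add: 1 2)
qed

lemmas has_vector_derivative_mat2_mult = bounded_bilinear.has_vector_derivative[OF bounded_bilinear_mat2_mult]
lemmas continuous_on_mat2_mult = bounded_bilinear.continuous_on[OF bounded_bilinear_mat2_mult]

lemma has_vector_derivative_imp_continuous_on:
  assumes "\<And>x. (f has_vector_derivative f' x) (at x)"
  shows "continuous_on A f"
  using assms by (intro continuous_at_imp_continuous_on ballI has_vector_derivative_continuous)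

lemma C2_continuous:
  assumes "C2 f"
  shows "continuous_on UNIV f" "continuous_on UNIV (D f)" "continuous_on UNIV (D (D f))"
  using has_vector_derivative_imp_continuous_on[OF C2_D(1)[OF assms]]
    has_vector_derivative_imp_continuous_on[OF C2_D(2)[OF assms]] C2_D(3)[OF assms] by blast+

lemma C2_mult:
  assumes "C2 f" "C2 g"
  shows "C2 (\<lambda>x. f x ** g x)"
  unfolding C2_def
proof (intro exI conjI allI)
  show "((\<lambda>x. f x ** g x) has_vector_derivative f x ** D g x + D f x ** g x) (at x)" for x
    by (rule has_vector_derivative_mat2_mult) (use assms C2_D in auto)
  show "((\<lambda>x. f x ** D g x + D f x ** g x) has_vector_derivative
      (f x ** D (D g) x + D f x ** D g x) + (D f x ** D g x + D (D f) x ** g x)) (at x)" for x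
    by (intro has_vector_derivative_add has_vector_derivative_mat2_mult) (use assms C2_D in auto)
  show "continuous_on UNIV (\<lambda>x. (f x ** D (D g) x + D f x ** D g x) + (D f x ** D g x + D (D f) x ** g x))"
    by (intro continuous_on_add continuous_on_mat2_mult C2_continuous assms)
qed

lemma has_vector_derivative_shift:
  assumes "(f has_vector_derivative f') (at (x + c))"
  shows "((\<lambda>x. f (x + c)) has_vector_derivative f') (at (x::real))"
proof -
  have "((\<lambda>x. x + c) has_vector_derivative 1) (at x)" by (auto intro!: derivative_eq_intros)
  from vector_diff_chain_at[OF this, of f f'] assms show ?thesis by (simp add: o_def)
qed

lemma C2_shift:
  assumes "C2 f"
  shows "C2 (\<lambda>x. f (x + c))"
  unfolding C2_def
proof (intro exI conjI allI)
  show "((\<lambda>x. f (x + c)) has_vector_derivative D f (x + c)) (at x)" for x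
    by (intro has_vector_derivative_shift C2_D assms)
  show "((\<lambda>x. D f (x + c)) has_vector_derivative D (D f) (x + c)) (at x)" for x
    by (intro has_vector_derivative_shift C2_D assms)
  show "continuous_on UNIV (\<lambda>x. D (D f) (x + c))"
    by (intro continuous_on_compose2[OF C2_D(3)[OF assms]] continuous_intros) auto
qed

text \<open>Used for the linear relations among matrix entries that hold on SU(2) and su(2): they
  pass to the derivative of a curve.\<close>

lemma linear_zero_derivative:
  assumes "bounded_linear L" "\<And>y. L (f y) = 0" "(f has_vector_derivative f') (at (x::real))"
  shows "L f' = 0"
  using bounded_linear.has_vector_derivative[OF assms(1,3)] assms(2)
    vector_derivative_unique_at[OF _ has_vector_derivative_const] by fastforce

lemma bounded_linear_mat2_component: "bounded_linear (\<lambda>A :: cmat2. A $ i $ j)"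
  by (intro bounded_linear_compose[OF bounded_linear_vec_nth[of j] bounded_linear_vec_nth[of i]])

lemma su2_derivative:
  assumes "\<And>y. f y \<in> su2" "(f has_vector_derivative f') (at (x::real))"
  shows "f' \<in> su2"
proof -
  note bl = bounded_linear_mat2_component bounded_linear_compose[OF bounded_linear_cnj bounded_linear_mat2_component]
  have "cnj (f' $ 1 $ 1) + f' $ 1 $ 1 = 0" "f' $ 2 $ 2 + f' $ 1 $ 1 = 0" "f' $ 2 $ 1 + cnj (f' $ 1 $ 2) = 0"
    by (rule linear_zero_derivative[OF _ _ assms(2)], intro bounded_linear_add bl, simp add: su2_component assms(1))+
  thus ?thesis by (intro su2_I) (simp_all only: eq_neg_iff_add_eq_0)
qed

lemma periodic_of_int:
  fixes f :: "real \<Rightarrow> 'b"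
  assumes "\<And>z. f (z + t) = f z"
  shows "f (z + of_int k * t) = f z"
proof -
  have nat: "f (z + real n * t) = f z" for n z
  proof (induction n)
    case (Suc n)
    thus ?case using assms[of "z + real n * t"] by (simp add: algebra_simps)
  qed simp
  show ?thesis
  proof (cases "k \<ge> 0")
    case True thus ?thesis using nat[of z "nat k"] by simp
  next
    case False thus ?thesis using nat[of "z + of_int k * t" "nat (- k)"] by simp
  qed
qed

lemma periodic_frac:
  assumes "\<And>x. f (x + 1) = f (x :: real)"
  shows "f (frac x) = f x"
  using periodic_of_int[of f 1 "frac x" "\<lfloor>x\<rfloor>", OF assms] by (simp add: frac_def)

text \<open>Dirichlet approximation yields arbitrarily small periods k \<open>\<alpha>\<close> - h,
  nonzero by irrationality. A multiple of such a period brings x close to y.\<close>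

lemma periodic_continuous_constant:
  fixes g :: "real \<Rightarrow> 'b::metric_space"
  assumes irr: "\<alpha> \<notin> \<rat>" and cont: "continuous_on UNIV g"
    and p: "\<And>x. g (x + 1) = g x" "\<And>x. g (x + \<alpha>) = g x"
  shows "g x = g y"
proof (rule ccontr)
  assume "g x \<noteq> g y"
  then obtain \<delta> where \<delta>: "\<delta> > 0" "\<And>z. \<bar>z - y\<bar> < \<delta> \<Longrightarrow> dist (g z) (g y) < dist (g x) (g y)"
    using cont unfolding continuous_on_iff dist_real_def by (metis UNIV_I zero_less_dist_iff)
  obtain N :: nat where N: "N > 0" "1 / real N < \<delta>"
    using reals_Archimedean[OF \<delta>(1)] by (metis inverse_eq_divide zero_less_Suc)
  obtain h k where hk: "0 < k" "\<bar>of_int k * \<alpha> - of_int h\<bar> < 1 / N"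
    by (rule Dirichlet_approx[OF N(1), of \<alpha>])
  define t where "t = of_int k * \<alpha> - of_int h"
  have t0: "t \<noteq> 0"
  proof
    assume "t = 0"
    hence "\<alpha> = of_int h / of_int k" using hk(1) by (simp add: t_def field_simps)
    thus False using irr by simp
  qed
  have gt: "g (z + t) = g z" for z
  proof -
    have "g (z + t) = g ((z + of_int k * \<alpha>) + of_int (- h) * 1)" by (simp add: t_def algebra_simps)
    also have "\<dots> = g z" using periodic_of_int[of g, OF p(1)] periodic_of_int[of g, OF p(2)] by metis
    finally show ?thesis .
  qed
  define j where "j = \<lfloor>(y - x) / t\<rfloor>"
  have "\<bar>(y - x) / t - of_int j\<bar> < 1" unfolding j_def by linarith
  hence "\<bar>(y - x) / t - of_int j\<bar> * \<bar>t\<bar> < 1 * \<bar>t\<bar>" using t0 by (intro mult_strict_right_mono) auto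
  moreover have "x + of_int j * t - y = - (((y - x) / t - of_int j) * t)" using t0 by (simp add: field_simps)
  ultimately have "\<bar>x + of_int j * t - y\<bar> < \<bar>t\<bar>" by (simp only: abs_minus_cancel abs_mult mult_1)
  also have "\<bar>t\<bar> < \<delta>" using hk(2) N(2) by (simp add: t_def)
  finally have "dist (g (x + of_int j * t)) (g y) < dist (g x) (g y)" by (rule \<delta>(2))
  thus False using periodic_of_int[of g, OF gt] by simp
qed

section \<open>The limit of the logarithmic derivatives, its equivariance and its constant
  norm\<close>

locale positive_degree_cocycle =
  fixes \<alpha> :: real and \<phi> :: "real \<Rightarrow> cmat2"
  assumes irrational: "\<alpha> \<notin> \<rat>"
    and cocycle: "Ck_cocycle 2 \<phi>"
    and degree: "cocycle_degree \<alpha> \<phi> \<noteq> 0"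
    and uniform: "uniformly_convergent_on UNIV (mean_log_deriv \<alpha> \<phi>)"
    and bounded: "\<exists>B. \<forall>n\<ge>1. su2_L1_norm (D (mean_log_deriv \<alpha> \<phi> n)) \<le> B"
begin

abbreviation "\<Phi> \<equiv> cocycle_iter \<alpha> \<phi>"
abbreviation "a \<equiv> mean_log_deriv \<alpha> \<phi>"
definition "\<psi> x = lim (\<lambda>n. a n x)"

lemma \<phi>_SU2: "\<phi> x \<in> SU2" and \<phi>_periodic: "\<phi> (x + 1) = \<phi> x" and \<phi>_C2: "C2 \<phi>"
proof -
  show "\<phi> x \<in> SU2" "\<phi> (x + 1) = \<phi> x" using cocycle by (auto simp: Ck_cocycle_def)
  have "\<forall>x. \<phi> differentiable (at x)" "\<forall>x. D \<phi> differentiable (at x)" "continuous_on UNIV (D (D \<phi>))"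
    using cocycle by (auto simp: Ck_cocycle_def numeral_2_eq_2)
  thus "C2 \<phi>" unfolding C2_def vector_derivative_works
    by (intro exI[of _ "D \<phi>"] exI[of _ "D (D \<phi>)"] conjI)
qed

lemma \<Phi>_SU2: "\<Phi> n x \<in> SU2"
  by (induction n) (auto intro: SU2_one SU2_mult \<phi>_SU2)

lemma \<phi>_periodic': "\<phi> (x + 1 + c) = \<phi> (x + c)"
  using \<phi>_periodic[of "x + c"] by (simp add: add_ac)

lemma \<Phi>_periodic: "\<Phi> n (x + 1) = \<Phi> n x"
  by (induction n) (auto simp: \<phi>_periodic')

lemma \<Phi>_C2: "C2 (\<Phi> n)"
proof (induction n)
  case 0
  show ?case unfolding C2_def cocycle_iter.simps(1)[abs_def]
    by (intro exI[of _ "\<lambda>_. 0"]) (auto intro!: derivative_eq_intros)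
next
  case (Suc n)
  show ?case unfolding cocycle_iter.simps(2)[abs_def]
    by (intro C2_mult C2_shift Suc \<phi>_C2)
qed

text \<open>Splits off the first factor instead of the last, which relates the iterates at x to
  those at x + \<open>\<alpha>\<close>.\<close>

lemma \<Phi>_Suc: "\<Phi> (Suc n) x = \<phi> x ** \<Phi> n (x + \<alpha>)"
proof (induction n)
  case (Suc n)
  have "\<Phi> (Suc (Suc n)) x = (\<phi> x ** \<Phi> n (x + \<alpha>)) ** \<phi> (x + real (Suc n) * \<alpha>)"
    by (subst cocycle_iter.simps(2), subst Suc.IH) simp
  also have "x + real (Suc n) * \<alpha> = x + \<alpha> + real n * \<alpha>" by (simp add: algebra_simps)
  finally show ?case by (simp add: matrix_mul_assoc)
qed simp

lemma a_eq: "a n x = (1 / real n) *\<^sub>R (D (\<Phi> n) x ** adjoint_mat (\<Phi> n x))"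
  by (simp add: mean_log_deriv_def matrix_inv_SU2[OF \<Phi>_SU2])

lemma D_\<Phi>:
  assumes "n \<ge> 1"
  shows "(\<Phi> n has_vector_derivative real n *\<^sub>R (a n x ** \<Phi> n x)) (at x)"
proof -
  have "real n *\<^sub>R (a n x ** \<Phi> n x) = real n *\<^sub>R ((1 / real n) *\<^sub>R (D (\<Phi> n) x ** adjoint_mat (\<Phi> n x) ** \<Phi> n x))"
    unfolding a_eq by (simp add: bounded_bilinear.scaleR_left[OF bounded_bilinear_mat2_mult])
  also have "\<dots> = D (\<Phi> n) x" using assms by (simp add: SU2_cancel[OF \<Phi>_SU2])
  finally show ?thesis using C2_D(1)[OF \<Phi>_C2] by simp
qed

lemma a_deriv: "(a n has_vector_derivative D (a n) x) (at x)" and D_a_cont: "continuous_on UNIV (D (a n))"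
proof -
  let ?f = "\<lambda>x. (1 / real n) *\<^sub>R (D (\<Phi> n) x ** adjoint_mat (D (\<Phi> n) x) + D (D (\<Phi> n)) x ** adjoint_mat (\<Phi> n x))"
  note C = C2_D[OF \<Phi>_C2[of n]]
  note ad = bounded_linear.has_vector_derivative[OF bounded_linear_adjoint_mat]
  have 1: "(a n has_vector_derivative ?f x) (at x)" for x
    unfolding a_eq[abs_def]
    by (rule bounded_linear.has_vector_derivative[OF bounded_linear_scaleR_right
        has_vector_derivative_mat2_mult[OF C(2) ad[OF C(1)]]])
  hence 2: "vector_derivative (a n) (at x) = ?f x" for x by (rule vector_derivative_at)
  show "(a n has_vector_derivative D (a n) x) (at x)" unfolding 2 by (rule 1)
  show "continuous_on UNIV (D (a n))" unfolding 2
    by (intro continuous_intros continuous_on_mat2_mult bounded_linear.continuous_on[OF bounded_linear_adjoint_mat] C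
        has_vector_derivative_imp_continuous_on[OF C(1)] has_vector_derivative_imp_continuous_on[OF C(2)])
qed

lemma a_cont: "continuous_on A (a n)"
  by (rule has_vector_derivative_imp_continuous_on[OF a_deriv])

text \<open>Differentiating the linear entry relations of SU(2) fixes the second row of the
  derivative; differentiating \<open>\<Phi>\<close> times its adjoint = 1 makes the diagonal of the
  product purely imaginary and traceless.\<close>

lemma a_su2: "a n x \<in> su2"
proof -
  let ?F = "\<Phi> n x" and ?P = "D (\<Phi> n) x"
  note C = C2_D(1)[OF \<Phi>_C2[of n], of x]
  note bl = bounded_linear_mat2_component bounded_linear_compose[OF bounded_linear_cnj bounded_linear_mat2_component]
  note S = SU2_component[OF \<Phi>_SU2[of n]]
  have "?P $ 2 $ 2 - cnj (?P $ 1 $ 1) = 0" "?P $ 2 $ 1 + cnj (?P $ 1 $ 2) = 0"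
    by (rule linear_zero_derivative[OF _ _ C], intro bounded_linear_add bounded_linear_sub bl, simp add: S)+
  hence P: "?P $ 2 $ 2 = cnj (?P $ 1 $ 1)" "?P $ 2 $ 1 = - cnj (?P $ 1 $ 2)" by (auto simp: add_eq_0_iff)
  have "((\<lambda>x. \<Phi> n x ** adjoint_mat (\<Phi> n x)) has_vector_derivative ?F ** adjoint_mat ?P + ?P ** adjoint_mat ?F) (at x)"
    by (intro has_vector_derivative_mat2_mult bounded_linear.has_vector_derivative[OF bounded_linear_adjoint_mat] C)
  moreover have "((\<lambda>x. \<Phi> n x ** adjoint_mat (\<Phi> n x)) has_vector_derivative 0) (at x)"
    by (simp add: SU2_inverse[OF \<Phi>_SU2])
  ultimately have "?F ** adjoint_mat ?P + ?P ** adjoint_mat ?F = 0"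
    by (rule vector_derivative_unique_at)
  hence z: "(?F ** adjoint_mat ?P) $ 1 $ 1 + (?P ** adjoint_mat ?F) $ 1 $ 1 = 0"
    by (metis vector_add_component zero_index)
  have "?P ** adjoint_mat ?F \<in> su2"
  proof (rule su2_I)
    show "cnj ((?P ** adjoint_mat ?F) $ 1 $ 1) = - (?P ** adjoint_mat ?F) $ 1 $ 1"
      unfolding eq_neg_iff_add_eq_0 using z by (simp add: mat2_mult_component algebra_simps)
    show "(?P ** adjoint_mat ?F) $ 2 $ 2 = - (?P ** adjoint_mat ?F) $ 1 $ 1"
      unfolding eq_neg_iff_add_eq_0 using z by (simp add: mat2_mult_component P S algebra_simps)
    show "(?P ** adjoint_mat ?F) $ 2 $ 1 = - cnj ((?P ** adjoint_mat ?F) $ 1 $ 2)"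
      by (simp add: mat2_mult_component P S algebra_simps)
  qed
  thus ?thesis unfolding a_eq using subspace_su2 by (rule subspace_scale[rotated])
qed

lemma D_a_su2: "D (a n) x \<in> su2"
  by (rule su2_derivative[OF a_su2 a_deriv])

lemma a_periodic: "a n (x + 1) = a n x"
proof -
  have "((\<lambda>x. \<Phi> n (x + 1)) has_vector_derivative D (\<Phi> n) (x + 1)) (at x)"
    by (rule has_vector_derivative_shift[OF C2_D(1)[OF \<Phi>_C2]])
  hence "D (\<Phi> n) (x + 1) = D (\<Phi> n) x"
    unfolding \<Phi>_periodic by (simp add: vector_derivative_at)
  thus ?thesis by (simp add: a_eq \<Phi>_periodic)
qed

lemma a_uniform: "uniform_limit UNIV a \<psi> sequentially"
  using uniform unfolding uniformly_convergent_uniform_limit_iff \<psi>_def[abs_def] .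

lemma a_tendsto: "(\<lambda>n. a n x) \<longlonglongrightarrow> \<psi> x"
  by (rule tendsto_uniform_limitI[OF a_uniform]) simp

lemma \<psi>_cont: "continuous_on A \<psi>"
  by (rule continuous_on_subset[OF uniform_limit_theorem[OF _ a_uniform]]) (simp_all add: a_cont)

lemma \<psi>_su2: "\<psi> x \<in> su2"
  by (rule closed_sequentially[OF closed_su2 _ a_tendsto]) (rule a_su2)

lemma \<psi>_periodic: "\<psi> (x + 1) = \<psi> x"
  by (simp add: \<psi>_def a_periodic)

lemma a_close:
  assumes "\<epsilon> > 0"
  shows "\<forall>\<^sub>F n in sequentially. \<forall>x. su2_norm (a n x - \<psi> x) < \<epsilon>"
  using uniform_limitD[OF a_uniform assms]
proof eventually_elim
  case (elim n)
  have "su2_norm (a n x - \<psi> x) < \<epsilon>" for x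
  proof -
    have "su2_norm (a n x - \<psi> x) = norm (a n x - \<psi> x) / sqrt 2"
      by (intro su2_norm_eq subspace_diff[OF subspace_su2] a_su2 \<psi>_su2)
    also have "\<dots> \<le> norm (a n x - \<psi> x)" by (simp add: divide_le_eq mult_le_cancel_left1)
    also have "\<dots> < \<epsilon>" using elim by (simp add: dist_norm)
    finally show ?thesis .
  qed
  thus ?case by blast
qed

text \<open>The product rule applied to \<open>\<Phi>_Suc\<close>. As n grows, the first summand
  vanishes and the weight of the second tends to 1, which yields the conjugation law of
  \<open>\<psi>\<close>.\<close>

lemma a_Suc:
  assumes "n \<ge> 1"
  shows "a (Suc n) x = (1 / real (Suc n)) *\<^sub>R (D \<phi> x ** adjoint_mat (\<phi> x))
    + (real n / real (Suc n)) *\<^sub>R (\<phi> x ** a n (x + \<alpha>) ** adjoint_mat (\<phi> x))"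
proof -
  let ?F = "\<Phi> n (x + \<alpha>)"
  have "(\<Phi> (Suc n) has_vector_derivative \<phi> x ** (real n *\<^sub>R (a n (x + \<alpha>) ** ?F)) + D \<phi> x ** ?F) (at x)"
    unfolding \<Phi>_Suc[abs_def]
    by (intro has_vector_derivative_mat2_mult has_vector_derivative_shift D_\<Phi> assms C2_D(1) \<phi>_C2)
  hence "D (\<Phi> (Suc n)) x = \<phi> x ** (real n *\<^sub>R (a n (x + \<alpha>) ** ?F)) + D \<phi> x ** ?F"
    by (rule vector_derivative_at)
  also have "\<dots> ** adjoint_mat (\<Phi> (Suc n) x) = real n *\<^sub>R (\<phi> x ** a n (x + \<alpha>) ** adjoint_mat (\<phi> x)) + D \<phi> x ** adjoint_mat (\<phi> x)"
  proof -
    have c: "Z ** (?F ** (adjoint_mat ?F ** adjoint_mat (\<phi> x))) = Z ** adjoint_mat (\<phi> x)" for Z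
      by (simp add: SU2_cancel(1)[OF \<Phi>_SU2])
    show ?thesis
      by (simp add: \<Phi>_Suc adjoint_mat_mult bounded_bilinear.scaleR_left[OF bounded_bilinear_mat2_mult]
          bounded_bilinear.scaleR_right[OF bounded_bilinear_mat2_mult]
          bounded_bilinear.add_left[OF bounded_bilinear_mat2_mult] matrix_mul_assoc[symmetric] c
          SU2_cancel(1)[OF \<Phi>_SU2] del: cocycle_iter.simps)
  qed
  finally show ?thesis unfolding a_eq[of "Suc n"] by (simp add: scaleR_add_right add.commute)
qed

lemma \<psi>_conj: "\<psi> x = \<phi> x ** \<psi> (x + \<alpha>) ** adjoint_mat (\<phi> x)"
proof (rule LIMSEQ_unique)
  show "(\<lambda>n. a (Suc n) x) \<longlonglongrightarrow> \<psi> x" by (rule LIMSEQ_Suc[OF a_tendsto])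
  note mt = bounded_bilinear.tendsto[OF bounded_bilinear_mat2_mult]
  have "(\<lambda>n. 1 / real (Suc n)) \<longlonglongrightarrow> 0" by (rule LIMSEQ_Suc[OF lim_1_over_n])
  moreover have "(\<lambda>n. real n / real (Suc n)) \<longlonglongrightarrow> 1" by (rule LIMSEQ_n_over_Suc_n)
  ultimately have "(\<lambda>n. (1 / real (Suc n)) *\<^sub>R (D \<phi> x ** adjoint_mat (\<phi> x))
    + (real n / real (Suc n)) *\<^sub>R (\<phi> x ** a n (x + \<alpha>) ** adjoint_mat (\<phi> x)))
    \<longlonglongrightarrow> 0 *\<^sub>R (D \<phi> x ** adjoint_mat (\<phi> x)) + 1 *\<^sub>R (\<phi> x ** \<psi> (x + \<alpha>) ** adjoint_mat (\<phi> x))"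
    by (intro tendsto_intros mt a_tendsto)
  moreover have "\<forall>\<^sub>F n in sequentially. (1 / real (Suc n)) *\<^sub>R (D \<phi> x ** adjoint_mat (\<phi> x))
    + (real n / real (Suc n)) *\<^sub>R (\<phi> x ** a n (x + \<alpha>) ** adjoint_mat (\<phi> x)) = a (Suc n) x"
    using eventually_ge_at_top[of 1] by eventually_elim (simp add: a_Suc)
  ultimately show "(\<lambda>n. a (Suc n) x) \<longlonglongrightarrow> \<phi> x ** \<psi> (x + \<alpha>) ** adjoint_mat (\<phi> x)"
    by (simp add: tendsto_cong)
qed

lemma \<psi>_\<phi>: "\<psi> x ** \<phi> x = \<phi> x ** \<psi> (x + \<alpha>)"
  by (subst \<psi>_conj) (simp add: SU2_cancel[OF \<phi>_SU2])

lemma \<psi>_\<Phi>: "\<psi> x ** \<Phi> n x = \<Phi> n x ** \<psi> (x + real n * \<alpha>)"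
proof (induction n)
  case (Suc n)
  have "\<psi> x ** \<Phi> (Suc n) x = \<Phi> n x ** (\<psi> (x + real n * \<alpha>) ** \<phi> (x + real n * \<alpha>))"
    by (simp add: matrix_mul_assoc Suc.IH)
  also have "\<dots> = \<Phi> (Suc n) x ** \<psi> (x + real n * \<alpha> + \<alpha>)"
    unfolding \<psi>_\<phi> by (simp add: matrix_mul_assoc)
  finally show ?case by (simp add: algebra_simps)
qed simp

definition "d = su2_norm (\<psi> 0)"

text \<open>Conjugation preserves the determinant, so the norm has the periods 1 and
  \<open>\<alpha>\<close> and is continuous, hence constant.\<close>

lemma \<psi>_norm: "su2_norm (\<psi> x) = d"
  unfolding d_def
proof (rule periodic_continuous_constant[OF irrational, of "\<lambda>x. su2_norm (\<psi> x)"])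
  have "su2_norm (\<psi> x) = norm (\<psi> x) / sqrt 2" for x by (rule su2_norm_eq[OF \<psi>_su2])
  thus "continuous_on UNIV (\<lambda>x. su2_norm (\<psi> x))"
    by (simp only:) (intro continuous_intros \<psi>_cont, simp)
  show "su2_norm (\<psi> (x + 1)) = su2_norm (\<psi> x)" for x by (simp add: \<psi>_periodic)
  show "su2_norm (\<psi> (x + \<alpha>)) = su2_norm (\<psi> x)" for x
    using \<phi>_SU2[of x] SU2_adjoint[OF \<phi>_SU2[of x]]
    by (subst \<psi>_conj[of x]) (simp add: su2_norm_def det_mul SU2_def)
qed

lemma has_degree_d: "has_degree \<alpha> \<phi> d"
  unfolding has_degree_def
proof (intro exI[of _ \<psi>] conjI)
  interpret prob_space circle by (rule prob_space_circle)
  have \<psi>m: "\<psi> \<in> borel_measurable borel" by (rule borel_measurable_continuous_onI[OF \<psi>_cont])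
  thus "\<psi> \<in> borel_measurable circle" by (rule borel_measurable_circle)
  show "\<forall>x\<in>space circle. \<psi> x \<in> su2" by (simp add: \<psi>_su2)
  show "integrable circle (\<lambda>x. (su2_norm (\<psi> x))\<^sup>2)" by (simp add: \<psi>_norm)
  show "AE x in circle. (\<lambda>n. a n x) \<longlonglongrightarrow> \<psi> x" by (simp add: a_tendsto)
  show "AE x in circle. su2_norm (\<psi> x) = d" by (simp add: \<psi>_norm)
  show "(\<lambda>n. LINT x|circle. (su2_norm (a n x - \<psi> x))\<^sup>2) \<longlonglongrightarrow> 0"
  proof (rule tendstoI)
    fix e :: real assume e: "e > 0"
    define r where "r = sqrt (e / 2)"
    have r: "r > 0" "r\<^sup>2 = e / 2" using e by (auto simp: r_def)
    show "\<forall>\<^sub>F n in sequentially. dist (LINT x|circle. (su2_norm (a n x - \<psi> x))\<^sup>2) 0 < e"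
      using a_close[OF r(1)]
    proof eventually_elim
      case (elim n)
      have eq: "su2_norm (a n x - \<psi> x) = norm (a n x - \<psi> x) / sqrt 2" for x
        by (intro su2_norm_eq subspace_diff[OF subspace_su2] a_su2 \<psi>_su2)
      have b: "(su2_norm (a n x - \<psi> x))\<^sup>2 \<le> e / 2" for x
        unfolding r(2)[symmetric] using elim by (intro power_mono) (auto simp: eq less_imp_le)
      have "continuous_on UNIV (\<lambda>x. (su2_norm (a n x - \<psi> x))\<^sup>2)"
        unfolding eq by (intro continuous_intros a_cont \<psi>_cont) auto
      hence m: "(\<lambda>x. (su2_norm (a n x - \<psi> x))\<^sup>2) \<in> borel_measurable circle"
        by (intro borel_measurable_circle borel_measurable_continuous_onI)
      have "(LINT x|circle. (su2_norm (a n x - \<psi> x))\<^sup>2) \<le> e / 2"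
        by (rule integral_le_const[OF integrable_circle_bounded[OF m, of "e / 2"]]) (use b in auto)
      moreover have "0 \<le> (LINT x|circle. (su2_norm (a n x - \<psi> x))\<^sup>2)" by simp
      ultimately show ?case using e by (simp add: dist_real_def)
    qed
  qed
qed

text \<open>The description by \<open>THE\<close> is unique because any other limit function agrees
  with \<open>\<psi>\<close> almost everywhere.\<close>

lemma cocycle_degree_eq: "cocycle_degree \<alpha> \<phi> = d"
  unfolding cocycle_degree_def
proof (rule the_equality)
  show "has_degree \<alpha> \<phi> d" by (rule has_degree_d)
  interpret prob_space circle by (rule prob_space_circle)
  fix d' assume "has_degree \<alpha> \<phi> d'"
  then obtain \<psi>' where "AE x in circle. (\<lambda>n. a n x) \<longlonglongrightarrow> \<psi>' x" "AE x in circle. su2_norm (\<psi>' x) = d'"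
    unfolding has_degree_def by blast
  hence "AE x in circle. d' = d"
  proof eventually_elim
    case (elim x)
    have "\<psi>' x = \<psi> x" by (rule LIMSEQ_unique[OF elim(1) a_tendsto])
    thus ?case using elim(2) \<psi>_norm by simp
  qed
  thus "d' = d" by simp
qed

lemma d_pos: "d > 0"
proof -
  have "d \<ge> 0" unfolding d_def su2_norm_eq[OF \<psi>_su2] by simp
  thus ?thesis using degree cocycle_degree_eq by simp
qed

end

subsection \<open>The oscillatory integral estimate\<close>

lemma cin_residual_norm:
  assumes "norm s = 1" "norm w = 1"
  shows "(norm (w - cin w s *s s))\<^sup>2 = 1 - (cmod (cin w s))\<^sup>2"
proof -
  let ?u = "cin w s"
  have "complex_of_real ((norm (w - ?u *s s))\<^sup>2) = cin (w - ?u *s s) (w - ?u *s s)"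
    by (simp only: cin_self)
  also have "\<dots> = cin w w - ?u * cnj ?u - cnj ?u * ?u + ?u * cnj ?u * cin s s"
    by (simp add: cin_diff_left cin_diff_right cin_smult_left cin_smult_right cin_commute[of s w] algebra_simps)
  also have "\<dots> = 1 - ?u * cnj ?u" using assms by (simp add: cin_self)
  also have "\<dots> = of_real (1 - (cmod ?u)\<^sup>2)" by (simp only: of_real_diff complex_norm_square of_real_1)
  finally show ?thesis by (simp only: of_real_eq_iff)
qed

lemmas has_vector_derivative_cin = bounded_bilinear.has_vector_derivative[OF bounded_bilinear_cin]
lemmas has_vector_derivative_mat2_vec = bounded_bilinear.has_vector_derivative[OF bounded_bilinear_mat2_vec]
lemmas continuous_on_cin = bounded_bilinear.continuous_on[OF bounded_bilinear_cin]
lemmas continuous_on_mat2_vec = bounded_bilinear.continuous_on[OF bounded_bilinear_mat2_vec]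

text \<open>Let u = <\<open>\<Phi>\<close> t, s> and L = Im <A s, s>. If \<open>\<Phi>\<close> t
  were exactly a multiple of s, then u' would be u times i n L plus the connection forms of s and t.
  Dividing V by L gives a function W for which the derivative of W u^m is i n m V u^m up to two
  errors: the term with W' keeps both factors 1/n and 1/m, while the connection forms come with the
  factor m of the differentiated power and keep only 1/n. The number e bounds the failure of
  \<open>\<Phi>\<close> t to be parallel to s.\<close>

lemma oscillatory_integral_bound:
  fixes \<Phi> A A' :: "real \<Rightarrow> cmat2" and s s' t t' :: "real \<Rightarrow> complex ^ 2" and V V' :: "real \<Rightarrow> real"
  assumes "p \<le> q" and nm: "n \<ge> 1" "m \<ge> 1" and c: "c > 0" and e: "e \<ge> 0"
    and \<Phi>: "\<And>x. \<Phi> x \<in> SU2" "\<And>x. (\<Phi> has_vector_derivative real n *\<^sub>R (A x ** \<Phi> x)) (at x)"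
    and A: "\<And>x. A x \<in> su2" "\<And>x. A' x \<in> su2" "\<And>x. (A has_vector_derivative A' x) (at x)" "continuous_on UNIV A'"
    and Ab: "\<And>x. x \<in> {p..q} \<Longrightarrow> su2_norm (A x) \<le> a0"
    and s: "\<And>x. x \<in> {p..q} \<Longrightarrow> (s has_vector_derivative s' x) (at x)" "continuous_on {p..q} s'"
      "\<And>x. x \<in> {p..q} \<Longrightarrow> norm (s x) = 1"
    and t: "\<And>x. x \<in> {p..q} \<Longrightarrow> (t has_vector_derivative t' x) (at x)" "continuous_on {p..q} t'"
      "\<And>x. x \<in> {p..q} \<Longrightarrow> norm (t x) = 1"
    and V: "\<And>x. (V has_vector_derivative V' x) (at x)" "continuous_on UNIV V'" "V p = 0" "V q = 0"
      "\<And>x. x \<in> {p..q} \<Longrightarrow> 0 \<le> V x \<and> V x \<le> 1"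
    and lam: "\<And>x. x \<in> {p..q} \<Longrightarrow> c \<le> Im (cin (A x *v s x) (s x))"
    and res: "\<And>x. x \<in> {p..q} \<Longrightarrow> norm (\<Phi> x *v t x - cin (\<Phi> x *v t x) (s x) *s s x) \<le> e"
  shows "cmod (integral {p..q} (\<lambda>x. of_real (V x) * cin (\<Phi> x *v t x) (s x) ^ m))
    \<le> integral {p..q} (\<lambda>x. (\<bar>V' x\<bar> / c + (su2_norm (A' x) + 2 * a0 * norm (s' x)) / c\<^sup>2) / (real n * real m)
        + (real n * a0 * e + cmod (cin (s' x) (s x)) + cmod (cin (t' x) (t x)) + e * (norm (s' x) + norm (t' x))) / (real n * c))"
proof -
  define u where "u x = cin (\<Phi> x *v t x) (s x)" for x
  define u' where "u' x = cin (\<Phi> x *v t x) (s' x) + cin (\<Phi> x *v t' x + (real n *\<^sub>R (A x ** \<Phi> x)) *v t x) (s x)" for x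
  define L where "L x = Im (cin (A x *v s x) (s x))" for x
  define L' where "L' x = Im (cin (A x *v s x) (s' x) + cin (A x *v s' x + A' x *v s x) (s x))" for x
  define W where "W x = V x / L x" for x
  define W' where "W' x = V' x / L x - V x * L' x / (L x)\<^sup>2" for x
  define G' where "G' x = of_real (W x) * (of_nat m * u x ^ (m - 1) * u' x) + of_real (W' x) * u x ^ m" for x
  define K where "K x = (\<bar>V' x\<bar> / c + (su2_norm (A' x) + 2 * a0 * norm (s' x)) / c\<^sup>2) / (real n * real m)
        + (real n * a0 * e + cmod (cin (s' x) (s x)) + cmod (cin (t' x) (t x)) + e * (norm (s' x) + norm (t' x))) / (real n * c)" for x
  have Lc: "L x \<ge> c" "L x > 0" if "x \<in> {p..q}" for x using lam[OF that] c by (auto simp: L_def)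
  have du: "(u has_vector_derivative u' x) (at x)" if "x \<in> {p..q}" for x
    unfolding u_def u'_def by (intro has_vector_derivative_cin has_vector_derivative_mat2_vec \<Phi> s t that)
  have dL: "(L has_vector_derivative L' x) (at x)" if "x \<in> {p..q}" for x
    unfolding L_def L'_def
    by (intro bounded_linear.has_vector_derivative[OF bounded_linear_Im] has_vector_derivative_cin has_vector_derivative_mat2_vec A s that)
  have dW: "(W has_vector_derivative W' x) (at x)" if "x \<in> {p..q}" for x
  proof -
    have "(V has_real_derivative V' x) (at x)" "(L has_real_derivative L' x) (at x)"
      using V(1) dL[OF that] by (auto simp: has_real_derivative_iff_has_vector_derivative)
    hence "((\<lambda>x. V x / L x) has_real_derivative (V' x * L x - V x * L' x) / (L x * L x)) (at x)"
      using Lc[OF that] by (intro DERIV_divide) auto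
    moreover have "(V' x * L x - V x * L' x) / (L x * L x) = W' x"
      using Lc(2)[OF that] by (simp add: W'_def field_simps power2_eq_square)
    ultimately show ?thesis by (simp add: W_def[abs_def] has_real_derivative_iff_has_vector_derivative)
  qed
  have dG: "((\<lambda>x. of_real (W x) * u x ^ m) has_vector_derivative G' x) (at x)" if "x \<in> {p..q}" for x
  proof -
    have "((\<lambda>x. complex_of_real (W x)) has_vector_derivative of_real (W' x)) (at x)"
      using bounded_linear.has_vector_derivative[OF bounded_linear_of_real dW[OF that]] .
    moreover have "((\<lambda>x. u x ^ m) has_vector_derivative of_nat m * u x ^ (m - 1) * u' x) (at x)"
    proof -
      have "((\<lambda>z. z ^ m) has_field_derivative of_nat m * u x ^ (m - 1)) (at (u x))"
        by (auto intro!: derivative_eq_intros)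
      from field_vector_diff_chain_at[OF du[OF that] this] show ?thesis by (simp add: o_def mult_ac)
    qed
    ultimately show ?thesis unfolding G'_def by (rule has_vector_derivative_mult)
  qed
  have "(G' has_integral (of_real (W q) * u q ^ m - of_real (W p) * u p ^ m)) {p..q}"
    by (rule fundamental_theorem_of_calculus[OF \<open>p \<le> q\<close>])
       (use dG in \<open>auto intro: has_vector_derivative_at_within\<close>)
  hence G0: "(G' has_integral 0) {p..q}" using V(3,4) by (simp add: W_def)
  have contu: "continuous_on {p..q} u"
    by (rule continuous_at_imp_continuous_on) (use du has_vector_derivative_continuous in blast)
  have contV: "continuous_on {p..q} V"
    by (rule has_vector_derivative_imp_continuous_on[OF V(1)])
  have contt: "continuous_on {p..q} t"
    by (rule continuous_at_imp_continuous_on) (use t(1) has_vector_derivative_continuous in blast)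
  have conts: "continuous_on {p..q} s"
    by (rule continuous_at_imp_continuous_on) (use s(1) has_vector_derivative_continuous in blast)
  have Vu: "(\<lambda>x. of_real (V x) * u x ^ m) integrable_on {p..q}"
    by (intro integrable_continuous_real continuous_intros contV contu)
  have Kint: "K integrable_on {p..q}"
    unfolding K_def su2_norm_eq[OF A(2)] using nm c
    by (intro integrable_continuous_real continuous_intros continuous_on_cin conts contt s(2) t(2)
        continuous_on_subset[OF A(4)] continuous_on_subset[OF V(2)]) auto
  define k where "k = 1 / (\<i> * of_nat n * of_nat m :: complex)"
  have kn: "cmod k = 1 / (real n * real m)" by (simp add: k_def norm_divide norm_mult)
  have bound: "cmod (of_real (V x) * u x ^ m - k * G' x) \<le> K x" if x: "x \<in> {p..q}" for x
  proof -
    define r where "r = \<Phi> x *v t x - u x *s s x"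
    \<comment> \<open>The residual after moving \<open>\<Phi>\<close> to the other side, used to
      expand the term with t' along t. By Pythagoras it is as long as r.\<close>
    define r2 where "r2 = adjoint_mat (\<Phi> x) *v s x - cnj (u x) *s t x"
    \<comment> \<open>What remains of u' besides the main term: residual terms and the two
      connection forms.\<close>
    define E where "E = u' x - \<i> * of_nat n * of_real (L x) * u x"
    have ns: "norm (s x) = 1" and nt: "norm (t x) = 1" using s(3) t(3) x by auto
    have nw: "norm (\<Phi> x *v t x) = 1" using nt by (simp add: norm_SU2_vec \<Phi>)
    have rn: "norm r \<le> e" using res[OF x] by (simp add: r_def u_def)
    have c2: "cin (adjoint_mat (\<Phi> x) *v s x) (t x) = cnj (u x)"
      by (simp add: u_def cin_adjoint_mat cin_commute[of "s x"])
    have "(norm r2)\<^sup>2 = 1 - (cmod (cnj (u x)))\<^sup>2"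
      unfolding r2_def c2[symmetric]
      by (rule cin_residual_norm[OF nt]) (simp add: norm_SU2_vec SU2_adjoint \<Phi> ns)
    also have "\<dots> = (norm r)\<^sup>2"
      using cin_residual_norm[OF ns nw] by (simp add: r_def u_def)
    finally have "norm r2 = norm r" by (simp add: power2_eq_iff_nonneg)
    hence r2n: "norm r2 \<le> e" using rn by simp
    have u1: "cmod (u x) \<le> 1" using cin_bound[of "\<Phi> x *v t x" "s x"] nw ns by (simp add: u_def)
    have un: "cmod (u x ^ k) \<le> 1" for k using u1 by (simp add: norm_power power_le_one)
    have a0: "su2_norm (A x) \<le> a0" "a0 \<ge> 0"
      using Ab[OF x] su2_norm_eq[OF A(1)[of x]] norm_ge_zero[of "A x"] by (auto intro: order_trans[rotated])
    have w: "\<Phi> x *v t x = u x *s s x + r" by (simp add: r_def)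
    have As: "cin (A x *v s x) (s x) = \<i> * of_real (L x)"
      using Re_cin_su2[OF A(1), of x "s x"] by (simp add: complex_eq_iff L_def)
    have "(real n *\<^sub>R (A x ** \<Phi> x)) *v t x = of_nat n *s (A x *v (\<Phi> x *v t x))"
      by (simp add: matrix_vector_mul_assoc vec_eq_iff mat2_vec_component scaleR_conv_of_real[where 'a=complex] algebra_simps)
    also have "\<dots> = of_nat n *s (u x *s (A x *v s x) + A x *v r)"
      unfolding w by (simp add: matrix_vector_right_distrib smult_mat2_vec)
    finally have e1: "cin ((real n *\<^sub>R (A x ** \<Phi> x)) *v t x) (s x) = \<i> * of_nat n * of_real (L x) * u x + of_nat n * cin (A x *v r) (s x)"
      by (simp add: cin_smult_left cin_add_left As algebra_simps)
    have e2: "cin (\<Phi> x *v t x) (s' x) = u x * cin (s x) (s' x) + cin r (s' x)"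
      unfolding w by (simp add: cin_add_left cin_smult_left)
    have "cin (\<Phi> x *v t' x) (s x) = cin (t' x) (cnj (u x) *s t x + r2)"
      by (simp add: cin_adjoint_mat r2_def)
    hence e3: "cin (\<Phi> x *v t' x) (s x) = u x * cin (t' x) (t x) + cin (t' x) r2"
      by (simp add: cin_add_right cin_smult_right)
    have E: "E = of_nat n * cin (A x *v r) (s x) + (u x * cin (s x) (s' x) + cin r (s' x)) + (u x * cin (t' x) (t x) + cin (t' x) r2)"
      unfolding E_def u'_def cin_add_left e1 e2 e3 by simp
    have b1: "cmod (of_nat n * cin (A x *v r) (s x)) \<le> real n * a0 * e"
    proof -
      have "cmod (cin (A x *v r) (s x)) \<le> norm (A x *v r) * norm (s x)" by (rule cin_bound)
      also have "\<dots> = su2_norm (A x) * norm r" by (simp add: ns norm_su2_vec A)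
      also have "\<dots> \<le> a0 * e" using a0 rn by (intro mult_mono) auto
      finally have "real n * cmod (cin (A x *v r) (s x)) \<le> real n * (a0 * e)" by (rule mult_left_mono) simp
      thus ?thesis by (simp add: norm_mult mult.assoc)
    qed
    have b2: "cmod (u x * cin (s x) (s' x)) \<le> cmod (cin (s' x) (s x))"
      using u1 by (simp add: norm_mult cin_commute[of "s x" "s' x"] mult_left_le_one_le)
    have b3: "cmod (cin r (s' x)) \<le> e * norm (s' x)"
      using rn by (intro order_trans[OF cin_bound] mult_right_mono) auto
    have b4: "cmod (u x * cin (t' x) (t x)) \<le> cmod (cin (t' x) (t x))"
      using u1 by (simp add: norm_mult mult_left_le_one_le)
    have b5: "cmod (cin (t' x) r2) \<le> e * norm (t' x)"
      using r2n by (subst mult.commute) (intro order_trans[OF cin_bound] mult_left_mono, auto)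
    have Eb: "cmod E \<le> real n * a0 * e + cmod (cin (s' x) (s x)) + cmod (cin (t' x) (t x)) + e * (norm (s' x) + norm (t' x))"
      (is "_ \<le> ?B")
    proof -
      have "cmod E \<le> cmod (of_nat n * cin (A x *v r) (s x)) + (cmod (u x * cin (s x) (s' x)) + cmod (cin r (s' x))) + (cmod (u x * cin (t' x) (t x)) + cmod (cin (t' x) r2))"
        unfolding E by (intro norm_triangle_le add_mono order_refl)
      also have "\<dots> \<le> real n * a0 * e + (cmod (cin (s' x) (s x)) + e * norm (s' x)) + (cmod (cin (t' x) (t x)) + e * norm (t' x))"
        by (intro add_mono b1 b2 b3 b4 b5)
      finally show ?thesis by (simp add: algebra_simps)
    qed
    have L'b: "\<bar>L' x\<bar> \<le> su2_norm (A' x) + 2 * a0 * norm (s' x)"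
    proof -
      have "\<bar>L' x\<bar> \<le> cmod (cin (A x *v s x) (s' x) + cin (A x *v s' x + A' x *v s x) (s x))"
        unfolding L'_def by (rule abs_Im_le_cmod)
      also have "\<dots> \<le> norm (A x *v s x) * norm (s' x) + (norm (A x *v s' x) * norm (s x) + norm (A' x *v s x) * norm (s x))"
        unfolding cin_add_left by (intro norm_triangle_le add_mono cin_bound)
      also have "\<dots> = 2 * (su2_norm (A x) * norm (s' x)) + su2_norm (A' x)"
        by (simp add: norm_su2_vec A ns)
      also have "\<dots> \<le> 2 * (a0 * norm (s' x)) + su2_norm (A' x)"
        using a0 by (intro add_mono mult_left_mono mult_right_mono) auto
      finally show ?thesis by simp
    qed
    have W'b: "\<bar>W' x\<bar> \<le> \<bar>V' x\<bar> / c + (su2_norm (A' x) + 2 * a0 * norm (s' x)) / c\<^sup>2"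
    proof -
      have "\<bar>W' x\<bar> \<le> \<bar>V' x\<bar> / L x + V x * \<bar>L' x\<bar> / (L x)\<^sup>2"
        unfolding W'_def using abs_triangle_ineq4[of "V' x / L x" "V x * L' x / (L x)\<^sup>2"] Lc[OF x] V(5)[OF x]
        by (simp add: abs_mult)
      also have "\<dots> \<le> \<bar>V' x\<bar> / c + 1 * (su2_norm (A' x) + 2 * a0 * norm (s' x)) / c\<^sup>2"
        using Lc[OF x] V(5)[OF x] L'b c by (intro add_mono frac_le mult_mono power_mono) auto
      finally show ?thesis by simp
    qed
    have Wb: "0 \<le> W x" "W x \<le> 1 / c"
      using Lc[OF x] V(5)[OF x] c by (auto simp: W_def intro!: frac_le)
    \<comment> \<open>Inserting u' = i n L u + E, the main term becomes i n m V u^m because W L = V;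
      dividing by i n m recovers the integrand.\<close>
    have "G' x = of_real (W' x) * u x ^ m + of_real (W x) * of_nat m * u x ^ (m - 1) * E
      + \<i> * of_nat n * of_nat m * of_real (W x * L x) * (u x * u x ^ (m - 1))"
      unfolding G'_def E_def by (simp add: algebra_simps)
    also have "u x * u x ^ (m - 1) = u x ^ m" using nm by (simp add: power_eq_if)
    also have "W x * L x = V x" using Lc(2)[OF x] by (simp add: W_def)
    finally have G': "G' x = of_real (W' x) * u x ^ m + of_real (W x) * of_nat m * u x ^ (m - 1) * E
      + \<i> * of_nat n * of_nat m * of_real (V x) * u x ^ m" by simp
    have kk: "k * (\<i> * of_nat n * of_nat m * of_real (V x) * u x ^ m) = of_real (V x) * u x ^ m"
      using nm by (simp add: k_def)
    have "of_real (V x) * u x ^ m - k * G' x = - (k * (of_real (W' x) * u x ^ m + of_real (W x) * of_nat m * u x ^ (m - 1) * E))"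
      unfolding G' distrib_left[of k] kk by simp
    hence "cmod (of_real (V x) * u x ^ m - k * G' x) = cmod k * cmod (of_real (W' x) * u x ^ m + of_real (W x) * of_nat m * u x ^ (m - 1) * E)"
      by (simp only: norm_minus_cancel norm_mult)
    also have "\<dots> \<le> cmod k * (\<bar>W' x\<bar> * 1 + W x * real m * 1 * cmod E)"
    proof (intro mult_left_mono norm_triangle_le add_mono)
      show "cmod (of_real (W' x) * u x ^ m) \<le> \<bar>W' x\<bar> * 1"
        unfolding norm_mult using un by (intro mult_mono) auto
      have "cmod (of_real (W x) * of_nat m * u x ^ (m - 1) * E) = W x * real m * cmod (u x ^ (m - 1)) * cmod E"
        using Wb by (simp add: norm_mult)
      also have "\<dots> \<le> W x * real m * 1 * cmod E"
        using Wb un by (intro mult_mono) auto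
      finally show "cmod (of_real (W x) * of_nat m * u x ^ (m - 1) * E) \<le> W x * real m * 1 * cmod E" .
    qed simp
    also have "\<dots> \<le> cmod k * ((\<bar>V' x\<bar> / c + (su2_norm (A' x) + 2 * a0 * norm (s' x)) / c\<^sup>2) * 1 + (1 / c) * real m * 1 * ?B)"
      using W'b Wb Eb c by (intro mult_left_mono add_mono mult_mono) auto
    also have "\<dots> = K x"
      unfolding kn K_def using nm c by (simp add: field_simps)
    finally show ?thesis .
  qed
  have "integral {p..q} (\<lambda>x. of_real (V x) * u x ^ m) = integral {p..q} (\<lambda>x. of_real (V x) * u x ^ m - k * G' x)"
    using integral_unique[OF has_integral_diff[OF integrable_integral[OF Vu] has_integral_mult_right[OF G0, of k]]] by simp
  also have "cmod \<dots> \<le> integral {p..q} K"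
    by (intro integral_norm_bound_integral Kint bound integrable_diff Vu has_integral_integrable[OF has_integral_mult_right[OF G0]])
  finally show ?thesis unfolding u_def K_def .
qed

section \<open>Sections of the eigenlines and their derivatives\<close>

definition eig_sec :: "real \<Rightarrow> complex ^ 2 \<Rightarrow> cmat2 \<Rightarrow> complex ^ 2" where
  "eig_sec d e A = sgn (eig_proj d e A)"

lemma sgn_vec2: "sgn (u :: complex ^ 2) = of_real (1 / norm u) *s u"
  by (simp add: sgn_div_norm scaleR_conv_smult inverse_eq_divide)

lemma eig_sec_eigenvector:
  assumes "A \<in> su2" "su2_norm A = d" "d > 0"
  shows "A *v eig_sec d e A = (\<i> * of_real d) *s eig_sec d e A"
  unfolding eig_sec_def sgn_vec2 smult_mat2_vec eig_proj_eigenvector[OF assms]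
  by (simp add: vec_eq_iff)

lemma eig_proj_near:
  assumes "d > 0" "norm (A *v e - (\<i> * of_real d) *s e) \<le> \<eta> * d"
  shows "norm (eig_proj d e A - 2 *s e) \<le> \<eta>"
proof -
  have "eig_proj d e A - 2 *s e = (- \<i> / of_real d) *s (A *v e - (\<i> * of_real d) *s e)"
    using assms(1) by (simp add: eig_proj_def vec_eq_iff field_simps)
  hence "norm (eig_proj d e A - 2 *s e) = cmod (- \<i> / of_real d) * norm (A *v e - (\<i> * of_real d) *s e)"
    by (simp only: norm_smult_vec2)
  also have "\<dots> = norm (A *v e - (\<i> * of_real d) *s e) / d"
    using assms(1) by (simp add: norm_divide)
  finally show ?thesis using assms by (simp add: divide_le_eq)
qed

text \<open>The vector is within 1/2 of 2 e. This keeps it away from zero, so that normalising it is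
  smooth and Lipschitz.\<close>

lemma eig_proj_norm_ge_1:
  assumes "d > 0" "norm (A *v e - (\<i> * of_real d) *s e) \<le> \<eta> * d" "\<eta> \<le> 1 / 2" "norm e = 1"
  shows "1 \<le> norm (eig_proj d e A)"
proof -
  have "norm (2 *s e) \<le> norm (eig_proj d e A) + norm (eig_proj d e A - 2 *s e)"
    by (metis add_diff_cancel_left' diff_add_cancel norm_triangle_ineq4)
  thus ?thesis using eig_proj_near[OF assms(1,2)] assms(3,4) by (simp add: norm_smult_vec2)
qed

lemma sgn_Lipschitz:
  fixes p q :: "'a::real_normed_vector"
  assumes "1 \<le> norm p" "1 \<le> norm q"
  shows "norm (sgn p - sgn q) \<le> 2 * norm (p - q)"
proof -
  have p0: "norm p > 0" and q0: "norm q > 0" using assms by linarith+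
  have "sgn p - sgn q = (1 / norm p) *\<^sub>R (p - q) + ((norm q - norm p) / (norm p * norm q)) *\<^sub>R q"
  proof -
    have "(norm q - norm p) / (norm p * norm q) = 1 / norm p - 1 / norm q"
      using p0 q0 by (simp add: field_simps)
    thus ?thesis by (simp add: sgn_div_norm inverse_eq_divide scaleR_diff_left scaleR_diff_right del: divide_diff_eq_iff)
  qed
  also have "norm \<dots> \<le> (1 / norm p) * norm (p - q) + (\<bar>norm q - norm p\<bar> / (norm p * norm q)) * norm q"
    by (intro norm_triangle_le add_mono) auto
  also have "(\<bar>norm q - norm p\<bar> / (norm p * norm q)) * norm q = (1 / norm p) * \<bar>norm q - norm p\<bar>"
    using q0 by simp
  also have "(1 / norm p) * norm (p - q) + (1 / norm p) * \<bar>norm q - norm p\<bar> \<le> 1 * norm (p - q) + 1 * norm (p - q)"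
    using assms p0 norm_triangle_ineq3[of q p]
    by (intro add_mono mult_mono) (auto simp: norm_minus_commute divide_le_eq)
  finally show ?thesis by simp
qed

text \<open>The section \<^const>\<open>eig_sec\<close> is almost parallel: as \<^term>\<open>A' x\<close> is skew-Hermitian,
  the connection form of the section vanishes to first order at \<^term>\<open>e\<close>.\<close>
lemma eig_sec_derivative:
  fixes A A' :: "real \<Rightarrow> cmat2"
  assumes d: "d > 0" and A: "\<And>x. A x \<in> su2" "\<And>x. A' x \<in> su2" "\<And>x. (A has_vector_derivative A' x) (at x)"
    and cont: "continuous_on UNIV A'" and e: "norm e = 1" and \<eta>: "\<eta> \<le> 1 / 2"
    and near: "\<And>x. x \<in> J \<Longrightarrow> norm (A x *v e - (\<i> * of_real d) *s e) \<le> \<eta> * d"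
  obtains s' where "\<And>x. x \<in> J \<Longrightarrow> ((\<lambda>x. eig_sec d e (A x)) has_vector_derivative s' x) (at x)"
    "continuous_on J s'" "\<And>x. x \<in> J \<Longrightarrow> norm (s' x) \<le> 2 * su2_norm (A' x) / d"
    "\<And>x. x \<in> J \<Longrightarrow> cmod (cin (s' x) (eig_sec d e (A x))) \<le> \<eta> * su2_norm (A' x) / d"
proof -
  define q where "q x = eig_proj d e (A x)" for x
  define q' where "q' x = - ((\<i> / of_real d) *s (A' x *v e))" for x
  define s' where "s' x = (1 / norm (q x)) *\<^sub>R q' x - (inner (q x) (q' x) / (norm (q x)) ^ 3) *\<^sub>R q x" for x
  have q1: "1 \<le> norm (q x)" if "x \<in> J" for x
    unfolding q_def using d near[OF that] \<eta> e by (rule eig_proj_norm_ge_1)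
  have dq: "(q has_vector_derivative q' x) (at x)" for x
  proof -
    have "((\<lambda>x. A x *v e) has_vector_derivative A x *v 0 + A' x *v e) (at x)"
      by (intro has_vector_derivative_mat2_vec A(3) has_vector_derivative_const)
    from has_vector_derivative_diff[OF has_vector_derivative_const bounded_linear.has_vector_derivative[OF bounded_linear_smult_vec2 this]]
    show ?thesis unfolding q_def[abs_def] eig_proj_def q'_def by simp
  qed
  have cq: "continuous_on S q" for S by (rule has_vector_derivative_imp_continuous_on[OF dq])
  have cq': "continuous_on S q'" for S
    unfolding q'_def by (intro continuous_intros bounded_linear.continuous_on[OF bounded_linear_smult_vec2] continuous_on_mat2_vec continuous_on_subset[OF cont]) auto
  have nq': "norm (q' x) = su2_norm (A' x) / d" for x
    using d by (simp add: q'_def norm_smult_vec2 norm_divide norm_su2_vec[OF A(2)] e)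
  show thesis
  proof
    show "((\<lambda>x. eig_sec d e (A x)) has_vector_derivative s' x) (at x)" if x: "x \<in> J" for x
    proof -
      have n0: "norm (q x) > 0" using q1[OF x] by linarith
      have "((\<lambda>x. inner (q x) (q x)) has_vector_derivative inner (q x) (q' x) + inner (q' x) (q x)) (at x)"
        by (intro bounded_bilinear.has_vector_derivative[OF bounded_bilinear_inner] dq)
      hence "((\<lambda>x. inner (q x) (q x)) has_real_derivative 2 * inner (q x) (q' x)) (at x)"
        by (simp add: has_real_derivative_iff_has_vector_derivative inner_commute)
      hence "((\<lambda>x. sqrt (inner (q x) (q x))) has_real_derivative (inverse (sqrt (inner (q x) (q x))) / 2) * (2 * inner (q x) (q' x))) (at x)"
        by (rule DERIV_chain2[OF DERIV_real_sqrt, rotated]) (use n0 in \<open>simp add: norm_eq_sqrt_inner[where 'a="complex ^ 2"]\<close>)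
      hence "((\<lambda>x. norm (q x)) has_real_derivative (inverse (norm (q x)) / 2) * (2 * inner (q x) (q' x))) (at x)"
        unfolding norm_eq_sqrt_inner[where 'a="complex ^ 2"] .
      moreover have "(inverse a / 2) * (2 * b) = b / a" for a b :: real
        by (cases "a = 0") (simp_all add: field_simps)
      ultimately have "((\<lambda>x. norm (q x)) has_real_derivative inner (q x) (q' x) / norm (q x)) (at x)"
        by (simp only:)
      hence "((\<lambda>x. inverse (norm (q x))) has_real_derivative - (inverse (norm (q x)) * (inner (q x) (q' x) / norm (q x)) * inverse (norm (q x)))) (at x)"
        using n0 by (intro DERIV_inverse') auto
      moreover have "- (inverse a * (b / a) * inverse a) = - (b / a ^ 3)" for a b :: real
        by (cases "a = 0") (simp_all add: field_simps power3_eq_cube)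
      ultimately have "((\<lambda>x. inverse (norm (q x))) has_vector_derivative - (inner (q x) (q' x) / (norm (q x)) ^ 3)) (at x)"
        by (simp only: has_real_derivative_iff_has_vector_derivative)
      from bounded_bilinear.has_vector_derivative[OF bounded_bilinear_scaleR this dq[of x]]
      show ?thesis
        unfolding eig_sec_def sgn_div_norm q_def[symmetric] s'_def by (simp add: inverse_eq_divide)
    qed
    show "continuous_on J s'"
    proof -
      have nz: "norm (q x) \<noteq> 0" "norm (q x) ^ 3 \<noteq> 0" if "x \<in> J" for x
        using q1[OF that] by auto
      show ?thesis unfolding s'_def
        by (intro continuous_on_diff continuous_on_scaleR continuous_on_divide continuous_on_const
            continuous_on_norm continuous_on_inner continuous_on_power cq cq') (use nz in auto)
    qed
    fix x assume x: "x \<in> J"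
    have n0: "norm (q x) > 0" using q1[OF x] by linarith
    have "norm (s' x) \<le> (1 / norm (q x)) * norm (q' x) + (\<bar>inner (q x) (q' x)\<bar> / (norm (q x)) ^ 3) * norm (q x)"
      unfolding s'_def using norm_triangle_ineq4 by (rule order_trans) simp
    also have "\<dots> \<le> (1 / norm (q x)) * norm (q' x) + ((norm (q x) * norm (q' x)) / (norm (q x)) ^ 3) * norm (q x)"
      by (intro add_mono mult_right_mono divide_right_mono Cauchy_Schwarz_ineq2) auto
    also have "\<dots> = 2 * norm (q' x) / norm (q x)" using n0 by (simp add: field_simps power3_eq_cube)
    also have "\<dots> \<le> 2 * norm (q' x) / 1" using q1[OF x] by (intro divide_left_mono) auto
    finally show "norm (s' x) \<le> 2 * su2_norm (A' x) / d" by (simp add: nq')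
    \<comment> \<open>Normalising removes the real part: only i Im <q', q> survives, divided by the
      squared norm of q.\<close>
    have "cin (s' x) (eig_sec d e (A x)) = of_real ((1 / norm (q x))\<^sup>2) * (cin (q' x) (q x) - of_real (Re (cin (q' x) (q x))))"
    proof -
      have c: "cin (q x) (q x) = of_real (norm (q x) * norm (q x))" by (simp only: cin_self power2_eq_square)
      have "cin (s' x) (eig_sec d e (A x)) = of_real (1 / norm (q x)) * (of_real (1 / norm (q x)) * cin (q' x) (q x)
          - of_real (inner (q x) (q' x) / (norm (q x)) ^ 3) * cin (q x) (q x))"
        unfolding eig_sec_def sgn_div_norm q_def[symmetric] s'_def
        by (simp add: cin_scaleR_left cin_scaleR_right cin_diff_left inverse_eq_divide)
      also have "inner (q x) (q' x) = Re (cin (q' x) (q x))" by (simp add: Re_cin inner_commute)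
      finally show ?thesis unfolding c using n0 by (simp add: field_simps power2_eq_square power3_eq_cube)
    qed
    also have "cin (q' x) (q x) - of_real (Re (cin (q' x) (q x))) = \<i> * of_real (Im (cin (q' x) (q x)))"
      by (simp add: complex_eq_iff)
    \<comment> \<open><q', e> is real because A' is skew-Hermitian, so q may be replaced by q - 2 e,
      whose norm is at most \<open>\<eta>\<close>.\<close>
    also have "Im (cin (q' x) (q x)) = Im (cin (q' x) (q x - 2 *s e))"
    proof -
      have "cin (q' x) e = - (\<i> / of_real d) * cin (A' x *v e) e"
        by (simp add: q'_def cin_def field_simps add_divide_distrib)
      hence "Im (cin (q' x) e) = 0" using Re_cin_su2[OF A(2), of x e] by (simp add: complex_eq_iff)
      thus ?thesis by (simp add: cin_diff_right cin_smult_right)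
    qed
    finally have "cmod (cin (s' x) (eig_sec d e (A x))) = (1 / norm (q x))\<^sup>2 * \<bar>Im (cin (q' x) (q x - 2 *s e))\<bar>"
      by (simp add: norm_mult norm_power norm_divide)
    also have "\<dots> \<le> 1 * (norm (q' x) * \<eta>)"
    proof (intro mult_mono)
      show "(1 / norm (q x))\<^sup>2 \<le> 1" using q1[OF x] n0 by (intro power_le_one) (auto simp: divide_le_eq)
      have "\<bar>Im (cin (q' x) (q x - 2 *s e))\<bar> \<le> norm (q' x) * norm (q x - 2 *s e)"
        using abs_Im_le_cmod cin_bound by (rule order_trans)
      also have "\<dots> \<le> norm (q' x) * \<eta>"
        unfolding q_def by (intro mult_left_mono eig_proj_near d near x) auto
      finally show "\<bar>Im (cin (q' x) (q x - 2 *s e))\<bar> \<le> norm (q' x) * \<eta>" .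
    qed auto
    finally show "cmod (cin (s' x) (eig_sec d e (A x))) \<le> \<eta> * su2_norm (A' x) / d" by (simp add: nq' mult.commute)
  qed
qed

text \<open>The residual is exactly zero for w0 and s0. Its perturbation costs
  \<open>\<epsilon>\<close> for w, 2 \<open>\<epsilon>\<close> for the coefficient and
  \<open>\<epsilon>\<close> for s.\<close>

lemma residual_perturbation:
  assumes "w0 = cin w0 s0 *s s0" "norm s0 \<le> 1" "norm s \<le> 1" "norm w \<le> 1" "norm w0 \<le> 1"
    "norm (s - s0) \<le> \<epsilon>" "norm (w - w0) \<le> \<epsilon>"
  shows "cmod (cin w s - cin w0 s0) \<le> 2 * \<epsilon>" "norm (w - cin w s *s s) \<le> 4 * \<epsilon>"
proof -
  have "cin w s - cin w0 s0 = cin (w - w0) s + cin w0 (s - s0)"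
    by (simp add: cin_diff_left cin_diff_right)
  also have "cmod \<dots> \<le> norm (w - w0) * norm s + norm w0 * norm (s - s0)"
    by (intro norm_triangle_le add_mono cin_bound)
  also have "\<dots> \<le> \<epsilon> * 1 + 1 * \<epsilon>"
    using assms order_trans[OF norm_ge_zero assms(7)] by (intro add_mono mult_mono) auto
  finally show 1: "cmod (cin w s - cin w0 s0) \<le> 2 * \<epsilon>" by simp
  have cw: "cmod (cin w s) \<le> 1"
    using assms by (intro order_trans[OF cin_bound] mult_le_one) auto
  have "w - cin w s *s s = (w - w0) + (w0 - cin w0 s0 *s s0) + ((cin w0 s0 - cin w s) *s s0 + cin w s *s (s0 - s))"
    by (simp add: vec_eq_iff algebra_simps)
  also have "\<dots> = (w - w0) + ((cin w0 s0 - cin w s) *s s0 + cin w s *s (s0 - s))"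
    using assms(1) by simp
  also have "norm \<dots> \<le> norm (w - w0) + (cmod (cin w0 s0 - cin w s) * norm s0 + cmod (cin w s) * norm (s0 - s))"
    by (intro norm_triangle_le add_mono) (simp_all only: norm_smult_vec2 order_refl)
  also have "\<dots> \<le> \<epsilon> + (2 * \<epsilon> * 1 + 1 * \<epsilon>)"
    using assms 1 cw norm_ge_zero[of "cin w s - cin w0 s0"]
    by (intro add_mono mult_mono) (auto simp: norm_minus_commute intro: order_trans[OF norm_ge_zero])
  finally show "norm (w - cin w s *s s) \<le> 4 * \<epsilon>" by simp
qed

lemma su2_norm_nonneg: "A \<in> su2 \<Longrightarrow> 0 \<le> su2_norm A"
  by (simp add: su2_norm_eq)

lemma su2_norm_triangle:
  assumes "A \<in> su2" "B \<in> su2"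
  shows "su2_norm A \<le> su2_norm (A - B) + su2_norm B"
proof -
  have "norm A \<le> norm (A - B) + norm B" by (metis diff_add_cancel norm_triangle_ineq)
  thus ?thesis
    by (simp add: su2_norm_eq assms subspace_diff[OF subspace_su2] add_divide_distrib[symmetric] divide_right_mono)
qed

lemma continuous_on_su2_norm:
  assumes "continuous_on S f" "\<And>x. f x \<in> su2"
  shows "continuous_on S (\<lambda>x. su2_norm (f x))"
  unfolding su2_norm_eq[OF assms(2)] by (intro continuous_intros assms(1)) auto

lemma eig_sec_Lipschitz:
  assumes "d > 0" "norm e = 1" "A \<in> su2" "B \<in> su2" "\<eta> \<le> 1 / 2"
    "norm (A *v e - (\<i> * of_real d) *s e) \<le> \<eta> * d" "norm (B *v e - (\<i> * of_real d) *s e) \<le> \<eta> * d"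
  shows "norm (eig_sec d e A - eig_sec d e B) \<le> 2 * su2_norm (A - B) / d"
proof -
  have "norm (eig_sec d e A - eig_sec d e B) \<le> 2 * norm (eig_proj d e A - eig_proj d e B)"
    unfolding eig_sec_def by (intro sgn_Lipschitz eig_proj_norm_ge_1[OF assms(1) _ assms(5,2)] assms)
  also have "eig_proj d e A - eig_proj d e B = (- \<i> / of_real d) *s ((A - B) *v e)"
    using assms(1) by (simp add: eig_proj_def vec_eq_iff mat2_vec_component field_simps)
  also have "norm \<dots> = su2_norm (A - B) / d"
    unfolding norm_smult_vec2 norm_su2_vec[OF subspace_diff[OF subspace_su2 assms(3,4)]]
    using assms(1,2) by (simp add: norm_divide)
  finally show ?thesis by simp
qed

context positive_degree_cocycle
begin

text \<open>Since \<open>sgn 0 = 0\<close>, this is a unit eigenvector except where e is orthogonal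
  to the eigenline, and there it is zero. Hence the recurring condition
  \<open>norm (sec e x) = 1\<close>.\<close>

definition sec :: "complex ^ 2 \<Rightarrow> real \<Rightarrow> complex ^ 2" where
  "sec e x = eig_sec d e (\<psi> x)"

lemma \<psi>_periodic_int: "\<psi> (x + of_int l) = \<psi> x"
  using periodic_of_int[of \<psi> 1 x l, OF \<psi>_periodic] by simp

lemma sec_eigenvector: "\<psi> x *v sec e x = (\<i> * of_real d) *s sec e x"
  unfolding sec_def by (rule eig_sec_eigenvector[OF \<psi>_su2 \<psi>_norm d_pos])

lemma sec_periodic_int: "sec e (x + of_int l) = sec e x"
  by (simp add: sec_def \<psi>_periodic_int)

text \<open>By \<open>\<psi>_\<Phi>\<close> the iterate carries the eigenspace over x + n
  \<open>\<alpha>\<close> into the one over x, which is a line.\<close>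

lemma \<Phi>_sec:
  assumes "norm (sec e x) = 1"
  shows "\<Phi> n x *v sec e (x + real n * \<alpha>) = cin (\<Phi> n x *v sec e (x + real n * \<alpha>)) (sec e x) *s sec e x"
proof (rule su2_eigenline[OF \<psi>_su2 _ sec_eigenvector _ assms])
  show "\<i> * complex_of_real d \<noteq> 0" using d_pos by simp
  have "\<psi> x *v (\<Phi> n x *v sec e (x + real n * \<alpha>)) = \<Phi> n x *v (\<psi> (x + real n * \<alpha>) *v sec e (x + real n * \<alpha>))"
    by (simp add: matrix_vector_mul_assoc \<psi>_\<Phi>)
  thus "\<psi> x *v (\<Phi> n x *v sec e (x + real n * \<alpha>)) = (\<i> * of_real d) *s (\<Phi> n x *v sec e (x + real n * \<alpha>))"
    by (simp add: sec_eigenvector smult_mat2_vec)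
qed

lemma integral_circle_HK:
  fixes f :: "real \<Rightarrow> 'b::euclidean_space"
  assumes "continuous_on UNIV f"
  shows "(LINT x|circle. f x) = integral {0..1} f"
proof -
  have "set_integrable lborel {0..1} f"
    by (rule borel_integrable_atLeastAtMost') (rule continuous_on_subset[OF assms], simp)
  from set_borel_integral_eq_integral(2)[OF this]
  show ?thesis
    by (simp add: integral_circle_Icc[OF borel_measurable_continuous_onI[OF assms]] set_lebesgue_integral_def)
qed

lemma D_a_norm_cont: "continuous_on S (\<lambda>x. su2_norm (D (a n) x))"
  by (intro continuous_on_su2_norm D_a_su2 continuous_on_subset[OF D_a_cont]) auto

text \<open>B is enlarged to at least 1 because it serves as a denominator later.\<close>

lemma integral_D_a_bound:
  obtains B where "B \<ge> 1" "\<And>n. n \<ge> 1 \<Longrightarrow> integral {0..1} (\<lambda>x. su2_norm (D (a n) x)) \<le> B"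
proof -
  obtain B where B: "\<And>n. n \<ge> 1 \<Longrightarrow> su2_L1_norm (D (a n)) \<le> B" using bounded by blast
  show thesis
  proof (rule that[of "max 1 B"])
    fix n :: nat assume "n \<ge> 1"
    thus "integral {0..1} (\<lambda>x. su2_norm (D (a n) x)) \<le> max 1 B"
      using B[of n] integral_circle_HK[OF D_a_norm_cont] by (simp add: su2_L1_norm_def)
  qed simp
qed

lemma near_eigenvector:
  assumes "norm e = 1" "\<psi> x0 *v e = (\<i> * of_real d) *s e" "A \<in> su2"
    "su2_norm (A - \<psi> x) \<le> \<eta> * d / 2" "su2_norm (\<psi> x - \<psi> x0) \<le> \<eta> * d / 2"
  shows "norm (A *v e - (\<i> * of_real d) *s e) \<le> \<eta> * d"
proof -
  have "A *v e - (\<i> * of_real d) *s e = (A - \<psi> x) *v e + (\<psi> x - \<psi> x0) *v e"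
    unfolding assms(2)[symmetric] by (simp add: matrix_vector_mult_diff_rdistrib)
  also have "norm \<dots> \<le> norm ((A - \<psi> x) *v e) + norm ((\<psi> x - \<psi> x0) *v e)"
    by (rule norm_triangle_ineq)
  also have "\<dots> = su2_norm (A - \<psi> x) + su2_norm (\<psi> x - \<psi> x0)"
    using assms(1,3) by (simp add: norm_su2_vec subspace_diff[OF subspace_su2] \<psi>_su2)
  finally show ?thesis using assms(4,5) by simp
qed

text \<open>The estimate is proved for the section \<open>S\<close> built from \<open>a k\<close>
  and carried over to \<open>sec e\<close> by letting k tend to infinity inside \<open>K\<close>,
  with n and m fixed. Hence \<open>K\<close> is infinite, and only the bound b on the variation over
  the interval, uniform in \<open>K\<close>, enters. \<open>oscillatory_integral_bound\<close> is
  used with c = d / 2, a0 = 2 d and e = 4 \<open>\<epsilon>\<close>. The term 4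
  \<open>\<eta>\<close> b / d^2 collects the connection forms at x and x + \<open>\<tau>\<close>,
  each integrating to at most \<open>\<eta>\<close> b / d, and is not divided by m.\<close>

lemma interval_estimate:
  assumes e: "norm e = 1" "\<psi> x0 *v e = (\<i> * of_real d) *s e" and \<eta>: "0 < \<eta>" "\<eta> \<le> 1 / 2"
    and osc: "\<And>x. x \<in> {x0..x1} \<Longrightarrow> su2_norm (\<psi> x - \<psi> x0) \<le> \<eta> * d / 2"
    and K: "infinite K" "\<And>k. k \<in> K \<Longrightarrow> integral {x0..x1} (\<lambda>x. su2_norm (D (a k) x)) \<le> b"
    and n: "n \<ge> 1" "\<And>x. su2_norm (a n x - \<psi> x) \<le> d / 4"
    and B: "integral {p..q} (\<lambda>x. su2_norm (D (a n) x)) \<le> B"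
    and pq: "p \<le> q" "q - p \<le> 1" "\<And>x. x \<in> {p..q} \<Longrightarrow> x \<in> {x0..x1} \<and> x + \<tau> \<in> {x0..x1}"
    and \<tau>: "\<tau> = real n * \<alpha> + of_int l"
    and V: "\<And>x. (V has_vector_derivative V' x) (at x)" "continuous_on UNIV V'" "V p = 0" "V q = 0"
      "\<And>x. x \<in> {p..q} \<Longrightarrow> 0 \<le> V x \<and> V x \<le> 1" "integral {p..q} (\<lambda>x. \<bar>V' x\<bar>) \<le> CV"
    and m: "m \<ge> 1"
  shows "cmod (integral {p..q} (\<lambda>x. of_real (V x) * cin (\<Phi> n x *v sec e (x + \<tau>)) (sec e x) ^ m))
    \<le> ((2 * CV / d + 4 * (B + 8 * b) / d\<^sup>2) / real m + 4 * \<eta> * b / d\<^sup>2) / real n" (is "cmod ?I \<le> ?Y")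
proof -
  note d0 = d_pos
  \<comment> \<open>Everything proportional to \<open>\<epsilon>\<close>: 16 from the residual
    multiplied by n, 32 b / (n d^2) from the residual times the derivatives of the section, and 2 m
    from replacing u^m by \<open>\<Gamma>\<close>^m.\<close>
  define C where "C = 4 * 4 + 4 * 8 * b / (real n * d\<^sup>2) + 2 * real m"
  have main: "cmod ?I \<le> ?Y + C * \<epsilon>" if \<epsilon>: "0 < \<epsilon>" "\<epsilon> \<le> 1 / 8" for \<epsilon>
  proof -
    \<comment> \<open>The first bound keeps e almost an eigenvector of \<open>a k\<close>, so that
      the section exists; the second makes the section \<open>\<epsilon>\<close>-close to
      \<open>sec e\<close>, as normalised eigenvectors are Lipschitz with constant 2 / d.\<close>
    define \<epsilon>' where "\<epsilon>' = min (\<eta> * d / 2) (\<epsilon> * d / 2)"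
    have \<epsilon>': "\<epsilon>' > 0" using \<eta> d0 \<epsilon> by (simp add: \<epsilon>'_def)
    obtain k0 where k0: "\<And>k x. k \<ge> k0 \<Longrightarrow> su2_norm (a k x - \<psi> x) < \<epsilon>'"
      using a_close[OF \<epsilon>'] unfolding eventually_sequentially by blast
    obtain k where k: "k \<in> K" "k \<ge> k0" using K(1) by (meson infinite_nat_iff_unbounded_le)
    have ak: "su2_norm (a k x - \<psi> x) \<le> \<eta> * d / 2" "su2_norm (a k x - \<psi> x) \<le> \<epsilon> * d / 2" for x
      using k0[OF k(2), of x] by (auto simp: \<epsilon>'_def)
    have z0: "su2_norm (\<psi> x - \<psi> x) \<le> \<eta> * d / 2" for x
      using \<eta> d0 by (simp add: su2_norm_def det_2)
    have neara: "norm (a k x *v e - (\<i> * of_real d) *s e) \<le> \<eta> * d" if "x \<in> {x0..x1}" for x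
      by (rule near_eigenvector[OF e a_su2 ak(1) osc[OF that]])
    have near\<psi>: "norm (\<psi> x *v e - (\<i> * of_real d) *s e) \<le> \<eta> * d" if "x \<in> {x0..x1}" for x
      by (rule near_eigenvector[OF e \<psi>_su2 z0 osc[OF that]])
    define S where "S x = eig_sec d e (a k x)" for x
    obtain s' where ds: "\<And>x. x \<in> {x0..x1} \<Longrightarrow> (S has_vector_derivative s' x) (at x)"
      and cs: "continuous_on {x0..x1} s'" and s'b: "\<And>x. x \<in> {x0..x1} \<Longrightarrow> norm (s' x) \<le> 2 * su2_norm (D (a k) x) / d"
      and s'c: "\<And>x. x \<in> {x0..x1} \<Longrightarrow> cmod (cin (s' x) (S x)) \<le> \<eta> * su2_norm (D (a k) x) / d"
      using eig_sec_derivative[OF d0 a_su2 D_a_su2 a_deriv D_a_cont e(1) \<eta>(2) neara]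
      unfolding S_def[abs_def] by blast
    have nS: "norm (S x) = 1" if "x \<in> {x0..x1}" for x
      using eig_proj_norm_ge_1[OF d0 neara[OF that] \<eta>(2) e(1)] by (auto simp: S_def eig_sec_def norm_sgn)
    have nsec: "norm (sec e x) = 1" if "x \<in> {x0..x1}" for x
      using eig_proj_norm_ge_1[OF d0 near\<psi>[OF that] \<eta>(2) e(1)] by (auto simp: sec_def eig_sec_def norm_sgn)
    have close: "norm (S x - sec e x) \<le> \<epsilon>" if "x \<in> {x0..x1}" for x
    proof -
      have "norm (S x - sec e x) \<le> 2 * su2_norm (a k x - \<psi> x) / d"
        unfolding S_def sec_def by (rule eig_sec_Lipschitz[OF d0 e(1) a_su2 \<psi>_su2 \<eta>(2) neara[OF that] near\<psi>[OF that]])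
      also have "\<dots> \<le> \<epsilon>" using ak(2)[of x] d0 by (simp add: field_simps)
      finally show ?thesis .
    qed
    define u where "u x = cin (\<Phi> n x *v S (x + \<tau>)) (S x)" for x
    define \<Gamma> where "\<Gamma> x = cin (\<Phi> n x *v sec e (x + \<tau>)) (sec e x)" for x
    have pert: "cmod (u x - \<Gamma> x) \<le> 2 * \<epsilon>" "norm (\<Phi> n x *v S (x + \<tau>) - u x *s S x) \<le> 4 * \<epsilon>"
      "cmod (u x) \<le> 1" "cmod (\<Gamma> x) \<le> 1"
      if x: "x \<in> {p..q}" for x
    proof -
      have J: "x \<in> {x0..x1}" "x + \<tau> \<in> {x0..x1}" using pq(3)[OF x] by auto
      note nf = nS[OF J(1)] nS[OF J(2)] nsec[OF J(1)] nsec[OF J(2)]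
      have st: "sec e (x + \<tau>) = sec e (x + real n * \<alpha>)"
        using sec_periodic_int[of e "x + real n * \<alpha>" l] by (simp add: \<tau> add.assoc)
      have "\<Phi> n x *v sec e (x + \<tau>) = cin (\<Phi> n x *v sec e (x + \<tau>)) (sec e x) *s sec e x"
        unfolding st by (rule \<Phi>_sec[OF nsec[OF J(1)]])
      moreover have "norm (\<Phi> n x *v S (x + \<tau>) - \<Phi> n x *v sec e (x + \<tau>)) \<le> \<epsilon>"
        using close[OF J(2)] norm_SU2_vec[OF \<Phi>_SU2, of n x "S (x + \<tau>) - sec e (x + \<tau>)"]
        by (simp add: matrix_vector_mult_diff_distrib)
      ultimately show "cmod (u x - \<Gamma> x) \<le> 2 * \<epsilon>" "norm (\<Phi> n x *v S (x + \<tau>) - u x *s S x) \<le> 4 * \<epsilon>"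
        unfolding u_def \<Gamma>_def using close[OF J(1)]
        by (intro residual_perturbation; simp add: norm_SU2_vec[OF \<Phi>_SU2] nf)+
      show "cmod (u x) \<le> 1" "cmod (\<Gamma> x) \<le> 1"
        unfolding u_def \<Gamma>_def using cin_bound[of "\<Phi> n x *v S (x + \<tau>)" "S x"] cin_bound[of "\<Phi> n x *v sec e (x + \<tau>)" "sec e x"]
        by (simp_all add: norm_SU2_vec[OF \<Phi>_SU2] nf)
    qed
    \<comment> \<open>The exact value d loses d / 4 by replacing \<open>\<psi>\<close> with
      \<open>a n\<close> and twice d / 8 by replacing \<open>sec e\<close> with \<open>S\<close>;
      this is where \<open>\<epsilon>\<close> <= 1/8 is used.\<close>
    have lam: "d / 2 \<le> Im (cin (a n x *v S x) (S x))" if x: "x \<in> {p..q}" for x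
    proof -
      have J: "x \<in> {x0..x1}" using pq(3)[OF x] by auto
      define R where "R = (a n x - \<psi> x) *v S x + (\<psi> x *v (S x - sec e x) - (\<i> * of_real d) *s (S x - sec e x))"
      have "a n x *v S x = (\<i> * of_real d) *s S x + R"
        unfolding R_def by (simp add: matrix_vector_mult_diff_rdistrib matrix_vector_mult_diff_distrib sec_eigenvector vec_eq_iff algebra_simps)
      hence "cin (a n x *v S x) (S x) = \<i> * of_real d + cin R (S x)"
        using nS[OF J] by (simp add: cin_add_left cin_smult_left cin_self)
      moreover have "cmod (cin R (S x)) \<le> d / 2"
      proof -
        have "cmod (cin R (S x)) \<le> norm R" using cin_bound[of R "S x"] nS[OF J] by simp
        also have "\<dots> \<le> norm ((a n x - \<psi> x) *v S x) + (norm (\<psi> x *v (S x - sec e x)) + norm ((\<i> * of_real d) *s (S x - sec e x)))"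
          unfolding R_def by (intro norm_triangle_le add_mono order_refl norm_triangle_ineq4)
        also have "\<dots> = su2_norm (a n x - \<psi> x) + 2 * (d * norm (S x - sec e x))"
        proof -
          have "norm ((\<i> * of_real d) *s w) = d * norm w" for w :: "complex ^ 2"
            unfolding norm_smult_vec2 using d0 by (simp add: norm_mult)
          thus ?thesis
            by (simp only: norm_su2_vec[OF subspace_diff[OF subspace_su2 a_su2 \<psi>_su2]] norm_su2_vec[OF \<psi>_su2] \<psi>_norm nS[OF J])
        qed
        also have "\<dots> \<le> d / 4 + 2 * (d * (1 / 8))"
          using n(2)[of x] close[OF J] \<epsilon> d0 by (intro add_mono mult_left_mono) auto
        finally show ?thesis by simp
      qed
      ultimately show ?thesis using abs_Im_le_cmod[of "cin R (S x)"] by simp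
    qed
    define \<delta>n where "\<delta>n x = su2_norm (D (a n) x)" for x
    define \<delta>k where "\<delta>k x = su2_norm (D (a k) x)" for x
    have \<delta>0: "0 \<le> \<delta>n x" "0 \<le> \<delta>k x" for x by (simp_all add: \<delta>n_def \<delta>k_def su2_norm_nonneg D_a_su2)
    have cont\<delta>: "continuous_on T \<delta>n" "continuous_on T \<delta>k" for T
      unfolding \<delta>n_def[abs_def] \<delta>k_def[abs_def] by (rule D_a_norm_cont)+
    have sub: "{p..q} \<subseteq> {x0..x1}" "{p + \<tau>..q + \<tau>} \<subseteq> {x0..x1}"
    proof -
      show "{p..q} \<subseteq> {x0..x1}" using pq(3) by blast
      show "{p + \<tau>..q + \<tau>} \<subseteq> {x0..x1}"
      proof
        fix y assume "y \<in> {p + \<tau>..q + \<tau>}"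
        hence "y - \<tau> \<in> {p..q}" by auto
        from pq(3)[OF this] show "y \<in> {x0..x1}" by simp
      qed
    qed
    have cshift: "continuous_on {p..q} (\<lambda>x. s' (x + \<tau>))"
      by (rule continuous_on_compose2[OF cs]) (intro continuous_intros, use pq(3) in blast)
    have an2d: "su2_norm (a n x) \<le> 2 * d" for x
      using su2_norm_triangle[OF a_su2 \<psi>_su2, of n x x] n(2)[of x] d0 by (simp add: \<psi>_norm)
    let ?K = "\<lambda>x. (\<bar>V' x\<bar> / (d / 2) + (\<delta>n x + 2 * (2 * d) * norm (s' x)) / (d / 2)\<^sup>2) / (real n * real m)
        + (real n * (2 * d) * (4 * \<epsilon>) + cmod (cin (s' x) (S x)) + cmod (cin (s' (x + \<tau>)) (S (x + \<tau>))) + (4 * \<epsilon>) * (norm (s' x) + norm (s' (x + \<tau>)))) / (real n * (d / 2))"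
    have obd: "cmod (integral {p..q} (\<lambda>x. of_real (V x) * u x ^ m)) \<le> integral {p..q} ?K"
      unfolding u_def \<delta>n_def
    proof (rule oscillatory_integral_bound[where t="\<lambda>x. S (x + \<tau>)" and t'="\<lambda>x. s' (x + \<tau>)"])
      show "\<And>x. x \<in> {p..q} \<Longrightarrow> ((\<lambda>x. S (x + \<tau>)) has_vector_derivative s' (x + \<tau>)) (at x)"
        using pq(3) by (intro has_vector_derivative_shift ds) auto
      show "continuous_on {p..q} s'" using cs sub(1) by (rule continuous_on_subset)
      show "\<And>x. x \<in> {p..q} \<Longrightarrow> norm (\<Phi> n x *v S (x + \<tau>) - cin (\<Phi> n x *v S (x + \<tau>)) (S x) *s S x) \<le> 4 * \<epsilon>"
        using pert(2) by (simp add: u_def)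
    qed (use pq n m d0 \<epsilon> lam an2d cshift V ds nS in \<open>auto intro: \<Phi>_SU2 D_\<Phi> a_su2 D_a_su2 a_deriv D_a_cont\<close>)
    \<comment> \<open>Coefficients of a majorant in terms of the variations, after inserting 2
      \<open>\<delta>k\<close> / d for the derivative of the section and \<open>\<eta>\<close>
      \<open>\<delta>k\<close> / d for its connection form. The shifted point has no part with 1/m,
      since L involves the section only at x.\<close>
    define c1 where "c1 = 2 / d / (real n * real m)"
    define c2 where "c2 = 4 / d\<^sup>2 / (real n * real m)"
    define c3 where "c3 = 32 / d\<^sup>2 / (real n * real m) + 2 * \<eta> / (real n * d\<^sup>2) + 16 * \<epsilon> / (real n * d\<^sup>2)"
    define c4 where "c4 = 2 * \<eta> / (real n * d\<^sup>2) + 16 * \<epsilon> / (real n * d\<^sup>2)"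
    define c5 where "c5 = 16 * \<epsilon>"
    let ?K2 = "\<lambda>x. c1 * \<bar>V' x\<bar> + (c2 * \<delta>n x + (c3 * \<delta>k x + (c4 * \<delta>k (x + \<tau>) + c5)))"
    note obd
    also have "integral {p..q} ?K \<le> integral {p..q} ?K2"
    proof (rule integral_le)
      have cS: "continuous_on {x0..x1} S"
        by (rule continuous_at_imp_continuous_on) (use ds has_vector_derivative_continuous in blast)
      have cSs: "continuous_on {p..q} (\<lambda>x. S (x + \<tau>))"
        by (rule continuous_on_compose2[OF cS]) (intro continuous_intros, use pq(3) in blast)
      show "?K integrable_on {p..q}"
        using n m d0
        by (intro integrable_continuous_real continuous_intros continuous_on_cin cshift cSs
          continuous_on_subset[OF cs sub(1)] continuous_on_subset[OF cS sub(1)] cont\<delta> continuous_on_subset[OF V(2)]) auto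
      show "?K2 integrable_on {p..q}"
        by (intro integrable_continuous_real continuous_intros cont\<delta> continuous_on_subset[OF V(2)]
          continuous_on_compose2[OF cont\<delta>(2)[of UNIV]]) auto
      fix x assume x: "x \<in> {p..q}"
      have J: "x \<in> {x0..x1}" "x + \<tau> \<in> {x0..x1}" using pq(3)[OF x] by auto
      have b: "norm (s' x) \<le> 2 * \<delta>k x / d" "norm (s' (x + \<tau>)) \<le> 2 * \<delta>k (x + \<tau>) / d"
        "cmod (cin (s' x) (S x)) \<le> \<eta> * \<delta>k x / d" "cmod (cin (s' (x + \<tau>)) (S (x + \<tau>))) \<le> \<eta> * \<delta>k (x + \<tau>) / d"
        unfolding \<delta>k_def by (intro s'b s'c J)+
      have "?K x \<le> (\<bar>V' x\<bar> / (d / 2) + (\<delta>n x + 2 * (2 * d) * (2 * \<delta>k x / d)) / (d / 2)\<^sup>2) / (real n * real m)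
        + (real n * (2 * d) * (4 * \<epsilon>) + \<eta> * \<delta>k x / d + \<eta> * \<delta>k (x + \<tau>) / d + (4 * \<epsilon>) * (2 * \<delta>k x / d + 2 * \<delta>k (x + \<tau>) / d)) / (real n * (d / 2))"
        using d0 \<epsilon> by (intro add_mono divide_right_mono mult_left_mono b order_refl) auto
      also have "\<dots> = ?K2 x"
        unfolding c1_def c2_def c3_def c4_def c5_def using n m d0 by (simp add: field_simps power2_eq_square)
      finally show "?K x \<le> ?K2 x" .
    qed
    also have "\<dots> = c1 * integral {p..q} (\<lambda>x. \<bar>V' x\<bar>) + (c2 * integral {p..q} \<delta>n + (c3 * integral {p..q} \<delta>k
        + (c4 * integral {p..q} (\<lambda>x. \<delta>k (x + \<tau>)) + (q - p) * c5)))"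
    proof (rule integral_unique)
      have i: "continuous_on {p..q} f \<Longrightarrow> (f has_integral integral {p..q} f) {p..q}" for f :: "real \<Rightarrow> real"
        by (intro integrable_integral integrable_continuous_real)
      have c5: "((\<lambda>x. c5) has_integral (q - p) * c5) {p..q}"
        using has_integral_const_real[of c5 p q] pq(1) by simp
      show "(?K2 has_integral c1 * integral {p..q} (\<lambda>x. \<bar>V' x\<bar>) + (c2 * integral {p..q} \<delta>n + (c3 * integral {p..q} \<delta>k
        + (c4 * integral {p..q} (\<lambda>x. \<delta>k (x + \<tau>)) + (q - p) * c5)))) {p..q}"
        by (intro has_integral_add has_integral_mult_right i c5 continuous_intros cont\<delta> continuous_on_subset[OF V(2)]
          continuous_on_compose2[OF cont\<delta>(2)[of UNIV]]) auto
    qed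
    also have "\<dots> \<le> c1 * CV + (c2 * B + (c3 * b + (c4 * b + 1 * c5)))"
    proof -
      have I: "integral T \<delta>k \<le> b" if "T = {p'..q'}" "T \<subseteq> {x0..x1}" for T p' q'
      proof -
        have "integral T \<delta>k \<le> integral {x0..x1} \<delta>k"
          using that \<delta>0 by (intro integral_subset_le integrable_continuous_real cont\<delta>) (auto intro: integrable_continuous_real cont\<delta>)
        thus ?thesis using K(2)[OF k(1)] by (simp add: \<delta>k_def[abs_def])
      qed
      have "integral {p..q} (\<lambda>x. \<delta>k (x + \<tau>)) = integral {p + \<tau>..q + \<tau>} \<delta>k"
        using integral_shift[OF cont\<delta>(2), of p q \<tau>] by (simp add: o_def)
      hence "integral {p..q} (\<lambda>x. \<delta>k (x + \<tau>)) \<le> b" using I[OF refl sub(2)] by simp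
      moreover have "integral {p..q} \<delta>n \<le> B" using B by (simp add: \<delta>n_def[abs_def])
      moreover have "integral {p..q} \<delta>k \<le> b" using I[OF refl sub(1)] .
      ultimately show ?thesis
        unfolding c1_def c2_def c3_def c4_def c5_def
        using V(6) pq \<epsilon> \<eta> d0 by (intro add_mono mult_left_mono mult_right_mono) auto
    qed
    also have "\<dots> = ?Y + (16 + 32 * b / (real n * d\<^sup>2)) * \<epsilon>"
      unfolding c1_def c2_def c3_def c4_def c5_def using n m d0 by (simp add: field_simps)
    finally have ub: "cmod (integral {p..q} (\<lambda>x. of_real (V x) * u x ^ m)) \<le> ?Y + (16 + 32 * b / (real n * d\<^sup>2)) * \<epsilon>" .
    have csec: "continuous_on {x0..x1} (sec e)"
    proof -
      have "continuous_on {x0..x1} (\<lambda>x. eig_proj d e (\<psi> x))"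
        unfolding eig_proj_def by (intro continuous_intros bounded_linear.continuous_on[OF bounded_linear_smult_vec2] continuous_on_mat2_vec \<psi>_cont)
      thus ?thesis unfolding sec_def[abs_def] eig_sec_def
        using eig_proj_norm_ge_1[OF d0 near\<psi> \<eta>(2) e(1)] by (intro continuous_on_sgn) force+
    qed
    have cS: "continuous_on {x0..x1} S"
      by (rule continuous_at_imp_continuous_on) (use ds has_vector_derivative_continuous in blast)
    have cV: "continuous_on {p..q} V" by (rule has_vector_derivative_imp_continuous_on[OF V(1)])
    have c\<Phi>: "continuous_on {p..q} (\<Phi> n)"
      by (rule continuous_on_subset[OF C2_continuous(1)[OF \<Phi>_C2]]) auto
    have shift: "continuous_on {p..q} (\<lambda>x. f (x + \<tau>))" if "continuous_on {x0..x1} f" for f :: "real \<Rightarrow> complex ^ 2"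
      by (rule continuous_on_compose2[OF that]) (intro continuous_intros, use pq(3) in blast)
    have cu: "continuous_on {p..q} u" "continuous_on {p..q} \<Gamma>"
      unfolding u_def[abs_def] \<Gamma>_def[abs_def]
      by (intro continuous_on_cin continuous_on_mat2_vec c\<Phi> shift cS csec continuous_on_subset[OF cS sub(1)] continuous_on_subset[OF csec sub(1)])+
    have i: "(\<lambda>x. of_real (V x) * u x ^ m) integrable_on {p..q}" "(\<lambda>x. of_real (V x) * \<Gamma> x ^ m) integrable_on {p..q}"
      by (intro integrable_continuous_real continuous_intros cV cu)+
    have "cmod (integral {p..q} (\<lambda>x. of_real (V x) * \<Gamma> x ^ m) - integral {p..q} (\<lambda>x. of_real (V x) * u x ^ m))
      = cmod (integral {p..q} (\<lambda>x. of_real (V x) * \<Gamma> x ^ m - of_real (V x) * u x ^ m))"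
      using i by (simp add: Henstock_Kurzweil_Integration.integral_diff)
    also have "\<dots> \<le> integral {p..q} (\<lambda>x. 2 * real m * \<epsilon>)"
    proof (rule integral_norm_bound_integral)
      fix x assume x: "x \<in> {p..q}"
      have "cmod (of_real (V x) * \<Gamma> x ^ m - of_real (V x) * u x ^ m) = V x * cmod (\<Gamma> x ^ m - u x ^ m)"
        using V(5)[OF x] by (simp add: right_diff_distrib[symmetric] norm_mult)
      also have "\<dots> \<le> 1 * (real m * cmod (\<Gamma> x - u x))"
        using V(5)[OF x] pert(3,4)[OF x] by (intro mult_mono norm_power_diff) auto
      also have "\<dots> \<le> 2 * real m * \<epsilon>"
        using mult_left_mono[OF pert(1)[OF x], of "real m"] by (simp add: norm_minus_commute)
      finally show "cmod (of_real (V x) * \<Gamma> x ^ m - of_real (V x) * u x ^ m) \<le> 2 * real m * \<epsilon>" .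
    qed (use i in \<open>auto intro: integrable_diff\<close>)
    also have "\<dots> = (q - p) * (2 * real m * \<epsilon>)" using pq(1) by simp
    also have "\<dots> \<le> 1 * (2 * real m * \<epsilon>)" using pq(2) \<epsilon> by (intro mult_right_mono) auto
    finally have "cmod (integral {p..q} (\<lambda>x. of_real (V x) * \<Gamma> x ^ m) - integral {p..q} (\<lambda>x. of_real (V x) * u x ^ m)) \<le> 2 * real m * \<epsilon>" by simp
    hence "cmod (integral {p..q} (\<lambda>x. of_real (V x) * \<Gamma> x ^ m)) \<le> cmod (integral {p..q} (\<lambda>x. of_real (V x) * u x ^ m)) + 2 * real m * \<epsilon>"
      using norm_triangle_ineq2[of "integral {p..q} (\<lambda>x. of_real (V x) * \<Gamma> x ^ m)"] by (smt (verit))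
    also have "\<dots> \<le> ?Y + C * \<epsilon>" using ub by (simp add: C_def algebra_simps)
    finally show ?thesis by (simp add: \<Gamma>_def)
  qed
  show ?thesis
  proof (rule tendsto_lowerbound)
    show "((\<lambda>\<epsilon>. ?Y + C * \<epsilon>) \<longlongrightarrow> ?Y) (at_right 0)"
      by (auto intro!: tendsto_eq_intros)
    show "\<forall>\<^sub>F \<epsilon> in at_right 0. cmod ?I \<le> ?Y + C * \<epsilon>"
      unfolding eventually_at_right_field by (intro exI[of _ "1/8"]) (use main in auto)
  qed simp
qed

end

text \<open>Each of the finitely many n \<open>\<alpha>\<close> has a positive distance to the
  integers.\<close>

lemma irrational_no_return:
  assumes "\<alpha> \<notin> \<rat>"
  shows "\<exists>\<delta>>0. \<forall>n\<in>{1..<N}. \<forall>l::int. \<delta> \<le> \<bar>real n * \<alpha> + of_int l\<bar>"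
proof (induction N)
  case (Suc N)
  then obtain \<delta> where \<delta>: "\<delta> > 0" "\<forall>n\<in>{1..<N}. \<forall>l::int. \<delta> \<le> \<bar>real n * \<alpha> + of_int l\<bar>" by blast
  show ?case
  proof (cases "N = 0")
    case True thus ?thesis using \<delta> by auto
  next
    case False
    define z where "z = real N * \<alpha>"
    have "z \<notin> \<int>"
    proof
      assume "z \<in> \<int>"
      then obtain l where "z = of_int l" by (elim Ints_cases)
      hence "\<alpha> = of_int l / of_nat N" using False by (simp add: z_def field_simps)
      thus False using assms by (metis Rats_divide Rats_of_int Rats_of_nat)
    qed
    hence f: "0 < frac z" by (simp add: frac_gt_0_iff)
    define \<delta>' where "\<delta>' = min (frac z) (1 - frac z)"
    have \<delta>': "\<delta>' > 0" using f frac_lt_1[of z] by (simp add: \<delta>'_def)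
    have "\<delta>' \<le> \<bar>z + of_int l\<bar>" for l :: int
    proof -
      have e: "z + of_int l = frac z + of_int (\<lfloor>z\<rfloor> + l)" by (simp add: frac_def)
      show ?thesis
      proof (cases "\<lfloor>z\<rfloor> + l \<ge> 0")
        case True
        hence "(0::real) \<le> of_int (\<lfloor>z\<rfloor> + l)" by (simp only: of_int_0_le_iff)
        thus ?thesis unfolding e \<delta>'_def using f by linarith
      next
        case False
        hence "of_int (\<lfloor>z\<rfloor> + l) \<le> (- 1 :: real)" by linarith
        thus ?thesis unfolding e \<delta>'_def using frac_lt_1[of z] by linarith
      qed
    qed
    thus ?thesis using \<delta> \<delta>' by (intro exI[of _ "min \<delta> \<delta>'"]) (auto simp: less_Suc_eq z_def min_le_iff_disj)
  qed
qed (auto intro: exI[of _ 1])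

lemma integral_uniform_partition:
  fixes f :: "real \<Rightarrow> real"
  assumes "continuous_on UNIV f" "r > 0"
  shows "integral {0..real j / real r} f = (\<Sum>i<j. integral {real i / real r..real (Suc i) / real r} f)"
proof (induction j)
  case (Suc j)
  have "integral {0..real j / real r} f + integral {real j / real r..real (Suc j) / real r} f = integral {0..real (Suc j) / real r} f"
    by (rule Henstock_Kurzweil_Integration.integral_combine)
       (auto intro!: divide_right_mono integrable_continuous_real continuous_on_subset[OF assms(1)])
  thus ?case using Suc by simp
qed simp

section \<open>Choice of the interval and decay of the localized correlations\<close>

context positive_degree_cocycle
begin

text \<open>The order of choices: \<open>\<eta>\<close> depends on \<open>\<epsilon>\<close> and the
  global variation B, the interval length 1 / r on \<open>\<eta>\<close>, and the threshold for m on
  r. As the integral of v^2 is of order 1 / r, the error 4 \<open>\<eta>\<close> b / d^2, which m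
  cannot reduce, has to be of this order too. So the interval must carry no more than the average
  variation b = B / r, which permits \<open>\<eta>\<close> to be fixed before r.\<close>

lemma localized_correlation_decay:
  assumes \<epsilon>: "\<epsilon> > 0"
  obtains N :: nat and v :: "real \<Rightarrow> real" and e :: "complex ^ 2" where
    "v \<in> borel_measurable borel" "\<And>x. 0 \<le> v x" "\<And>x. v x \<le> 1" "norm e = 1"
    "0 < (LINT x|circle. (v x)\<^sup>2)" "\<And>x. v x \<noteq> 0 \<Longrightarrow> norm (sec e x) = 1"
    "\<And>m n. m \<ge> N \<Longrightarrow> n \<ge> 1 \<Longrightarrow>
      cmod (LINT x|circle. of_real (v x * v (frac (x + real n * \<alpha>))) * cin (\<Phi> n x *v sec e (x + real n * \<alpha>)) (sec e x) ^ m)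
        \<le> \<epsilon> * (LINT x|circle. (v x)\<^sup>2) / real n"
proof -
  note d0 = d_pos
  obtain B where B: "B \<ge> 1" "\<And>n. n \<ge> 1 \<Longrightarrow> integral {0..1} (\<lambda>x. su2_norm (D (a n) x)) \<le> B"
    using integral_D_a_bound by blast
  \<comment> \<open>With b = B / r the factor 1 / (32 B) makes 4 \<open>\<eta>\<close> b / d^2 at
    most \<open>\<epsilon>\<close> / (8 r).\<close>
  define \<eta> where "\<eta> = min (1 / 2) (\<epsilon> * d\<^sup>2 / (32 * B))"
  have \<eta>: "0 < \<eta>" "\<eta> \<le> 1 / 2" "\<eta> \<le> \<epsilon> * d\<^sup>2 / (32 * B)" using \<epsilon> d0 B(1) by (auto simp: \<eta>_def)
  have "\<eta> * d / 2 > 0" using \<eta> d0 by simp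
  moreover have "uniformly_continuous_on {0..1} \<psi>"
    by (intro compact_uniformly_continuous \<psi>_cont) simp
  ultimately obtain \<delta>1 where \<delta>1: "\<delta>1 > 0" "\<And>x y. x \<in> {0..1} \<Longrightarrow> y \<in> {0..1} \<Longrightarrow> dist y x < \<delta>1 \<Longrightarrow> dist (\<psi> y) (\<psi> x) < \<eta> * d / 2"
    unfolding uniformly_continuous_on_def by metis
  have "d / 4 > 0" using d0 by simp
  from a_close[OF this] obtain N0 where N0: "\<And>n x. n \<ge> N0 \<Longrightarrow> su2_norm (a n x - \<psi> x) < d / 4"
    unfolding eventually_sequentially by blast
  \<comment> \<open>For n < \<open>N0\<close> there is no control of \<open>a n\<close>. An interval
    shorter than \<open>\<delta>2\<close> is then disjoint from its translate by n
    \<open>\<alpha>\<close>, and the correlation is zero.\<close>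
  obtain \<delta>2 where \<delta>2: "\<delta>2 > 0" "\<And>n l. n \<in> {1..<N0} \<Longrightarrow> \<delta>2 \<le> \<bar>real n * \<alpha> + of_int l\<bar>"
    using irrational_no_return[OF irrational, of N0] by metis
  obtain r0 :: nat where r0: "1 / real (Suc r0) < min \<delta>1 \<delta>2"
    using reals_Archimedean[of "min \<delta>1 \<delta>2"] \<delta>1(1) \<delta>2(1) by (auto simp: inverse_eq_divide)
  define r where "r = Suc r0"
  have r: "r > 0" "1 / real r < \<delta>1" "1 / real r < \<delta>2" using r0 by (auto simp: r_def)
  define b where "b = B / real r"
  have b: "0 < b" "b \<le> B" using B(1) r(1) by (auto simp: b_def divide_le_eq)
  define J where "J i = {real i / real r..real (Suc i) / real r}" for i
  \<comment> \<open>Among r intervals sharing the total variation B, one has at most the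
    average.\<close>
  have "\<exists>i<r. integral (J i) (\<lambda>x. su2_norm (D (a k) x)) \<le> b" if "k \<ge> 1" for k
  proof (rule ccontr)
    assume "\<not> ?thesis"
    hence "(\<Sum>i<r. b) < (\<Sum>i<r. integral (J i) (\<lambda>x. su2_norm (D (a k) x)))"
      using r(1) by (intro sum_strict_mono) (auto simp: not_le)
    also have "\<dots> = integral {0..1} (\<lambda>x. su2_norm (D (a k) x))"
      using integral_uniform_partition[OF D_a_norm_cont[of _ k] r(1), of r] r(1) by (simp add: J_def)
    also have "\<dots> \<le> B" using B(2)[OF that] .
    finally show False using r(1) by (simp add: b_def)
  qed
  then obtain idx where idx: "\<And>k. k \<ge> 1 \<Longrightarrow> idx k < r \<and> integral (J (idx k)) (\<lambda>x. su2_norm (D (a k) x)) \<le> b"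
    by metis
  have "infinite {1::nat..}" by (rule infinite_Ici)
  moreover have "finite (idx ` {1..})"
    by (rule finite_subset[of _ "{..<r}"]) (use idx in auto)
  \<comment> \<open>The good interval depends on k; by the pigeonhole principle one of them serves
    infinitely many k.\<close>
  ultimately obtain k1 where k1: "k1 \<in> {1..}" "infinite {k \<in> {1..}. idx k = idx k1}"
    using pigeonhole_infinite by blast
  define i where "i = idx k1"
  define K where "K = {k \<in> {1..}. idx k = i}"
  have ir: "i < r" using idx[of k1] k1(1) by (simp add: i_def)
  have K: "infinite K" "\<And>k. k \<in> K \<Longrightarrow> integral (J i) (\<lambda>x. su2_norm (D (a k) x)) \<le> b"
  proof -
    show "infinite K" using k1(2) by (simp add: K_def i_def)
    fix k assume "k \<in> K"
    thus "integral (J i) (\<lambda>x. su2_norm (D (a k) x)) \<le> b" using idx[of k] by (auto simp: K_def)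
  qed
  define x0 where "x0 = real i / real r"
  define x1 where "x1 = real (Suc i) / real r"
  have x01: "0 \<le> x0" "x1 \<le> 1" "x1 - x0 = 1 / real r" "x0 < x1"
    using ir r(1) by (auto simp: x0_def x1_def divide_le_eq field_simps)
  have JX: "J i = {x0..x1}" by (simp add: J_def x0_def x1_def)
  obtain e where e: "norm e = 1" "\<psi> x0 *v e = (\<i> * of_real d) *s e"
    using su2_eigenvector_exists[OF \<psi>_su2 \<psi>_norm d0] by blast
  have osc: "su2_norm (\<psi> x - \<psi> x0) \<le> \<eta> * d / 2" if "x \<in> {x0..x1}" for x
  proof -
    have "dist x x0 < \<delta>1" using that x01 r(2) by (auto simp: dist_real_def)
    hence "dist (\<psi> x) (\<psi> x0) < \<eta> * d / 2" using that x01 by (intro \<delta>1(2)) auto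
    moreover have "su2_norm (\<psi> x - \<psi> x0) \<le> norm (\<psi> x - \<psi> x0)"
      by (simp add: su2_norm_eq subspace_diff[OF subspace_su2] \<psi>_su2 divide_le_eq mult_le_cancel_left1)
    ultimately show ?thesis by (simp add: dist_norm)
  qed
  \<comment> \<open>In the coordinate z = r y - i this is 4 z (1 - z): zero at both ends, at most 1
    in between, slope at most 4 r, and the square integrates to 8 / (15 r). The untruncated
    polynomial stays differentiable on the whole line.\<close>
  define v0 where "v0 y = 4 * (real r * y - real i) * (real i + 1 - real r * y)" for y
  define v0' where "v0' y = 4 * real r * (2 * real i + 1 - 2 * real r * y)" for y
  define v where "v y = (if y \<in> {x0..x1} then v0 y else 0)" for y
  have dv0: "(v0 has_real_derivative v0' y) (at y)" for y
    unfolding v0_def[abs_def] v0'_def by (auto intro!: derivative_eq_intros simp: algebra_simps)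
  have Y: "0 \<le> real r * y - real i" "real r * y - real i \<le> 1" if "y \<in> {x0..x1}" for y
    using that r(1) by (auto simp: x0_def x1_def field_simps)
  have v0b: "0 \<le> v0 y" "v0 y \<le> 1" "\<bar>v0' y\<bar> \<le> 4 * real r" if y: "y \<in> {x0..x1}" for y
  proof -
    define z where "z = real r * y - real i"
    have z: "0 \<le> z" "z \<le> 1" using Y[OF y] by (auto simp: z_def)
    have v: "v0 y = 4 * (z * (1 - z))" "v0' y = 4 * real r * (1 - 2 * z)"
      by (simp_all add: v0_def v0'_def z_def algebra_simps)
    show "0 \<le> v0 y" unfolding v using z by simp
    have "0 \<le> (1 - 2 * z)\<^sup>2" by simp
    thus "v0 y \<le> 1" unfolding v by (simp add: power2_eq_square algebra_simps)
    have "\<bar>1 - 2 * z\<bar> \<le> 1" using z by linarith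
    thus "\<bar>v0' y\<bar> \<le> 4 * real r" unfolding v by (simp add: abs_mult mult_left_le)
  qed
  have v0end: "v0 x0 = 0" "v0 x1 = 0" using r(1) by (simp_all add: v0_def x0_def x1_def)
  have v0c: "continuous_on S v0" for S unfolding v0_def[abs_def] by (intro continuous_intros)
  have vm [measurable]: "v \<in> borel_measurable borel"
    unfolding v_def[abs_def] v0_def by measurable
  have v1: "0 \<le> v x" "v x \<le> 1" for x using v0b by (auto simp: v_def)
  have vsq: "(LINT x|circle. (v x)\<^sup>2) = 8 / (15 * real r)"
  proof -
    define F where "F y = 16 / real r * ((real r * y - real i) ^ 3 / 3 - (real r * y - real i) ^ 4 / 2 + (real r * y - real i) ^ 5 / 5)" for y
    have "(LINT x|circle. (v x)\<^sup>2) = (\<integral>x. indicator {0..1} x *\<^sub>R (v x)\<^sup>2 \<partial>lborel)"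
      by (rule integral_circle_Icc) measurable
    also have "\<dots> = (\<integral>x. indicator {x0..x1} x *\<^sub>R (v0 x)\<^sup>2 \<partial>lborel)"
      by (rule Bochner_Integration.integral_cong) (use x01 in \<open>auto simp: v_def indicator_def\<close>)
    also have "\<dots> = F x1 - F x0"
    proof (rule integral_FTC_Icc)
      fix y
      have "(F has_real_derivative (v0 y)\<^sup>2) (at y)"
      proof -
        have "((\<lambda>y. real r * y - real i) has_real_derivative real r) (at y)"
          by (auto intro!: derivative_eq_intros)
        hence "(F has_real_derivative 16 / real r * ((3 * (real r * y - real i)\<^sup>2 * real r) / 3 - (4 * (real r * y - real i) ^ 3 * real r) / 2
           + (5 * (real r * y - real i) ^ 4 * real r) / 5)) (at y)"
          using r(1) unfolding F_def[abs_def] by (auto intro!: derivative_eq_intros)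
        moreover have "16 / real r * ((3 * z\<^sup>2 * real r) / 3 - (4 * z ^ 3 * real r) / 2 + (5 * z ^ 4 * real r) / 5) = (4 * z * (1 - z))\<^sup>2" for z
          using r(1) by (simp add: field_simps power2_eq_square power3_eq_cube power4_eq_xxxx)
        moreover have "v0 y = 4 * (real r * y - real i) * (1 - (real r * y - real i))" by (simp add: v0_def algebra_simps)
        ultimately show ?thesis by (simp only:)
      qed
      thus "(F has_vector_derivative (v0 y)\<^sup>2) (at y within {x0..x1})"
        by (simp add: has_real_derivative_iff_has_vector_derivative has_vector_derivative_at_within)
    qed (use x01 v0c in \<open>auto intro!: continuous_intros\<close>)
    also have "\<dots> = 8 / (15 * real r)"
    proof -
      have "real r * x1 - real i = 1" "real r * x0 - real i = 0" using r(1) by (simp_all add: x0_def x1_def)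
      thus ?thesis unfolding F_def by (simp add: field_simps)
    qed
    finally show ?thesis .
  qed
  have z0: "su2_norm (\<psi> x - \<psi> x) \<le> \<eta> * d / 2" for x
    using \<eta> d0 by (simp add: su2_norm_def det_2)
  have nsec: "norm (sec e x) = 1" if "x \<in> {x0..x1}" for x
    using eig_proj_norm_ge_1[OF d0 near_eigenvector[OF e \<psi>_su2 z0 osc[OF that]] \<eta>(2) e(1)]
    by (auto simp: sec_def eig_sec_def norm_sgn)
  define Y where "Y m = (2 * 8 / d + 4 * (B + 8 * b) / d\<^sup>2) / real m + 4 * \<eta> * b / d\<^sup>2" for m :: nat
  have Y0: "0 \<le> Y m" for m using d0 B(1) b \<eta> by (simp add: Y_def)
  define \<Gamma> where "\<Gamma> n x = cin (\<Phi> n x *v sec e (x + real n * \<alpha>)) (sec e x)" for n x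
  \<comment> \<open>\<open>p\<close> and \<open>q\<close> are the ends of the set of x for which
    both x and x + \<open>\<tau>\<close> lie in the interval.\<close>
  define p where "p \<tau> = max x0 (x0 - \<tau>)" for \<tau> :: real
  define q where "q \<tau> = min x1 (x1 - \<tau>)" for \<tau> :: real
  have piece: "cmod (integral {p \<tau>..q \<tau>} (\<lambda>x. of_real (v0 x * v0 (x + \<tau>)) * \<Gamma> n x ^ m)) \<le> Y m / real n"
    if m: "m \<ge> 1" and n: "n \<ge> 1" and \<tau>: "\<tau> = real n * \<alpha> + of_int l" for m n \<tau> l
  proof (cases "p \<tau> < q \<tau>")
    case False
    hence "{p \<tau>..q \<tau>} = {} \<or> p \<tau> = q \<tau>" by auto
    hence "integral {p \<tau>..q \<tau>} (\<lambda>x. of_real (v0 x * v0 (x + \<tau>)) * \<Gamma> n x ^ m) = 0" by auto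
    thus ?thesis using Y0[of m] by simp
  next
    case True
    have pqJ: "x \<in> {x0..x1} \<and> x + \<tau> \<in> {x0..x1}" if "x \<in> {p \<tau>..q \<tau>}" for x
      using that by (auto simp: p_def q_def)
    \<comment> \<open>A genuine overlap means a return of the rotation within
      \<open>\<delta>2\<close>, which is possible only for n >= \<open>N0\<close>.\<close>
    have "\<bar>\<tau>\<bar> < 1 / real r" using True x01(3) by (auto simp: p_def q_def)
    hence nN: "n \<ge> N0" using \<delta>2(2)[of n l] n r(3) \<tau> by (cases "n < N0") auto
    have sg: "sec e (x + \<tau>) = sec e (x + real n * \<alpha>)" for x
      using sec_periodic_int[of e "x + real n * \<alpha>" l] by (simp add: \<tau> add.assoc)
    have "cmod (integral {p \<tau>..q \<tau>} (\<lambda>x. of_real (v0 x * v0 (x + \<tau>)) * cin (\<Phi> n x *v sec e (x + \<tau>)) (sec e x) ^ m))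
      \<le> ((2 * 8 / d + 4 * (B + 8 * b) / d\<^sup>2) / real m + 4 * \<eta> * b / d\<^sup>2) / real n"
    proof (rule interval_estimate[OF e \<eta>(1,2) osc K(1) _ n _ _ _ _ pqJ \<tau>, where V'="\<lambda>x. v0' x * v0 (x + \<tau>) + v0' (x + \<tau>) * v0 x"])
      show "\<And>k. k \<in> K \<Longrightarrow> integral {x0..x1} (\<lambda>x. su2_norm (D (a k) x)) \<le> b" using K(2) JX by simp
      show "\<And>x. su2_norm (a n x - \<psi> x) \<le> d / 4" using N0[OF nN] by (simp add: less_imp_le)
      have "integral {p \<tau>..q \<tau>} (\<lambda>x. su2_norm (D (a n) x)) \<le> integral {0..1} (\<lambda>x. su2_norm (D (a n) x))"
        using x01 by (intro integral_subset_le integrable_continuous_real D_a_norm_cont)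
          (auto simp: p_def q_def su2_norm_nonneg D_a_su2)
      thus "integral {p \<tau>..q \<tau>} (\<lambda>x. su2_norm (D (a n) x)) \<le> B" using B(2)[OF n] by simp
      show "p \<tau> \<le> q \<tau>" using True by simp
      have "q \<tau> - p \<tau> \<le> 1 / real r" using x01(3) by (auto simp: p_def q_def)
      also have "\<dots> \<le> 1" using r(1) by (simp add: divide_le_eq)
      finally show "q \<tau> - p \<tau> \<le> 1" .
      show "((\<lambda>x. v0 x * v0 (x + \<tau>)) has_vector_derivative v0' x * v0 (x + \<tau>) + v0' (x + \<tau>) * v0 x) (at x)" for x
      proof -
        have "((\<lambda>x. v0 (x + \<tau>)) has_real_derivative v0' (x + \<tau>)) (at x)"
          using dv0[of "x + \<tau>"] unfolding DERIV_shift .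
        from DERIV_mult[OF dv0 this] show ?thesis by (simp add: has_real_derivative_iff_has_vector_derivative)
      qed
      show cV': "continuous_on UNIV (\<lambda>x. v0' x * v0 (x + \<tau>) + v0' (x + \<tau>) * v0 x)"
        unfolding v0_def v0'_def by (intro continuous_intros)
      show "v0 (p \<tau>) * v0 (p \<tau> + \<tau>) = 0" using v0end by (auto simp: p_def max_def)
      show "v0 (q \<tau>) * v0 (q \<tau> + \<tau>) = 0" using v0end by (auto simp: q_def min_def)
      show "0 \<le> v0 x * v0 (x + \<tau>) \<and> v0 x * v0 (x + \<tau>) \<le> 1" if "x \<in> {p \<tau>..q \<tau>}" for x
        using pqJ[OF that] v0b by (auto intro!: mult_nonneg_nonneg mult_le_one)
      \<comment> \<open>Slope 8 r on a length of at most 1 / r: the variation of the product is at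
        most 8 for every r, the value used for CV.\<close>
      have "integral {p \<tau>..q \<tau>} (\<lambda>x. \<bar>v0' x * v0 (x + \<tau>) + v0' (x + \<tau>) * v0 x\<bar>) \<le> integral {p \<tau>..q \<tau>} (\<lambda>x. 8 * real r)"
      proof (rule integral_le)
        show "(\<lambda>x. \<bar>v0' x * v0 (x + \<tau>) + v0' (x + \<tau>) * v0 x\<bar>) integrable_on {p \<tau>..q \<tau>}"
          by (intro integrable_continuous_real continuous_intros continuous_on_subset[OF cV']) auto
        fix x assume "x \<in> {p \<tau>..q \<tau>}"
        note J = pqJ[OF this, THEN conjunct1] pqJ[OF this, THEN conjunct2]
        have "\<bar>v0' x * v0 (x + \<tau>)\<bar> \<le> (4 * real r) * 1" "\<bar>v0' (x + \<tau>) * v0 x\<bar> \<le> (4 * real r) * 1"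
          unfolding abs_mult using v0b[OF J(1)] v0b[OF J(2)] by (intro mult_mono; simp)+
        thus "\<bar>v0' x * v0 (x + \<tau>) + v0' (x + \<tau>) * v0 x\<bar> \<le> 8 * real r" by linarith
      qed (rule integrable_const_ivl)
      also have "\<dots> = (q \<tau> - p \<tau>) * (8 * real r)" using True by simp
      also have "\<dots> \<le> 1 / real r * (8 * real r)" using \<open>q \<tau> - p \<tau> \<le> 1 / real r\<close> by (intro mult_right_mono) auto
      also have "\<dots> = 8" using r(1) by simp
      finally show "integral {p \<tau>..q \<tau>} (\<lambda>x. \<bar>v0' x * v0 (x + \<tau>) + v0' (x + \<tau>) * v0 x\<bar>) \<le> 8" .
    qed (use m in auto)
    thus ?thesis by (simp add: Y_def \<Gamma>_def sg)
  qed
  \<comment> \<open>The rotation moves x by \<open>\<theta>\<close> or by \<open>\<theta>\<close> -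
    1, according to whether it wraps around. Both translates may meet the interval, which gives two
    pieces.\<close>
  have split: "(LINT x|circle. of_real (v x * v (frac (x + real n * \<alpha>))) * \<Gamma> n x ^ m)
    = integral {p (frac (real n * \<alpha>))..q (frac (real n * \<alpha>))} (\<lambda>x. of_real (v0 x * v0 (x + frac (real n * \<alpha>))) * \<Gamma> n x ^ m)
    + integral {p (frac (real n * \<alpha>) - 1)..q (frac (real n * \<alpha>) - 1)} (\<lambda>x. of_real (v0 x * v0 (x + (frac (real n * \<alpha>) - 1))) * \<Gamma> n x ^ m)" for n m
  proof -
    define \<theta> where "\<theta> = frac (real n * \<alpha>)"
    have \<theta>: "0 \<le> \<theta>" "\<theta> < 1" by (auto simp: \<theta>_def frac_lt_1)
    define g where "g \<tau> x = indicator {p \<tau>..q \<tau>} x *\<^sub>R (of_real (v0 x * v0 (x + \<tau>)) * \<Gamma> n x ^ m)" for \<tau> x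
    have csec: "continuous_on {x0..x1} (sec e)"
    proof -
      have "continuous_on {x0..x1} (\<lambda>x. eig_proj d e (\<psi> x))"
        unfolding eig_proj_def by (intro continuous_intros bounded_linear.continuous_on[OF bounded_linear_smult_vec2] continuous_on_mat2_vec \<psi>_cont)
      moreover have "eig_proj d e (\<psi> x) \<noteq> 0" if "x \<in> {x0..x1}" for x
        using nsec[OF that] by (auto simp: sec_def eig_sec_def)
      ultimately show ?thesis unfolding sec_def[abs_def] eig_sec_def by (intro continuous_on_sgn) auto
    qed
    have gi: "set_integrable lborel {p \<tau>..q \<tau>} (\<lambda>x. of_real (v0 x * v0 (x + \<tau>)) * \<Gamma> n x ^ m)"
      if \<tau>: "\<tau> = real n * \<alpha> + of_int l" for \<tau> l
    proof -
      have pqJ: "x \<in> {x0..x1} \<and> x + \<tau> \<in> {x0..x1}" if "x \<in> {p \<tau>..q \<tau>}" for x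
        using that by (auto simp: p_def q_def)
      have "sec e (x + real n * \<alpha>) = sec e (x + \<tau>)" for x
        using sec_periodic_int[of e "x + real n * \<alpha>" l] by (simp add: \<tau> add.assoc)
      moreover have "continuous_on {p \<tau>..q \<tau>} (\<lambda>x. sec e (x + \<tau>))"
        by (rule continuous_on_compose2[OF csec]) (intro continuous_intros, use pqJ in blast)
      ultimately have "continuous_on {p \<tau>..q \<tau>} (\<Gamma> n)"
        unfolding \<Gamma>_def[abs_def]
        by (intro continuous_on_cin continuous_on_mat2_vec continuous_on_subset[OF C2_continuous(1)[OF \<Phi>_C2]]
            continuous_on_subset[OF csec]) (use pqJ in auto)
      hence "continuous_on {p \<tau>..q \<tau>} (\<lambda>x. of_real (v0 x * v0 (x + \<tau>)) * \<Gamma> n x ^ m)"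
        by (intro continuous_intros v0c continuous_on_compose2[OF v0c[of UNIV]]) auto
      thus ?thesis by (rule borel_integrable_atLeastAtMost')
    qed
    have \<tau>: "\<theta> = real n * \<alpha> + of_int (- \<lfloor>real n * \<alpha>\<rfloor>)" "\<theta> - 1 = real n * \<alpha> + of_int (- \<lfloor>real n * \<alpha>\<rfloor> - 1)"
      by (simp_all add: \<theta>_def frac_def)
    have G: "integral\<^sup>L lborel (g \<tau>) = integral {p \<tau>..q \<tau>} (\<lambda>x. of_real (v0 x * v0 (x + \<tau>)) * \<Gamma> n x ^ m)"
      "integrable lborel (g \<tau>)" if "\<tau> = \<theta> \<or> \<tau> = \<theta> - 1" for \<tau>
    proof -
      have "set_integrable lborel {p \<tau>..q \<tau>} (\<lambda>x. of_real (v0 x * v0 (x + \<tau>)) * \<Gamma> n x ^ m)"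
        using that gi[OF \<tau>(1)] gi[OF \<tau>(2)] by blast
      from set_borel_integral_eq_integral(2)[OF this] this
      show "integral\<^sup>L lborel (g \<tau>) = integral {p \<tau>..q \<tau>} (\<lambda>x. of_real (v0 x * v0 (x + \<tau>)) * \<Gamma> n x ^ m)"
        "integrable lborel (g \<tau>)"
        unfolding set_lebesgue_integral_def set_integrable_def g_def by auto
    qed
    have ge: "g \<tau> x = of_real (v x * v (x + \<tau>)) * \<Gamma> n x ^ m" for \<tau> x
    proof -
      have "x \<in> {p \<tau>..q \<tau>} \<longleftrightarrow> x \<in> {x0..x1} \<and> x + \<tau> \<in> {x0..x1}" by (auto simp: p_def q_def)
      thus ?thesis by (auto simp: g_def v_def indicator_def)
    qed
    have vf: "v (frac (x + real n * \<alpha>)) = v (x + \<theta>) + v (x + (\<theta> - 1))" if x: "x \<in> {0..<1}" for x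
    proof -
      have f: "frac (x + real n * \<alpha>) = (if x + \<theta> < 1 then x + \<theta> else x + \<theta> - 1)"
        using x by (simp add: frac_add \<theta>_def frac_eq)
      show ?thesis
      proof (cases "x + \<theta> < 1")
        case True
        hence "v (x + (\<theta> - 1)) = 0" using x01(1) by (simp add: v_def)
        thus ?thesis using True by (simp add: f)
      next
        case False
        \<comment> \<open>If x + \<open>\<theta>\<close> >= 1 still lies in the interval, it is the
          right end point 1, where the bump vanishes.\<close>
        have "v (x + \<theta>) = 0"
        proof (cases "x + \<theta> \<in> {x0..x1}")
          case True
          hence "x + \<theta> = x1" using False x01(2) by auto
          thus ?thesis using v0end by (simp add: v_def)
        qed (auto simp: v_def)
        thus ?thesis using False by (simp add: f add_diff_eq)
      qed
    qed
    have "(LINT x|circle. of_real (v x * v (frac (x + real n * \<alpha>))) * \<Gamma> n x ^ m) = (LINT x|circle. g \<theta> x + g (\<theta> - 1) x)"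
    proof (rule Bochner_Integration.integral_cong[OF refl])
      fix x assume "x \<in> space circle"
      hence "v (frac (x + real n * \<alpha>)) = v (x + \<theta>) + v (x + (\<theta> - 1))" by (intro vf) simp
      thus "of_real (v x * v (frac (x + real n * \<alpha>))) * \<Gamma> n x ^ m = g \<theta> x + g (\<theta> - 1) x"
        unfolding ge by (simp add: algebra_simps)
    qed
    also have "\<dots> = (\<integral>x. indicator {0..1} x *\<^sub>R (g \<theta> x + g (\<theta> - 1) x) \<partial>lborel)"
      using G(2)[of \<theta>] G(2)[of "\<theta> - 1"] by (intro integral_circle_Icc) (auto dest!: borel_measurable_integrable)
    also have "\<dots> = (\<integral>x. g \<theta> x + g (\<theta> - 1) x \<partial>lborel)"
      by (rule Bochner_Integration.integral_cong) (use x01 in \<open>auto simp: ge v_def indicator_def\<close>)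
    also have "\<dots> = integral\<^sup>L lborel (g \<theta>) + integral\<^sup>L lborel (g (\<theta> - 1))"
      by (rule Bochner_Integration.integral_add) (auto intro: G(2))
    finally show ?thesis using G(1)[of \<theta>] G(1)[of "\<theta> - 1"] by (simp add: \<theta>_def)
  qed
  \<comment> \<open>Makes the part with 1/m at most \<open>\<epsilon>\<close> / (8 r); the constant
    36 B bounds 4 (B + 8 b), as b <= B.\<close>
  obtain N :: nat where N: "real N \<ge> 8 * real r * (16 / d + 36 * B / d\<^sup>2) / \<epsilon>" using real_arch_simple by blast
  show thesis
  proof (rule that[of v e "Suc N"])
    show "0 < (LINT x|circle. (v x)\<^sup>2)" unfolding vsq using r(1) by simp
    show "norm (sec e x) = 1" if "v x \<noteq> 0" for x
      using that nsec by (auto simp: v_def split: if_splits)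
    fix m n :: nat assume m: "m \<ge> Suc N" and n: "n \<ge> 1"
    have "cmod (LINT x|circle. of_real (v x * v (frac (x + real n * \<alpha>))) * \<Gamma> n x ^ m) \<le> Y m / real n + Y m / real n"
      unfolding split
    proof (intro norm_triangle_le add_mono)
      show "cmod (integral {p (frac (real n * \<alpha>))..q (frac (real n * \<alpha>))} (\<lambda>x. of_real (v0 x * v0 (x + frac (real n * \<alpha>))) * \<Gamma> n x ^ m)) \<le> Y m / real n"
        by (rule piece[of _ _ _ "- \<lfloor>real n * \<alpha>\<rfloor>"]) (use m n in \<open>auto simp: frac_def\<close>)
      show "cmod (integral {p (frac (real n * \<alpha>) - 1)..q (frac (real n * \<alpha>) - 1)} (\<lambda>x. of_real (v0 x * v0 (x + (frac (real n * \<alpha>) - 1))) * \<Gamma> n x ^ m)) \<le> Y m / real n"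
        by (rule piece[of _ _ _ "- \<lfloor>real n * \<alpha>\<rfloor> - 1"]) (use m n in \<open>auto simp: frac_def\<close>)
    qed
    also have "\<dots> \<le> \<epsilon> * (8 / (15 * real r)) / real n"
    proof -
      have m0: "real m > 0" using m by simp
      have "(2 * 8 / d + 4 * (B + 8 * b) / d\<^sup>2) / real m \<le> (16 / d + 36 * B / d\<^sup>2) / real m"
        using b d0 by (intro divide_right_mono add_mono) auto
      also have "\<dots> \<le> \<epsilon> / (8 * real r)"
      proof -
        have "8 * real r * (16 / d + 36 * B / d\<^sup>2) / \<epsilon> \<le> real m" using N m by simp
        hence "8 * real r * (16 / d + 36 * B / d\<^sup>2) \<le> real m * \<epsilon>" using \<epsilon> by (simp only: pos_divide_le_eq)
        hence "(16 / d + 36 * B / d\<^sup>2) * (8 * real r) \<le> \<epsilon> * real m" by (simp only: mult_ac)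
        moreover have "8 * real r > 0" using r(1) by simp
        ultimately have "16 / d + 36 * B / d\<^sup>2 \<le> \<epsilon> * real m / (8 * real r)" by (simp only: pos_le_divide_eq)
        also have "\<dots> = \<epsilon> / (8 * real r) * real m" by simp
        finally show ?thesis using m0 by (simp only: pos_divide_le_eq)
      qed
      finally have 1: "(2 * 8 / d + 4 * (B + 8 * b) / d\<^sup>2) / real m \<le> \<epsilon> / (8 * real r)" .
      have "4 * \<eta> * b / d\<^sup>2 \<le> 4 * (\<epsilon> * d\<^sup>2 / (32 * B)) * b / d\<^sup>2"
        using \<eta>(3) b by (intro divide_right_mono mult_right_mono mult_left_mono) auto
      also have "\<dots> = \<epsilon> / (8 * real r)" using d0 B(1) r(1) by (simp add: b_def field_simps)
      finally have "Y m \<le> \<epsilon> / (8 * real r) + \<epsilon> / (8 * real r)" unfolding Y_def using 1 by (rule add_mono[rotated])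
      also have "\<dots> = \<epsilon> / (4 * real r)" by (simp add: field_simps)
      finally have "Y m + Y m \<le> \<epsilon> / (4 * real r) + \<epsilon> / (4 * real r)" by linarith
      \<comment> \<open>The two pieces together give \<open>\<epsilon>\<close> / (2 r), and 1/2 is
        below 8/15.\<close>
      also have "\<dots> \<le> \<epsilon> * (8 / (15 * real r))" using \<epsilon> r(1) by (simp add: field_simps)
      finally have "(Y m + Y m) / real n \<le> \<epsilon> * (8 / (15 * real r)) / real n" by (rule divide_right_mono) simp
      thus ?thesis by (simp only: add_divide_distrib)
    qed
    finally show "cmod (LINT x|circle. of_real (v x * v (frac (x + real n * \<alpha>))) * cin (\<Phi> n x *v sec e (x + real n * \<alpha>)) (sec e x) ^ m)
        \<le> \<epsilon> * (LINT x|circle. (v x)\<^sup>2) / real n"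
      unfolding vsq \<Gamma>_def .
  qed (use vm v1 e in auto)
qed

end

subsection \<open>Skew products and Haar measure\<close>

lemma fibre_measurable:
  assumes "T \<in> measurable N N" "(\<lambda>(x, g). F x g) \<in> measurable (N \<Otimes>\<^sub>M \<mu>) \<mu>"
  shows "(\<lambda>(x, g). (T x, F x g)) \<in> measurable (N \<Otimes>\<^sub>M \<mu>) (N \<Otimes>\<^sub>M \<mu>)"
  unfolding split_beta
  by (rule measurable_Pair[OF measurable_compose[OF measurable_fst assms(1)] assms(2)[unfolded split_beta]])

text \<open>Fubini: the invariance of the fibre measure removes \<open>F x\<close> from the inner
  integral, then the invariance of the base removes \<open>T\<close>.\<close>

lemma distr_fibre_preserving:
  assumes "prob_space N" "prob_space \<mu>"
    and T: "T \<in> measurable N N" "distr N N T = N"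
    and F: "(\<lambda>(x, g). F x g) \<in> measurable (N \<Otimes>\<^sub>M \<mu>) \<mu>" "\<And>x. x \<in> space N \<Longrightarrow> distr \<mu> \<mu> (F x) = \<mu>"
  shows "distr (N \<Otimes>\<^sub>M \<mu>) (N \<Otimes>\<^sub>M \<mu>) (\<lambda>(x, g). (T x, F x g)) = N \<Otimes>\<^sub>M \<mu>" (is "distr ?M ?M ?S = ?M")
proof (rule measure_eqI)
  interpret N: prob_space N by fact
  interpret \<mu>: prob_space \<mu> by fact
  have S: "?S \<in> measurable ?M ?M" by (rule fibre_measurable[OF T(1) F(1)])
  fix A assume "A \<in> sets (distr ?M ?M ?S)"
  hence A: "A \<in> sets ?M" by simp
  have Fx: "F x \<in> measurable \<mu> \<mu>" if "x \<in> space N" for x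
    using measurable_compose[OF measurable_Pair1'[OF that] F(1)] by simp
  have "emeasure (distr ?M ?M ?S) A = (\<integral>\<^sup>+y. indicator A y \<partial>distr ?M ?M ?S)"
    by (rule nn_integral_indicator[symmetric]) (simp add: A)
  also have "\<dots> = (\<integral>\<^sup>+y. indicator A (?S y) \<partial>?M)" by (rule nn_integral_distr) (use S A in auto)
  also have "\<dots> = (\<integral>\<^sup>+x. \<integral>\<^sup>+g. indicator A (T x, F x g) \<partial>\<mu> \<partial>N)"
    using \<mu>.nn_integral_fst[OF measurable_compose[OF S borel_measurable_indicator[OF A, where 'b=ennreal]], symmetric]
    by (simp only: case_prod_conv)
  also have "\<dots> = (\<integral>\<^sup>+x. \<integral>\<^sup>+g. indicator A (T x, g) \<partial>\<mu> \<partial>N)"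
  proof (rule nn_integral_cong)
    fix x assume x: "x \<in> space N"
    have m: "(\<lambda>g. indicator A (T x, g) :: ennreal) \<in> borel_measurable \<mu>"
      by (rule measurable_compose[OF measurable_Pair1'[OF measurable_space[OF T(1) x]] borel_measurable_indicator[OF A]])
    have "(\<integral>\<^sup>+g. indicator A (T x, g) \<partial>\<mu>) = (\<integral>\<^sup>+g. indicator A (T x, g) \<partial>distr \<mu> \<mu> (F x))" by (simp add: F(2)[OF x])
    also have "\<dots> = (\<integral>\<^sup>+g. indicator A (T x, F x g) \<partial>\<mu>)"
      by (rule nn_integral_distr) (use Fx[OF x] m in auto)
    finally show "(\<integral>\<^sup>+g. indicator A (T x, F x g) \<partial>\<mu>) = (\<integral>\<^sup>+g. indicator A (T x, g) \<partial>\<mu>)" ..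
  qed
  also have "\<dots> = (\<integral>\<^sup>+x. \<integral>\<^sup>+g. indicator A (x, g) \<partial>\<mu> \<partial>distr N N T)"
  proof -
    have "(\<lambda>x. \<integral>\<^sup>+g. indicator A (x, g) \<partial>\<mu>) \<in> borel_measurable N"
      using \<mu>.borel_measurable_nn_integral_fst[OF borel_measurable_indicator[OF A]] .
    thus ?thesis by (intro nn_integral_distr[symmetric]) (use T in auto)
  qed
  also have "\<dots> = (\<integral>\<^sup>+y. indicator A y \<partial>?M)"
    unfolding T(2) by (rule \<mu>.nn_integral_fst[OF borel_measurable_indicator[OF A]])
  also have "\<dots> = emeasure ?M A" by (rule nn_integral_indicator[OF A])
  finally show "emeasure (distr ?M ?M ?S) A = emeasure ?M A" .
qed simp

lemma sets_circle_borel: "A \<in> sets circle \<Longrightarrow> A \<in> sets borel"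
  by (auto simp: sets_circle sets_restrict_space)

lemma rot_measurable: "rot \<alpha> \<in> measurable circle circle"
proof -
  have "rot \<alpha> \<in> measurable circle (restrict_space lborel {0..<1})"
  proof (rule measurable_restrict_space2)
    show "rot \<alpha> \<in> space circle \<rightarrow> {0..<1}" by (auto simp: rot_def frac_lt_1)
    show "rot \<alpha> \<in> measurable circle lborel"
      unfolding rot_def frac_def using borel_measurable_circle[of "\<lambda>x. x + \<alpha> - of_int \<lfloor>x + \<alpha>\<rfloor>" borel] by simp
  qed
  thus ?thesis by (simp add: circle_def)
qed

lemma nn_integral_circle:
  "f \<in> borel_measurable borel \<Longrightarrow> (\<integral>\<^sup>+x. f x \<partial>circle) = (\<integral>\<^sup>+x. f x * indicator {0..<1} x \<partial>lborel)"
  unfolding circle_def by (rule nn_integral_restrict_space) simp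

text \<open>The circle is cut at 1 - \<open>\<theta>\<close>; on the two pieces the rotation is a
  translation of the line, by \<open>\<theta>\<close> and by \<open>\<theta>\<close> - 1.\<close>

lemma distr_rot: "distr circle circle (rot \<alpha>) = circle"
proof (rule measure_eqI)
  fix A assume "A \<in> sets (distr circle circle (rot \<alpha>))"
  hence A: "A \<in> sets circle" by simp
  have Ab [measurable]: "A \<in> sets borel" by (rule sets_circle_borel[OF A])
  define \<theta> where "\<theta> = frac \<alpha>"
  have \<theta>: "0 \<le> \<theta>" "\<theta> < 1" by (auto simp: \<theta>_def frac_lt_1)
  have rot: "rot \<alpha> x = (if x + \<theta> < 1 then x + \<theta> else x + \<theta> - 1)" if x: "x \<in> {0..<1}" for x
    using x by (simp add: rot_def frac_add \<theta>_def frac_eq)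
  have shift: "(\<integral>\<^sup>+x. f (x + c) \<partial>lborel) = (\<integral>\<^sup>+x. f x \<partial>lborel)" if "f \<in> borel_measurable borel" for f :: "real \<Rightarrow> ennreal" and c
    using nn_integral_real_affine[OF that, of 1 c] by (simp add: add.commute)
  have rm: "rot \<alpha> \<in> borel_measurable borel" unfolding rot_def frac_def by measurable
  note [measurable] = rm
  have "emeasure (distr circle circle (rot \<alpha>)) A = (\<integral>\<^sup>+x. indicator A x \<partial>distr circle circle (rot \<alpha>))"
    using A by simp
  also have "\<dots> = (\<integral>\<^sup>+x. indicator A (rot \<alpha> x) \<partial>circle)"
    by (rule nn_integral_distr[OF rot_measurable]) (use A in auto)
  also have "\<dots> = (\<integral>\<^sup>+x. indicator A (rot \<alpha> x) * indicator {0..<1} x \<partial>lborel)"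
    by (rule nn_integral_circle) measurable
  also have "\<dots> = (\<integral>\<^sup>+x. indicator A (x + \<theta>) * indicator {\<theta>..<1} (x + \<theta>)
      + indicator A (x + (\<theta> - 1)) * indicator {0..<\<theta>} (x + (\<theta> - 1)) \<partial>lborel)"
    by (rule nn_integral_cong) (use \<theta> in \<open>auto simp: rot indicator_def algebra_simps\<close>)
  also have "\<dots> = (\<integral>\<^sup>+x. indicator A (x + \<theta>) * indicator {\<theta>..<1} (x + \<theta>) \<partial>lborel)
      + (\<integral>\<^sup>+x. indicator A (x + (\<theta> - 1)) * indicator {0..<\<theta>} (x + (\<theta> - 1)) \<partial>lborel)"
    by (rule nn_integral_add) measurable
  also have "\<dots> = (\<integral>\<^sup>+x. indicator A x * indicator {\<theta>..<1} x \<partial>lborel) + (\<integral>\<^sup>+x. indicator A x * indicator {0..<\<theta>} x \<partial>lborel)"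
    using shift[of "\<lambda>x. indicator A x * indicator {\<theta>..<1} x" \<theta>] shift[of "\<lambda>x. indicator A x * indicator {0..<\<theta>} x" "\<theta> - 1"]
    by simp
  also have "\<dots> = (\<integral>\<^sup>+x. indicator A x * indicator {\<theta>..<1} x + indicator A x * indicator {0..<\<theta>} x \<partial>lborel)"
    by (rule nn_integral_add[symmetric]) measurable
  also have "\<dots> = (\<integral>\<^sup>+x. indicator A x * indicator {0..<1} x \<partial>lborel)"
    by (rule nn_integral_cong) (use \<theta> in \<open>auto simp: indicator_def\<close>)
  also have "\<dots> = (\<integral>\<^sup>+x. indicator A x \<partial>circle)" by (rule nn_integral_circle[symmetric]) measurable
  also have "\<dots> = emeasure circle A" using A by simp
  finally show "emeasure (distr circle circle (rot \<alpha>)) A = emeasure circle A" .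
qed simp

lemma rot_inverse: "x \<in> {0..<1} \<Longrightarrow> rot (- \<alpha>) (rot \<alpha> x) = x" "x \<in> {0..<1} \<Longrightarrow> rot \<alpha> (rot (- \<alpha>) x) = x"
proof -
  assume x: "x \<in> {0..<1}"
  have "frac (frac (x + \<beta>) + - \<beta>) = frac (x + \<beta> + - \<beta>)" for \<beta> by (simp only: frac_add_simps)
  hence "rot (- \<beta>) (rot \<beta> x) = x" for \<beta> using x by (simp add: rot_def frac_eq)
  from this[of \<alpha>] this[of "- \<alpha>"] show "rot (- \<alpha>) (rot \<alpha> x) = x" "rot \<alpha> (rot (- \<alpha>) x) = x" by simp_all
qed

lemma rot_space: "rot \<alpha> x \<in> {0..<1}"
  by (simp add: rot_def frac_lt_1)

locale SU2_haar =
  fixes \<mu> :: "cmat2 measure"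
  assumes haar: "normalized_haar (**) SU2 \<mu>"
begin

sublocale prob_space \<mu>
  using haar by (intro prob_spaceI) (simp add: normalized_haar_def)

lemma sets_\<mu>: "sets \<mu> = sets (restrict_space borel SU2)"
  using haar by (simp add: normalized_haar_def)

lemma space_\<mu> [simp]: "space \<mu> = SU2"
  using sets_eq_imp_space_eq[OF sets_\<mu>] by (simp add: space_restrict_space)

lemma left_invariant: "k \<in> SU2 \<Longrightarrow> distr \<mu> \<mu> ((**) k) = \<mu>"
  using haar by (simp add: normalized_haar_def)

lemma measurable_to_\<mu>:
  assumes "f \<in> borel_measurable M" "\<And>y. y \<in> space M \<Longrightarrow> f y \<in> SU2"
  shows "f \<in> measurable M \<mu>"
proof -
  have "f \<in> measurable M (restrict_space borel SU2)"
    using assms by (intro measurable_restrict_space2) auto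
  thus ?thesis using measurable_cong_sets[OF refl sets_\<mu>] by blast
qed

lemma measurable_from_\<mu>: "f \<in> measurable borel N \<Longrightarrow> f \<in> measurable \<mu> N"
  using measurable_restrict_space1[of f borel N SU2] measurable_cong_sets[OF sets_\<mu> refl] by blast

lemma id_measurable [measurable]: "(\<lambda>g. g) \<in> borel_measurable \<mu>"
  by (rule measurable_from_\<mu>) simp

end

lemma borel_measurable_mat2_mult:
  fixes f g :: "'a \<Rightarrow> cmat2"
  assumes "f \<in> borel_measurable M" "g \<in> borel_measurable M"
  shows "(\<lambda>x. f x ** g x) \<in> borel_measurable M"
  by (rule borel_measurable_continuous_Pair[OF assms])
     (intro continuous_on_mat2_mult continuous_on_fst continuous_on_snd continuous_on_id)

lemma borel_measurable_mat2_vec: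
  assumes "f \<in> borel_measurable M" "g \<in> borel_measurable M"
  shows "(\<lambda>x. (f x :: cmat2) *v g x) \<in> borel_measurable M"
  by (rule borel_measurable_continuous_Pair[OF assms])
     (intro continuous_on_mat2_vec continuous_on_fst continuous_on_snd continuous_on_id)

lemma borel_measurable_adjoint_mat:
  "f \<in> borel_measurable M \<Longrightarrow> (\<lambda>x. adjoint_mat (f x)) \<in> borel_measurable M"
  by (rule borel_measurable_continuous_on[OF linear_continuous_on[OF bounded_linear_adjoint_mat]])

lemma borel_measurable_vec2_nth:
  "f \<in> borel_measurable M \<Longrightarrow> (\<lambda>x. (f x :: complex ^ 2) $ i) \<in> borel_measurable M"
  by (rule borel_measurable_continuous_on[OF linear_continuous_on[OF bounded_linear_vec_nth]])

context SU2_haar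
begin

text \<open>The image under inversion is right-invariant, and agrees with the left-invariant measure by Fubini.\<close>
lemma right_invariant:
  assumes k: "k \<in> SU2"
  shows "distr \<mu> \<mu> (\<lambda>g. g ** k) = \<mu>"
proof -
  have inv: "adjoint_mat \<in> measurable \<mu> \<mu>"
    by (rule measurable_to_\<mu>) (use borel_measurable_adjoint_mat[OF id_measurable] SU2_adjoint in auto)
  have right: "(\<lambda>g. g ** k) \<in> measurable \<mu> \<mu>" if "k \<in> SU2" for k
    by (rule measurable_to_\<mu>) (use borel_measurable_mat2_mult[OF id_measurable borel_measurable_const] SU2_mult that in auto)
  have left: "(**) k \<in> measurable \<mu> \<mu>" if "k \<in> SU2" for k
    by (rule measurable_to_\<mu>) (use borel_measurable_mat2_mult[OF borel_measurable_const id_measurable] SU2_mult that in auto)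
  define \<nu> where "\<nu> = distr \<mu> \<mu> adjoint_mat"
  interpret \<nu>: prob_space \<nu> unfolding \<nu>_def by (rule prob_space_distr[OF inv])
  have s: "sets \<nu> = sets \<mu>" by (simp add: \<nu>_def)
  have sp: "space \<nu> = SU2" by (simp add: \<nu>_def)
  have \<nu>_right: "distr \<nu> \<mu> (\<lambda>g. g ** k) = \<nu>" if k: "k \<in> SU2" for k
  proof -
    have "distr \<nu> \<mu> (\<lambda>g. g ** k) = distr \<mu> \<mu> ((\<lambda>g. g ** k) \<circ> adjoint_mat)"
      unfolding \<nu>_def by (rule distr_distr[OF right[OF k] inv])
    also have "(\<lambda>g. g ** k) \<circ> adjoint_mat = adjoint_mat \<circ> (**) (adjoint_mat k)"
      by (auto simp: adjoint_mat_mult)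
    also have "distr \<mu> \<mu> (adjoint_mat \<circ> (**) (adjoint_mat k)) = distr (distr \<mu> \<mu> ((**) (adjoint_mat k))) \<mu> adjoint_mat"
      by (rule distr_distr[symmetric, OF inv left[OF SU2_adjoint[OF k]]])
    also have "\<dots> = \<nu>" by (simp add: left_invariant SU2_adjoint k \<nu>_def)
    finally show ?thesis .
  qed
  interpret P: pair_sigma_finite \<nu> \<mu> ..
  have "\<mu> = \<nu>"
  proof (rule measure_eqI)
    fix A assume A: "A \<in> sets \<mu>"
    have prod: "(\<lambda>(h, g). h ** g) \<in> measurable (\<nu> \<Otimes>\<^sub>M \<mu>) \<mu>"
    proof (rule measurable_to_\<mu>)
      have 1: "(\<lambda>g. g) \<in> borel_measurable \<nu>" using id_measurable measurable_cong_sets[OF s refl] by blast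
      show "(\<lambda>(h, g). h ** g) \<in> borel_measurable (\<nu> \<Otimes>\<^sub>M \<mu>)"
        unfolding split_beta
        by (intro borel_measurable_mat2_mult measurable_compose[OF measurable_fst 1] measurable_compose[OF measurable_snd id_measurable])
    qed (auto simp: space_pair_measure sp SU2_mult)
    have im: "(\<lambda>y. indicator A (case y of (h, g) \<Rightarrow> h ** g) :: ennreal) \<in> borel_measurable (\<nu> \<Otimes>\<^sub>M \<mu>)"
      by (rule measurable_compose[OF prod]) (use A in simp)
    have iA: "(indicator A :: _ \<Rightarrow> ennreal) \<in> borel_measurable \<mu>" using A by simp
    \<comment> \<open>Evaluating the integral of the indicator at h g in both orders: integrating
      over g first uses left invariance of \<open>\<mu>\<close>, over h first right invariance of
      \<open>\<nu>\<close>.\<close>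
    have "emeasure \<mu> A = (\<integral>\<^sup>+h. emeasure \<mu> A \<partial>\<nu>)" by (simp add: \<nu>.emeasure_space_1)
    also have "\<dots> = (\<integral>\<^sup>+h. \<integral>\<^sup>+g. indicator A (h ** g) \<partial>\<mu> \<partial>\<nu>)"
    proof (rule nn_integral_cong)
      fix h assume "h \<in> space \<nu>"
      hence h: "h \<in> SU2" by (simp add: sp)
      have "emeasure \<mu> A = (\<integral>\<^sup>+g. indicator A g \<partial>distr \<mu> \<mu> ((**) h))" using A by (simp add: left_invariant h)
      also have "\<dots> = (\<integral>\<^sup>+g. indicator A (h ** g) \<partial>\<mu>)"
        by (rule nn_integral_distr[OF left[OF h]]) (use iA in simp)
      finally show "emeasure \<mu> A = (\<integral>\<^sup>+g. indicator A (h ** g) \<partial>\<mu>)" .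
    qed
    also have "\<dots> = (\<integral>\<^sup>+g. \<integral>\<^sup>+h. indicator A (h ** g) \<partial>\<nu> \<partial>\<mu>)"
      using P.Fubini'[of "\<lambda>h g. indicator A (h ** g)"] im by (simp add: split_beta)
    also have "\<dots> = (\<integral>\<^sup>+g. emeasure \<nu> A \<partial>\<mu>)"
    proof (rule nn_integral_cong)
      fix g assume "g \<in> space \<mu>"
      hence g: "g \<in> SU2" by simp
      have "emeasure \<nu> A = (\<integral>\<^sup>+h. indicator A h \<partial>distr \<nu> \<mu> (\<lambda>h. h ** g))" using A by (simp add: \<nu>_right g s)
      also have "\<dots> = (\<integral>\<^sup>+h. indicator A (h ** g) \<partial>\<nu>)"
        by (rule nn_integral_distr) (use right[OF g] iA measurable_cong_sets[OF s refl] in auto)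
      finally show "(\<integral>\<^sup>+h. indicator A (h ** g) \<partial>\<nu>) = emeasure \<nu> A" ..
    qed
    also have "\<dots> = emeasure \<nu> A" by (simp add: emeasure_space_1[unfolded space_\<mu>])
    finally show "emeasure \<mu> A = emeasure \<nu> A" .
  qed (simp add: s)
  thus ?thesis using \<nu>_right[OF k] by simp
qed

lemma integral_translate:
  fixes f :: "cmat2 \<Rightarrow> 'b::{banach,second_countable_topology}"
  assumes k: "k \<in> SU2" and f: "f \<in> borel_measurable \<mu>"
  shows "(\<integral>g. f (g ** k) \<partial>\<mu>) = (\<integral>g. f g \<partial>\<mu>)"
proof -
  have "(\<lambda>g. g ** k) \<in> measurable \<mu> \<mu>"
    by (rule measurable_to_\<mu>) (use borel_measurable_mat2_mult[OF id_measurable borel_measurable_const] SU2_mult k in auto)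
  from integral_distr[OF this f] show ?thesis by (simp add: right_invariant[OF k])
qed

definition moment :: "nat \<Rightarrow> real" where
  "moment m = (\<integral>g. cmod (g $ 1 $ 1) ^ (2 * m) \<partial>\<mu>)"

lemma measurable_entry: "(\<lambda>g. (g *v s) $ 1) \<in> borel_measurable \<mu>"
  by (intro borel_measurable_vec2_nth borel_measurable_mat2_vec id_measurable borel_measurable_const)

text \<open>\<open>k\<close> is the element of SU(2) with first column s. Right translation by it
  turns the first entry of g s into the corner entry of g, independently of s.\<close>

lemma moment_unit_vector:
  assumes "norm s = 1"
  shows "(\<integral>g. cmod ((g *v s) $ 1) ^ (2 * m) \<partial>\<mu>) = moment m"
proof -
  define k :: cmat2 where "k = (\<chi> i j. if i = 1 then (if j = 1 then s $ 1 else - cnj (s $ 2)) else (if j = 1 then s $ 2 else cnj (s $ 1)))"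
  have k: "k $ 1 $ 1 = s $ 1" "k $ 1 $ 2 = - cnj (s $ 2)" "k $ 2 $ 1 = s $ 2" "k $ 2 $ 2 = cnj (s $ 1)"
    by (simp_all add: k_def)
  have "s $ 1 * cnj (s $ 1) + s $ 2 * cnj (s $ 2) = 1"
    using cin_self[of s] assms by (simp add: cin_def)
  hence kS: "k \<in> SU2" by (intro SU2_I) (simp_all add: k mult.commute)
  have "(\<integral>g. cmod ((g ** k) $ 1 $ 1) ^ (2 * m) \<partial>\<mu>) = moment m"
    unfolding moment_def
  proof (rule integral_translate[OF kS])
    have "(\<lambda>g. (g *v axis 1 1) $ 1) \<in> borel_measurable \<mu>" by (rule measurable_entry)
    hence "(\<lambda>g. g $ 1 $ 1) \<in> borel_measurable \<mu>" by (simp add: mat2_vec_component axis_def)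
    thus "(\<lambda>g. cmod (g $ 1 $ 1) ^ (2 * m)) \<in> borel_measurable \<mu>" by measurable
  qed
  moreover have "(g ** k) $ 1 $ 1 = (g *v s) $ 1" for g :: cmat2
    by (simp add: mat2_mult_component mat2_vec_component k)
  ultimately show ?thesis by simp
qed

lemma entry_le_1:
  assumes "g \<in> SU2" "norm s \<le> 1"
  shows "cmod ((g *v s) $ 1) \<le> 1"
  using Finite_Cartesian_Product.norm_nth_le[of "g *v s" 1] assms by (simp add: norm_SU2_vec)

text \<open>If the moment vanished, so would the first row of almost every g, although this row is a
  unit vector.\<close>

lemma moment_pos: "0 < moment m"
proof -
  have int: "integrable \<mu> (\<lambda>g. cmod ((g *v s) $ 1) ^ (2 * m))" if "norm s = 1" for s
    by (rule integrable_const_bound[of _ 1])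
       (use measurable_entry entry_le_1 that in \<open>auto intro!: AE_I2 power_le_one\<close>)
  have "moment m \<ge> 0" unfolding moment_def by simp
  moreover have "moment m \<noteq> 0"
  proof
    assume 0: "moment m = 0"
    have z: "AE g in \<mu>. (g *v s) $ 1 = 0" if "norm s = 1" for s
    proof -
      have "AE g in \<mu>. cmod ((g *v s) $ 1) ^ (2 * m) = 0"
        using integral_nonneg_eq_0_iff_AE[OF int[OF that]] moment_unit_vector[OF that, of m] 0 by simp
      thus ?thesis by eventually_elim simp
    qed
    have "AE g in \<mu>. False"
      using z[OF norm_axis_vec2[of 1]] z[OF norm_axis_vec2[of 2]] AE_space
    proof eventually_elim
      case (elim g)
      hence "g $ 1 $ 1 = 0" "g $ 1 $ 2 = 0" "g \<in> SU2" by (simp_all add: mat2_vec_component axis_def)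
      thus False using SU2_component(3)[of g] by simp
    qed
    thus False by simp
  qed
  ultimately show ?thesis by simp
qed

end

text \<open>The diagonal torus of SU(2), for unimodular u. It acts from the left and so commutes
  with the skew product, which multiplies from the right, and it scales the first row by u.\<close>

definition torus_mat :: "complex \<Rightarrow> cmat2" where
  "torus_mat u = (\<chi> i j. if i = j then (if i = 1 then u else cnj u) else 0)"

lemma torus_mat_SU2: "cmod u = 1 \<Longrightarrow> torus_mat u \<in> SU2"
  by (rule SU2_I) (use complex_norm_square[of u] in \<open>simp_all add: torus_mat_def\<close>)

lemma torus_mat_entry: "((torus_mat u ** (g :: cmat2)) *v s) $ 1 = u * (g *v s) $ 1"
  by (simp add: mat2_vec_component mat2_mult_component torus_mat_def algebra_simps)

lemma (in positive_degree_cocycle) sec_measurable: "sec e \<in> borel_measurable borel"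
proof -
  have "continuous_on UNIV (\<lambda>x. eig_proj d e (\<psi> x))"
    unfolding eig_proj_def by (intro continuous_intros bounded_linear.continuous_on[OF bounded_linear_smult_vec2] continuous_on_mat2_vec \<psi>_cont)
  hence [measurable]: "(\<lambda>x. eig_proj d e (\<psi> x)) \<in> borel_measurable borel" by (rule borel_measurable_continuous_onI)
  show ?thesis unfolding sec_def[abs_def] eig_sec_def sgn_div_norm by measurable
qed

lemma (in positive_degree_cocycle) sec_norm_le: "norm (sec e x) \<le> 1"
  by (simp add: sec_def eig_sec_def norm_sgn)

lemma (in positive_degree_cocycle) sec_frac: "sec e (frac x) = sec e x"
  by (rule periodic_frac) (simp add: sec_def \<psi>_periodic)

lemma (in positive_degree_cocycle) \<phi>_frac: "\<phi> (frac x) = \<phi> x"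
  by (rule periodic_frac) (rule \<phi>_periodic)

section \<open>The extension by SU(2)\<close>

locale su2_skew_product = positive_degree_cocycle \<alpha> \<phi> + SU2_haar \<mu> for \<alpha> \<phi> \<mu>
begin

lemma \<phi>_measurable: "\<phi> \<in> borel_measurable borel"
  by (rule borel_measurable_continuous_onI[OF C2_continuous(1)[OF \<phi>_C2]])

definition "skew_inv = (\<lambda>(x, g). (rot (- \<alpha>) x, g ** adjoint_mat (\<phi> (rot (- \<alpha>) x))))"

definition "left_torus u = (\<lambda>(x :: real, g). (x, torus_mat u ** g))"

text \<open>Right invariance of Haar measure makes the skew product measure preserving, left
  invariance the torus symmetries; they commute by associativity.\<close>

lemma symmetric_automorphism:
  "circle_symmetric_automorphism (circle \<Otimes>\<^sub>M \<mu>) (skew_product (**) \<alpha> \<phi>) skew_inv left_torus"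
proof -
  have \<phi>c: "\<phi> \<in> borel_measurable circle" by (rule borel_measurable_circle[OF \<phi>_measurable])
  have b: "(\<lambda>(x, g). g ** f x) \<in> measurable (circle \<Otimes>\<^sub>M \<mu>) \<mu>"
    if "f \<in> borel_measurable circle" "\<And>x. x \<in> space circle \<Longrightarrow> f x \<in> SU2" for f
    by (rule measurable_to_\<mu>, unfold split_beta)
       (intro borel_measurable_mat2_mult measurable_compose[OF measurable_fst that(1)] measurable_compose[OF measurable_snd id_measurable],
        use that(2) in \<open>auto simp: space_pair_measure SU2_mult\<close>)
  have inv: "(\<lambda>x. adjoint_mat (\<phi> (rot (- \<alpha>) x))) \<in> borel_measurable circle"
    by (intro borel_measurable_adjoint_mat measurable_compose[OF rot_measurable \<phi>c])
  have F1: "(\<lambda>(x, g). g ** \<phi> x) \<in> measurable (circle \<Otimes>\<^sub>M \<mu>) \<mu>" by (rule b[OF \<phi>c \<phi>_SU2])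
  have F2: "(\<lambda>(x, g). g ** adjoint_mat (\<phi> (rot (- \<alpha>) x))) \<in> measurable (circle \<Otimes>\<^sub>M \<mu>) \<mu>"
    by (rule b[OF inv SU2_adjoint[OF \<phi>_SU2]])
  have F3: "(\<lambda>(x, g). torus_mat u ** g) \<in> measurable (circle \<Otimes>\<^sub>M \<mu>) \<mu>" if "cmod u = 1" for u
    by (rule measurable_to_\<mu>, unfold split_beta)
       (intro borel_measurable_mat2_mult borel_measurable_const measurable_compose[OF measurable_snd id_measurable],
        use torus_mat_SU2[OF that] in \<open>auto simp: space_pair_measure SU2_mult\<close>)
  have idc: "(\<lambda>x. x) \<in> measurable circle circle" by simp
  have P: "prob_space (circle \<Otimes>\<^sub>M \<mu>)"
  proof -
    interpret C: prob_space circle by (rule prob_space_circle)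
    interpret PP: pair_prob_space circle \<mu> ..
    show ?thesis by (rule PP.P.prob_space_axioms)
  qed
  have sk: "skew_product (**) \<alpha> \<phi> = (\<lambda>(x, g). (rot \<alpha> x, g ** \<phi> x))" by (simp add: skew_product_def)
  show ?thesis
  proof (intro circle_symmetric_automorphism.intro[OF P] circle_symmetric_automorphism_axioms.intro)
    show "skew_product (**) \<alpha> \<phi> \<in> measurable (circle \<Otimes>\<^sub>M \<mu>) (circle \<Otimes>\<^sub>M \<mu>)"
      unfolding sk by (rule fibre_measurable[OF rot_measurable F1])
    show "skew_inv \<in> measurable (circle \<Otimes>\<^sub>M \<mu>) (circle \<Otimes>\<^sub>M \<mu>)"
      unfolding skew_inv_def by (rule fibre_measurable[OF rot_measurable F2])
    show "distr (circle \<Otimes>\<^sub>M \<mu>) (circle \<Otimes>\<^sub>M \<mu>) (skew_product (**) \<alpha> \<phi>) = circle \<Otimes>\<^sub>M \<mu>"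
      unfolding sk
      by (rule distr_fibre_preserving[OF prob_space_circle prob_space_axioms rot_measurable distr_rot F1])
         (rule right_invariant[OF \<phi>_SU2])
    fix u :: complex assume u: "cmod u = 1"
    show "left_torus u \<in> measurable (circle \<Otimes>\<^sub>M \<mu>) (circle \<Otimes>\<^sub>M \<mu>)"
      unfolding left_torus_def by (rule fibre_measurable[OF idc F3[OF u]])
    show "distr (circle \<Otimes>\<^sub>M \<mu>) (circle \<Otimes>\<^sub>M \<mu>) (left_torus u) = circle \<Otimes>\<^sub>M \<mu>"
      unfolding left_torus_def
      by (rule distr_fibre_preserving[OF prob_space_circle prob_space_axioms idc _ F3[OF u]])
         (simp_all add: distr_id2 left_invariant torus_mat_SU2 u)
  next
    fix y assume y: "y \<in> space (circle \<Otimes>\<^sub>M \<mu>)"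
    show "skew_inv (skew_product (**) \<alpha> \<phi> y) = y" "skew_product (**) \<alpha> \<phi> (skew_inv y) = y"
      using y by (auto simp: space_pair_measure skew_inv_def sk rot_inverse SU2_cancel[OF \<phi>_SU2])
    show "left_torus u (skew_product (**) \<alpha> \<phi> y) = skew_product (**) \<alpha> \<phi> (left_torus u y)" for u
      by (cases y) (simp add: left_torus_def sk matrix_mul_assoc)
  qed
qed

sublocale Sk: circle_symmetric_automorphism "circle \<Otimes>\<^sub>M \<mu>" "skew_product (**) \<alpha> \<phi>" skew_inv left_torus
  by (rule symmetric_automorphism)

lemma skew_funpow:
  assumes "x \<in> {0..<1}"
  shows "(skew_product (**) \<alpha> \<phi> ^^ n) (x, g) = (frac (x + real n * \<alpha>), g ** \<Phi> n x)"
proof (induction n)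
  case 0
  show ?case using assms by (simp add: frac_eq)
next
  case (Suc n)
  have "rot \<alpha> (frac (x + real n * \<alpha>)) = frac (x + real (Suc n) * \<alpha>)"
    unfolding rot_def by (simp add: frac_add_simps algebra_simps)
  moreover have "skew_product (**) \<alpha> \<phi> (z, h) = (rot \<alpha> z, h ** \<phi> z)" for z h by (simp add: skew_product_def)
  ultimately show ?case by (simp add: Suc.IH \<phi>_frac matrix_mul_assoc)
qed

text \<open>A matrix coefficient of weight m evaluated along the eigenline: the fibre enters through
  the first entry of g \<open>sec e x\<close> alone, which transforms by a scalar both under the
  torus and along the orbit.\<close>

definition packet :: "(real \<Rightarrow> real) \<Rightarrow> complex ^ 2 \<Rightarrow> nat \<Rightarrow> real \<times> cmat2 \<Rightarrow> complex" where
  "packet v e m = (\<lambda>(x, g). of_real (v x) * ((g *v sec e x) $ 1) ^ m)"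

lemma packet_measurable:
  assumes "v \<in> borel_measurable borel"
  shows "packet v e m \<in> borel_measurable (circle \<Otimes>\<^sub>M \<mu>)"
proof -
  have 1: "(\<lambda>y. sec e (fst y)) \<in> borel_measurable (circle \<Otimes>\<^sub>M \<mu>)"
    by (intro measurable_compose[OF measurable_fst] borel_measurable_circle sec_measurable)
  have 2: "(\<lambda>y. v (fst y)) \<in> borel_measurable (circle \<Otimes>\<^sub>M \<mu>)"
    by (intro measurable_compose[OF measurable_fst] borel_measurable_circle assms)
  have 3: "(\<lambda>y. (snd y *v sec e (fst y)) $ 1) \<in> borel_measurable (circle \<Otimes>\<^sub>M \<mu>)"
    by (intro borel_measurable_vec2_nth borel_measurable_mat2_vec 1 measurable_compose[OF measurable_snd id_measurable])
  show ?thesis unfolding packet_def split_beta using 2 3 by measurable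
qed

lemma packet_bound:
  assumes "\<And>x. 0 \<le> v x" "\<And>x. v x \<le> 1" "y \<in> space (circle \<Otimes>\<^sub>M \<mu>)"
  shows "cmod (packet v e m y) \<le> 1"
proof -
  obtain x g where y: "y = (x, g)" "g \<in> SU2" using assms(3) by (auto simp: space_pair_measure)
  have "cmod (packet v e m y) = v x * cmod ((g *v sec e x) $ 1) ^ m"
    using assms(1) by (simp add: y packet_def norm_mult norm_power)
  also have "\<dots> \<le> 1" using assms y entry_le_1[OF y(2) sec_norm_le]
    by (intro mult_le_one power_le_one) auto
  finally show ?thesis .
qed

text \<open>Along the orbit the vector g \<open>sec e x\<close> is multiplied by
  \<open>\<Gamma>\<close>, so the fibre integral separates; what remains of it is the moment, the
  same for every unit vector.\<close>

lemma corr_packet: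
  assumes vm: "v \<in> borel_measurable borel" and v: "\<And>x. 0 \<le> v x" "\<And>x. v x \<le> 1"
    and sec: "\<And>x. v x \<noteq> 0 \<Longrightarrow> norm (sec e x) = 1"
  shows "Sk.corr (packet v e m) n = of_real (moment m) *
    (LINT x|circle. of_real (v x * v (frac (x + real n * \<alpha>))) * cin (\<Phi> n x *v sec e (x + real n * \<alpha>)) (sec e x) ^ m)"
proof -
  interpret C: prob_space circle by (rule prob_space_circle)
  interpret P: pair_sigma_finite circle \<mu> ..
  let ?S = "skew_product (**) \<alpha> \<phi>" and ?F = "packet v e m"
  let ?\<Gamma> = "\<lambda>x. cin (\<Phi> n x *v sec e (x + real n * \<alpha>)) (sec e x)"
  note [measurable] = packet_measurable[OF vm, of e m]
  have int: "integrable (circle \<Otimes>\<^sub>M \<mu>) (\<lambda>y. ?F ((?S ^^ n) y) * cnj (?F y))"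
  proof (rule Sk.integrable_bounded[of _ 1])
    fix y assume y: "y \<in> space (circle \<Otimes>\<^sub>M \<mu>)"
    show "norm (?F ((?S ^^ n) y) * cnj (?F y)) \<le> 1"
      unfolding norm_mult complex_mod_cnj
      using packet_bound[OF v y] packet_bound[OF v measurable_space[OF Sk.pow_meas(1) y]] by (intro mult_le_one) auto
  qed measurable
  have "Sk.corr ?F n = (LINT x|circle. LINT g|\<mu>. ?F ((?S ^^ n) (x, g)) * cnj (?F (x, g)))"
    unfolding Sk.corr_def by (rule P.integral_fst'[OF int, symmetric])
  also have "\<dots> = (LINT x|circle. of_real (moment m) * (of_real (v x * v (frac (x + real n * \<alpha>))) * ?\<Gamma> x ^ m))"
  proof (rule Bochner_Integration.integral_cong[OF refl])
    fix x assume "x \<in> space circle"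
    hence x: "x \<in> {0..<1}" by simp
    show "(LINT g|\<mu>. ?F ((?S ^^ n) (x, g)) * cnj (?F (x, g))) = of_real (moment m) * (of_real (v x * v (frac (x + real n * \<alpha>))) * ?\<Gamma> x ^ m)"
    proof (cases "v x = 0")
      case True
      thus ?thesis by (simp add: packet_def)
    next
      case False
      have ns: "norm (sec e x) = 1" by (rule sec[OF False])
      have "?F ((?S ^^ n) (x, g)) * cnj (?F (x, g)) = of_real (v x * v (frac (x + real n * \<alpha>))) * ?\<Gamma> x ^ m * of_real (cmod ((g *v sec e x) $ 1) ^ (2 * m))" for g
      proof -
        have "(g ** \<Phi> n x) *v sec e (frac (x + real n * \<alpha>)) = g *v (\<Phi> n x *v sec e (x + real n * \<alpha>))"
          by (simp add: sec_frac matrix_vector_mul_assoc)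
        also have "\<dots> = ?\<Gamma> x *s (g *v sec e x)"
          by (subst \<Phi>_sec[OF ns]) (simp only: smult_mat2_vec)
        finally have "?F ((?S ^^ n) (x, g)) = of_real (v (frac (x + real n * \<alpha>))) * (?\<Gamma> x * (g *v sec e x) $ 1) ^ m"
          by (simp add: packet_def skew_funpow[OF x])
        moreover have "complex_of_real (cmod z ^ (2 * m)) = z ^ m * cnj (z ^ m)" for z
        proof -
          have "cmod z ^ (2 * m) = (cmod (z ^ m))\<^sup>2" by (simp add: norm_power power_mult[symmetric] mult.commute)
          thus ?thesis by (simp only: complex_norm_square)
        qed
        ultimately show ?thesis by (simp add: packet_def power_mult_distrib mult_ac del: of_real_power)
      qed
      hence "(LINT g|\<mu>. ?F ((?S ^^ n) (x, g)) * cnj (?F (x, g)))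
        = of_real (v x * v (frac (x + real n * \<alpha>))) * ?\<Gamma> x ^ m * (LINT g|\<mu>. complex_of_real (cmod ((g *v sec e x) $ 1) ^ (2 * m)))"
        by (simp only: integral_mult_right_zero)
      also have "(LINT g|\<mu>. complex_of_real (cmod ((g *v sec e x) $ 1) ^ (2 * m))) = of_real (moment m)"
        by (simp only: integral_complex_of_real moment_unit_vector[OF ns])
      finally show ?thesis by (simp only: mult_ac)
    qed
  qed
  also have "\<dots> = of_real (moment m) * (LINT x|circle. of_real (v x * v (frac (x + real n * \<alpha>))) * ?\<Gamma> x ^ m)"
    by (rule integral_mult_right_zero)
  finally show ?thesis .
qed

theorem lebesgue_multiplicity:
  "lebesgue_countable_multiplicity (circle \<Otimes>\<^sub>M \<mu>) (koopman (circle \<Otimes>\<^sub>M \<mu>) (skew_product (**) \<alpha> \<phi>))"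
proof (rule Sk.lebesgue_countable_multiplicity_of_packets)
  fix \<epsilon> :: real assume \<epsilon>: "\<epsilon> > 0"
  obtain N v e where vm: "v \<in> borel_measurable borel" and v: "\<And>x. 0 \<le> v x" "\<And>x. v x \<le> 1"
    and pos: "0 < (LINT x|circle. (v x)\<^sup>2)" and sec: "\<And>x. v x \<noteq> 0 \<Longrightarrow> norm (sec e x) = 1"
    and decay: "\<And>m n. m \<ge> N \<Longrightarrow> n \<ge> 1 \<Longrightarrow>
      cmod (LINT x|circle. of_real (v x * v (frac (x + real n * \<alpha>))) * cin (\<Phi> n x *v sec e (x + real n * \<alpha>)) (sec e x) ^ m)
        \<le> \<epsilon> * (LINT x|circle. (v x)\<^sup>2) / real n"
    by (rule localized_correlation_decay[OF \<epsilon>]) (rule that; assumption)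
  note corr = corr_packet[OF vm v sec]
  \<comment> \<open>The case n = 0 of \<open>corr_packet\<close>. The moment occurs in this norm and
    in all correlations alike, so it does not matter how small it is for large m.\<close>
  have sq: "(\<integral>y. (cmod (packet v e m y))\<^sup>2 \<partial>(circle \<Otimes>\<^sub>M \<mu>)) = moment m * (LINT x|circle. (v x)\<^sup>2)" for m
  proof -
    have "complex_of_real (\<integral>y. (cmod (packet v e m y))\<^sup>2 \<partial>(circle \<Otimes>\<^sub>M \<mu>))
      = of_real (moment m) * (LINT x|circle. of_real (v x * v (frac (x + real 0 * \<alpha>))) * cin (\<Phi> 0 x *v sec e (x + real 0 * \<alpha>)) (sec e x) ^ m)"
      unfolding Sk.corr_0[symmetric] by (rule corr)
    also have "(LINT x|circle. of_real (v x * v (frac (x + real 0 * \<alpha>))) * cin (\<Phi> 0 x *v sec e (x + real 0 * \<alpha>)) (sec e x) ^ m)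
      = (LINT x|circle. complex_of_real ((v x)\<^sup>2))"
    proof (rule Bochner_Integration.integral_cong[OF refl])
      fix x assume "x \<in> space circle"
      hence "frac x = x" by (simp add: frac_eq)
      thus "of_real (v x * v (frac (x + real 0 * \<alpha>))) * cin (\<Phi> 0 x *v sec e (x + real 0 * \<alpha>)) (sec e x) ^ m = complex_of_real ((v x)\<^sup>2)"
        using sec[of x] by (cases "v x = 0") (simp_all add: cin_self power2_eq_square)
    qed
    also have "\<dots> = of_real (LINT x|circle. (v x)\<^sup>2)" by (rule integral_complex_of_real)
    finally show ?thesis by (simp only: of_real_mult[symmetric] of_real_eq_iff)
  qed
  show "\<exists>N. \<forall>m\<ge>N. \<exists>F. Sk.equivariant_packet \<epsilon> m F"
  proof (intro exI allI impI)
    fix m assume m: "N \<le> m"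
    show "Sk.equivariant_packet \<epsilon> m (packet v e m)"
      unfolding Sk.equivariant_packet_def
    proof (intro conjI ballI allI impI)
      show "packet v e m \<in> borel_measurable (circle \<Otimes>\<^sub>M \<mu>)" by (rule packet_measurable[OF vm])
      show "cmod (packet v e m y) \<le> 1" if "y \<in> space (circle \<Otimes>\<^sub>M \<mu>)" for y by (rule packet_bound[OF v that])
      show "packet v e m (left_torus u y) = u ^ m * packet v e m y" for u y
        by (cases y) (simp add: packet_def left_torus_def torus_mat_entry power_mult_distrib)
      show "0 < (\<integral>y. (cmod (packet v e m y))\<^sup>2 \<partial>(circle \<Otimes>\<^sub>M \<mu>))"
        unfolding sq using pos moment_pos by simp
      fix n :: nat assume n: "1 \<le> n"
      have "cmod (Sk.corr (packet v e m) n) \<le> moment m * (\<epsilon> * (LINT x|circle. (v x)\<^sup>2) / real n)"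
        using mult_left_mono[OF decay[OF m n], of "moment m"] moment_pos[of m]
        by (subst corr) (simp_all add: norm_mult)
      thus "cmod (Sk.corr (packet v e m) n) \<le> \<epsilon> * (\<integral>y. (cmod (packet v e m y))\<^sup>2 \<partial>(circle \<Otimes>\<^sub>M \<mu>)) / real n"
        unfolding sq by (simp add: mult_ac)
    qed
  qed
qed

end

subsection \<open>Ergodicity of the rotation\<close>

text \<open>A measurable function is almost everywhere a limit of continuous ones; clipping them to
  [0,1] allows dominated convergence.\<close>

lemma indicator_approx_continuous:
  assumes A: "A \<in> sets borel" and "\<epsilon> > 0"
  obtains g :: "real \<Rightarrow> real" where "continuous_on UNIV g" "\<And>x. 0 \<le> g x \<and> g x \<le> 1"
    "(LINT x|circle. \<bar>indicator A x - g x\<bar>) < \<epsilon>"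
proof -
  have "(indicator A :: real \<Rightarrow> real) \<in> borel_measurable lebesgue"
    by (rule measurable_completion) (use A in simp)
  hence "(indicator A :: real \<Rightarrow> real) measurable_on UNIV"
    by (rule lebesgue_measurable_imp_measurable_on_nnreal_UNIV) simp
  then obtain N G where N: "negligible N" and G: "\<And>n. continuous_on UNIV (G n)"
    and lim: "\<And>x. x \<notin> N \<Longrightarrow> (\<lambda>n. G n x :: real) \<longlonglongrightarrow> indicator A x"
    unfolding measurable_on_def by auto
  define g where "g n x = max 0 (min 1 (G n x))" for n and x :: real
  have gc: "continuous_on UNIV (g n)" for n unfolding g_def[abs_def] by (intro continuous_intros G)
  have gb: "0 \<le> g n x" "g n x \<le> 1" for n x by (auto simp: g_def)
  have "AE x in lebesgue. x \<notin> N" using N by (auto simp: negligible_iff_null_sets intro: AE_not_in)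
  hence "AE x in lborel. x \<notin> N" by (simp add: AE_completion_iff)
  hence AEN: "AE x in circle. x \<notin> N"
    unfolding circle_def by (subst AE_restrict_space_iff) auto
  have [measurable]: "(indicator A :: real \<Rightarrow> real) \<in> borel_measurable circle"
    by (intro borel_measurable_circle) (use A in simp)
  have [measurable]: "g n \<in> borel_measurable circle" for n
    by (intro borel_measurable_circle borel_measurable_continuous_onI gc)
  have "(\<lambda>n. LINT x|circle. \<bar>indicator A x - g n x\<bar>) \<longlonglongrightarrow> (LINT x|circle. 0)"
  proof (rule integral_dominated_convergence[where w="\<lambda>_. 1"])
    show "integrable circle (\<lambda>_. 1 :: real)" by (rule integrable_circle_bounded) auto
    show "AE x in circle. (\<lambda>n. \<bar>indicator A x - g n x\<bar>) \<longlonglongrightarrow> 0"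
      using AEN
    proof eventually_elim
      case (elim x)
      have "(\<lambda>n. \<bar>indicator A x - g n x\<bar>) \<longlonglongrightarrow> \<bar>indicator A x - max 0 (min 1 (indicator A x))\<bar>"
        unfolding g_def by (intro tendsto_intros lim elim)
      thus ?case by (simp add: indicator_def split: if_splits)
    qed
    show "AE x in circle. norm \<bar>indicator A x - g n x\<bar> \<le> 1" for n
    proof (rule AE_I2)
      fix x show "norm \<bar>indicator A x - g n x\<bar> \<le> 1"
        using gb[of n x] by (cases "x \<in> A") auto
    qed
  qed measurable
  hence "\<forall>\<^sub>F n in sequentially. (LINT x|circle. \<bar>indicator A x - g n x\<bar>) < \<epsilon>"
    using \<open>\<epsilon> > 0\<close> by (intro order_tendstoD(2)) auto
  then obtain n where "(LINT x|circle. \<bar>indicator A x - g n x\<bar>) < \<epsilon>" by (auto simp: eventually_sequentially)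
  thus thesis using that[of "g n"] gc gb by auto
qed

lemma integral_circle_rot:
  fixes f :: "real \<Rightarrow> 'b::{banach,second_countable_topology}"
  assumes "f \<in> borel_measurable circle"
  shows "(LINT x|circle. f (rot t x)) = (LINT x|circle. f x)"
  using integral_distr[OF rot_measurable assms, of t] by (simp add: distr_rot)

lemma AE_circle_rot: "AE x in circle. P x \<Longrightarrow> AE x in circle. P (rot t x)"
  by (rule AE_distrD[OF rot_measurable[of t]]) (simp only: distr_rot)

lemma rot_add: "rot (s + t) x = rot t (rot s x)"
proof -
  have "frac (frac (x + s) + t) = frac (x + s + t)" by (simp only: frac_add_simps)
  thus ?thesis by (simp add: rot_def add.assoc)
qed

text \<open>The point 0 is excluded, since small negative t send it to the other end of the
  fundamental domain.\<close>

lemma rot_tendsto: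
  assumes "t \<longlonglongrightarrow> 0" "0 < x" "x < 1"
  shows "(\<lambda>n. rot (t n) x) \<longlonglongrightarrow> x"
proof -
  have l: "(\<lambda>n. x + t n) \<longlonglongrightarrow> x + 0" by (intro tendsto_intros assms(1))
  have "\<forall>\<^sub>F n in sequentially. 0 < x + t n" "\<forall>\<^sub>F n in sequentially. x + t n < 1"
    using order_tendstoD[OF l] assms by auto
  hence "\<forall>\<^sub>F n in sequentially. x + t n = rot (t n) x"
    by eventually_elim (simp add: rot_def frac_eq)
  with l show ?thesis by (simp add: tendsto_cong)
qed

text \<open>The displacement of a set under the rotation by \<open>t\<close> is continuous in \<open>t\<close>; for an
  invariant set it also has the period \<open>\<alpha>\<close>, hence it vanishes for all \<open>t\<close>.\<close>
lemma rot_ergodic: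
  assumes irr: "\<alpha> \<notin> \<rat>" and A: "A \<in> sets circle" and inv: "AE x in circle. rot \<alpha> x \<in> A \<longleftrightarrow> x \<in> A"
  shows "measure circle A = 0 \<or> measure circle A = 1"
proof -
  interpret prob_space circle by (rule prob_space_circle)
  interpret P: pair_sigma_finite circle circle ..
  interpret PP: pair_prob_space circle circle ..
  define f where "f = (indicator A :: real \<Rightarrow> real)"
  have Ab: "A \<in> sets borel" by (rule sets_circle_borel[OF A])
  have fb: "f \<in> borel_measurable borel" unfolding f_def using Ab by simp
  have fm [measurable]: "f \<in> borel_measurable circle" by (rule borel_measurable_circle[OF fb])
  have frm [measurable]: "(\<lambda>x. f (rot t x)) \<in> borel_measurable circle" for t
    by (rule measurable_compose[OF rot_measurable fm])
  have f01: "\<bar>f x - f y\<bar> \<le> 1" for x y by (auto simp: f_def indicator_def)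
  have int: "integrable circle (\<lambda>x. \<bar>f (rot t x) - f (rot s x)\<bar>)" for s t
    by (rule integrable_circle_bounded[of _ 1]) (measurable, use f01 in simp)
  have int': "integrable circle (\<lambda>x. \<bar>f (rot t x) - f x\<bar>)" for t
    by (rule integrable_circle_bounded[of _ 1]) (measurable, use f01 in simp)
  define h where "h t = (LINT x|circle. \<bar>f (rot t x) - f x\<bar>)" for t
  have h1: "h (t + 1) = h t" for t
  proof -
    have "rot (t + 1) x = rot t x" for x
      unfolding rot_def using frac_add_of_int_right[of "x + t" 1] by (simp add: add.assoc)
    thus ?thesis by (simp add: h_def)
  qed
  have h\<alpha>: "h (t + \<alpha>) = h t" for t
    unfolding h_def
  proof (rule integral_cong_AE)
    show "AE x in circle. \<bar>f (rot (t + \<alpha>) x) - f x\<bar> = \<bar>f (rot t x) - f x\<bar>"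
      using AE_circle_rot[OF inv, of t] by eventually_elim (simp add: rot_add f_def indicator_def)
  qed measurable
  \<comment> \<open>By invariance of the measure, continuity of h everywhere follows from continuity
    at 0.\<close>
  have hd: "\<bar>h t - h s\<bar> \<le> h (t - s)" for t s
  proof -
    have "h t - h s = (LINT x|circle. \<bar>f (rot t x) - f x\<bar> - \<bar>f (rot s x) - f x\<bar>)"
      unfolding h_def using int' by simp
    also have "\<bar>\<dots>\<bar> \<le> (LINT x|circle. \<bar>f (rot t x) - f (rot s x)\<bar>)"
      by (rule order_trans[OF integral_abs_bound integral_mono]) (use int int' in \<open>auto simp del: integral_diff\<close>)
    also have "\<dots> = (LINT x|circle. (\<lambda>y. \<bar>f (rot (t - s) y) - f y\<bar>) (rot s x))"
      using rot_add[of s "t - s"] by simp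
    also have "\<dots> = h (t - s)"
      unfolding h_def by (rule integral_circle_rot) measurable
    finally show ?thesis .
  qed
  have h0: "h 0 = 0"
  proof -
    have "h 0 = (LINT x|circle. 0)"
      unfolding h_def by (rule Bochner_Integration.integral_cong) (auto simp: rot_def frac_eq)
    thus ?thesis by simp
  qed
  have hlim: "(\<lambda>n. h (t n)) \<longlonglongrightarrow> 0" if t: "t \<longlonglongrightarrow> 0" for t
  proof (rule LIMSEQ_I)
    fix e :: real assume e: "0 < e"
    hence e4: "e / 4 > 0" by simp
    obtain g where g: "continuous_on UNIV g" "\<And>x. 0 \<le> g x \<and> g x \<le> 1" "(LINT x|circle. \<bar>indicator A x - g x\<bar>) < e / 4"
      by (rule indicator_approx_continuous[OF Ab e4]) (rule that; assumption)
    have gm [measurable]: "g \<in> borel_measurable circle"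
      by (intro borel_measurable_circle borel_measurable_continuous_onI g)
    have grm [measurable]: "(\<lambda>x. g (rot t x)) \<in> borel_measurable circle" for t
      by (rule measurable_compose[OF rot_measurable gm])
    have gg: "\<bar>g x - g y\<bar> \<le> 1" "\<bar>f x - g y\<bar> \<le> 1" for x y
      using g(2)[of x] g(2)[of y] by (auto simp: f_def indicator_def)
    have "(\<lambda>n. LINT x|circle. \<bar>g (rot (t n) x) - g x\<bar>) \<longlonglongrightarrow> (LINT x|circle. 0)"
    proof (rule integral_dominated_convergence[where w="\<lambda>_. 1"])
      have "AE x in lborel. x \<noteq> (0::real)" by (rule AE_lborel_singleton)
      hence "AE x in circle. x \<noteq> 0" unfolding circle_def by (subst AE_restrict_space_iff) auto
      thus "AE x in circle. (\<lambda>n. \<bar>g (rot (t n) x) - g x\<bar>) \<longlonglongrightarrow> 0"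
        using AE_space
      proof eventually_elim
        case (elim x)
        hence "(\<lambda>n. rot (t n) x) \<longlonglongrightarrow> x" by (intro rot_tendsto t) auto
        hence "(\<lambda>n. g (rot (t n) x)) \<longlonglongrightarrow> g x"
          using continuous_on_tendsto_compose[OF g(1)] by auto
        hence "(\<lambda>n. \<bar>g (rot (t n) x) - g x\<bar>) \<longlonglongrightarrow> \<bar>g x - g x\<bar>" by (intro tendsto_intros)
        thus ?case by simp
      qed
    qed (use gg in auto)
    hence "\<forall>\<^sub>F n in sequentially. (LINT x|circle. \<bar>g (rot (t n) x) - g x\<bar>) < e / 4"
      using e4 by (intro order_tendstoD(2)) auto
    then obtain n0 where n0: "\<And>n. n \<ge> n0 \<Longrightarrow> (LINT x|circle. \<bar>g (rot (t n) x) - g x\<bar>) < e / 4"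
      unfolding eventually_sequentially by blast
    have "norm (h (t n) - 0) < e" if n: "n \<ge> n0" for n
    proof -
      have i1: "integrable circle (\<lambda>x. \<bar>f (rot (t n) x) - g (rot (t n) x)\<bar>)" "integrable circle (\<lambda>x. \<bar>g (rot (t n) x) - g x\<bar>)"
        "integrable circle (\<lambda>x. \<bar>f x - g x\<bar>)"
        by (rule integrable_circle_bounded[of _ 1]; measurable; use gg in simp)+
      have "h (t n) \<le> (LINT x|circle. \<bar>f (rot (t n) x) - g (rot (t n) x)\<bar> + (\<bar>g (rot (t n) x) - g x\<bar> + \<bar>f x - g x\<bar>))"
        unfolding h_def by (rule integral_mono) (use i1 int' in auto)
      also have "\<dots> = (LINT x|circle. (\<lambda>y. \<bar>f y - g y\<bar>) (rot (t n) x)) + ((LINT x|circle. \<bar>g (rot (t n) x) - g x\<bar>) + (LINT x|circle. \<bar>f x - g x\<bar>))"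
        using i1 by simp
      also have "(LINT x|circle. (\<lambda>y. \<bar>f y - g y\<bar>) (rot (t n) x)) = (LINT x|circle. \<bar>f x - g x\<bar>)"
        by (rule integral_circle_rot) measurable
      finally have "h (t n) < e" using g(3) n0[OF n] e by (simp add: f_def)
      moreover have "h (t n) \<ge> 0" by (simp add: h_def)
      ultimately show ?thesis by simp
    qed
    thus "\<exists>n0. \<forall>n\<ge>n0. norm (h (t n) - 0) < e" by blast
  qed
  have "continuous_on UNIV h"
    unfolding continuous_on_sequentially
  proof (intro allI ballI impI)
    fix t s assume "(\<forall>n. t n \<in> UNIV) \<and> t \<longlonglongrightarrow> (s :: real)"
    hence "(\<lambda>n. t n - s) \<longlonglongrightarrow> s - s" by (intro tendsto_intros) auto
    hence "(\<lambda>n. h (t n - s)) \<longlonglongrightarrow> 0" by (intro hlim) simp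
    hence "(\<lambda>n. h (t n) - h s) \<longlonglongrightarrow> 0"
      by (rule Lim_null_comparison[rotated]) (use hd in auto)
    thus "(h \<circ> t) \<longlonglongrightarrow> h s" by (simp add: o_def LIM_zero_iff)
  qed
  hence hz: "h t = 0" for t
    using periodic_continuous_constant[OF irr, of h t 0] h1 h\<alpha> h0 by simp
  define m where "m = measure circle A"
  have fi: "integrable circle f" by (rule integrable_circle_bounded[OF fm, of 1]) (auto simp: f_def indicator_def)
  have "(LINT x|circle. f x) = m" unfolding f_def m_def using A sets.sets_into_space[OF A] by (simp add: Int_absorb2 del: space_circle)
  note fm' = this
  \<comment> \<open>Averaging over the angle makes the rotated point uniformly distributed, since
    \<open>rot t x\<close> = \<open>rot x t\<close>. Integrating over x as well gives 2 m (1 - m),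
    while the integral of h is zero.\<close>
  have inner: "(LINT t|circle. \<bar>f (rot t x) - f x\<bar>) = m + f x * (1 - 2 * m)" for x
  proof -
    have "(LINT t|circle. \<bar>f (rot t x) - f x\<bar>) = (LINT t|circle. (\<lambda>y. \<bar>f y - f x\<bar>) (rot x t))"
      by (simp add: rot_def add.commute)
    also have "\<dots> = (LINT t|circle. \<bar>f t - f x\<bar>)" by (rule integral_circle_rot) measurable
    also have "\<dots> = (LINT t|circle. f t + f x * (1 - 2 * f t))"
      by (rule Bochner_Integration.integral_cong) (auto simp: f_def indicator_def)
    also have "\<dots> = m + f x * (1 - 2 * m)" using fi fm' prob_space by simp
    finally show ?thesis .
  qed
  have "0 = (LINT t|circle. h t)" by (simp add: hz)
  also have "\<dots> = (LINT x|circle. LINT t|circle. \<bar>f (rot t x) - f x\<bar>)"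
    unfolding h_def
  proof (rule P.Fubini_integral[symmetric])
    have "(\<lambda>y. rot (fst y) (snd y)) \<in> borel_measurable (circle \<Otimes>\<^sub>M circle)"
    proof -
      have 1: "(\<lambda>x. x) \<in> borel_measurable circle" by (rule borel_measurable_circle) simp
      have [measurable]: "fst \<in> borel_measurable (circle \<Otimes>\<^sub>M circle)" "snd \<in> borel_measurable (circle \<Otimes>\<^sub>M circle)"
        using measurable_compose[OF measurable_fst 1] measurable_compose[OF measurable_snd 1] by auto
      show ?thesis unfolding rot_def frac_def by measurable
    qed
    from measurable_compose[OF this fb]
    have "(\<lambda>y. f (rot (fst y) (snd y))) \<in> borel_measurable (circle \<Otimes>\<^sub>M circle)" .
    moreover have "(\<lambda>y. f (snd y)) \<in> borel_measurable (circle \<Otimes>\<^sub>M circle)" by measurable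
    ultimately have "(\<lambda>y. \<bar>f (rot (fst y) (snd y)) - f (snd y)\<bar>) \<in> borel_measurable (circle \<Otimes>\<^sub>M circle)" by measurable
    thus "integrable (circle \<Otimes>\<^sub>M circle) (\<lambda>(t, x). \<bar>f (rot t x) - f x\<bar>)"
      by (intro PP.P.integrable_const_bound[of _ 1]) (use f01 in \<open>auto simp: split_beta\<close>)
  qed
  also have "\<dots> = m + m * (1 - 2 * m)" unfolding inner using fi fm' prob_space by simp
  finally have "m * (1 - m) = 0" by (simp add: algebra_simps)
  thus ?thesis by (auto simp: m_def)
qed

subsection \<open>The circle extension\<close>

lemma rot_frac: "rot \<alpha> (frac (x + real n * \<alpha>)) = frac (x + real (Suc n) * \<alpha>)"
  unfolding rot_def by (simp add: frac_add_simps algebra_simps)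

text \<open>\<open>\<sigma>\<close> is a unit section with multiplier \<open>\<gamma>\<close> or its
  conjugate, as supplied by the transfer function. \<open>proj\<close> says that it is almost
  nowhere orthogonal to the eigenline; the comparison with \<open>sec e\<close> uses only the phase
  of their inner product, so this is the form in which the link between the two is assumed.\<close>

locale circle_skew_product = positive_degree_cocycle \<alpha> \<phi> for \<alpha> \<phi> +
  fixes \<nu> :: "complex measure" and \<gamma> :: "real \<Rightarrow> complex" and \<sigma> :: "real \<Rightarrow> complex ^ 2" and b :: bool
  assumes haar: "normalized_haar (*) (sphere 0 1) \<nu>"
    and \<gamma>: "\<gamma> \<in> measurable circle (restrict_space borel (sphere 0 1))"
    and \<sigma>: "\<sigma> \<in> borel_measurable circle" "\<And>x. x \<in> {0..<1} \<Longrightarrow> norm (\<sigma> x) = 1"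
    and \<phi>_\<sigma>: "AE x in circle. \<phi> x *v \<sigma> (rot \<alpha> x) = (if b then \<gamma> x else cnj (\<gamma> x)) *s \<sigma> x"
    and proj: "AE x in circle. eig_proj d (\<sigma> x) (\<psi> x) \<noteq> 0"
begin

text \<open>The flag \<open>b\<close> tells whether \<open>\<gamma>\<close> or its conjugate occurs as the eigenvalue.\<close>
definition br :: "complex \<Rightarrow> complex" where "br z = (if b then z else cnj z)"

lemma br_mult: "br (z * w) = br z * br w" by (simp add: br_def)
lemma br_norm: "cmod (br z) = cmod z" by (simp add: br_def)
lemma br_br: "br (br z) = z" by (simp add: br_def)
sublocale prob_space \<nu>
  using haar by (intro prob_spaceI) (simp add: normalized_haar_def)

lemma sets_\<nu>: "sets \<nu> = sets (restrict_space borel (sphere 0 1))"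
  using haar by (simp add: normalized_haar_def)

lemma space_\<nu> [simp]: "space \<nu> = sphere 0 1"
  using sets_eq_imp_space_eq[OF sets_\<nu>] by (simp add: space_restrict_space)

lemma left_invariant: "cmod k = 1 \<Longrightarrow> distr \<nu> \<nu> ((*) k) = \<nu>"
  using haar by (simp add: normalized_haar_def)

lemma measurable_to_\<nu>:
  assumes "f \<in> borel_measurable M" "\<And>y. y \<in> space M \<Longrightarrow> cmod (f y) = 1"
  shows "f \<in> measurable M \<nu>"
proof -
  have "f \<in> measurable M (restrict_space borel (sphere 0 1))"
    using assms by (intro measurable_restrict_space2) auto
  thus ?thesis using measurable_cong_sets[OF refl sets_\<nu>] by blast
qed

lemma id_\<nu>: "(\<lambda>z. z) \<in> borel_measurable \<nu>"
  using measurable_restrict_space1[of "\<lambda>z. z" borel borel "sphere 0 1"] measurable_cong_sets[OF sets_\<nu> refl] by auto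

lemma \<gamma>_norm: "x \<in> {0..<1} \<Longrightarrow> cmod (\<gamma> x) = 1"
  using measurable_space[OF \<gamma>, of x] by (simp add: space_restrict_space)

lemma \<gamma>_borel: "\<gamma> \<in> borel_measurable circle"
  using \<gamma> by (rule measurable_restrict_space2_iff[THEN iffD1, THEN conjunct1])

definition "skew_inv = (\<lambda>(x, z). (rot (- \<alpha>) x, z * cnj (\<gamma> (rot (- \<alpha>) x))))"

text \<open>With \<open>br u\<close> the packets, which contain \<open>br z\<close>, get the weight
  u^m for either value of the flag.\<close>

definition "rotate_fibre u = (\<lambda>(x :: real, z). (x, br u * z))"

lemma symmetric_automorphism:
  "circle_symmetric_automorphism (circle \<Otimes>\<^sub>M \<nu>) (skew_product (*) \<alpha> \<gamma>) skew_inv rotate_fibre"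
proof -
  have m: "(\<lambda>(x, z). z * f x) \<in> measurable (circle \<Otimes>\<^sub>M \<nu>) \<nu>"
    if f: "f \<in> borel_measurable circle" "\<And>x. x \<in> space circle \<Longrightarrow> cmod (f x) = 1" for f
    by (rule measurable_to_\<nu>, unfold split_beta)
       (intro borel_measurable_times measurable_compose[OF measurable_fst f(1)] measurable_compose[OF measurable_snd id_\<nu>],
        use f(2) in \<open>auto simp: space_pair_measure norm_mult simp del: space_circle\<close>)
  have F1: "(\<lambda>(x, z). z * \<gamma> x) \<in> measurable (circle \<Otimes>\<^sub>M \<nu>) \<nu>"
    by (rule m[OF \<gamma>_borel]) (simp add: \<gamma>_norm)
  have F2: "(\<lambda>(x, z). z * cnj (\<gamma> (rot (- \<alpha>) x))) \<in> measurable (circle \<Otimes>\<^sub>M \<nu>) \<nu>"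
    by (rule m) (use borel_measurable_cnj[OF measurable_compose[OF rot_measurable \<gamma>_borel]] in \<open>auto simp: \<gamma>_norm[OF rot_space]\<close>)
  have F3: "(\<lambda>(x, z). br u * z) \<in> measurable (circle \<Otimes>\<^sub>M \<nu>) \<nu>" if "cmod u = 1" for u
    by (rule measurable_to_\<nu>, unfold split_beta)
       (intro borel_measurable_times borel_measurable_const measurable_compose[OF measurable_snd id_\<nu>],
        use that in \<open>auto simp: space_pair_measure norm_mult br_norm\<close>)
  have idc: "(\<lambda>x. x) \<in> measurable circle circle" by simp
  have P: "prob_space (circle \<Otimes>\<^sub>M \<nu>)"
  proof -
    interpret C: prob_space circle by (rule prob_space_circle)
    interpret PP: pair_prob_space circle \<nu> ..
    show ?thesis by (rule PP.P.prob_space_axioms)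
  qed
  have sk: "skew_product (*) \<alpha> \<gamma> = (\<lambda>(x, z). (rot \<alpha> x, z * \<gamma> x))" by (simp add: skew_product_def)
  have g1: "\<gamma> x * cnj (\<gamma> x) = 1" if "x \<in> {0..<1}" for x
    using complex_norm_square[of "\<gamma> x"] \<gamma>_norm[OF that] by simp
  show ?thesis
  proof (intro circle_symmetric_automorphism.intro[OF P] circle_symmetric_automorphism_axioms.intro)
    show "skew_product (*) \<alpha> \<gamma> \<in> measurable (circle \<Otimes>\<^sub>M \<nu>) (circle \<Otimes>\<^sub>M \<nu>)"
      unfolding sk by (rule fibre_measurable[OF rot_measurable F1])
    show "skew_inv \<in> measurable (circle \<Otimes>\<^sub>M \<nu>) (circle \<Otimes>\<^sub>M \<nu>)"
      unfolding skew_inv_def by (rule fibre_measurable[OF rot_measurable F2])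
    show "distr (circle \<Otimes>\<^sub>M \<nu>) (circle \<Otimes>\<^sub>M \<nu>) (skew_product (*) \<alpha> \<gamma>) = circle \<Otimes>\<^sub>M \<nu>"
      unfolding sk
    proof (rule distr_fibre_preserving[OF prob_space_circle prob_space_axioms rot_measurable distr_rot F1])
      fix x assume "x \<in> space circle"
      hence "cmod (\<gamma> x) = 1" by (simp add: \<gamma>_norm)
      moreover have "(\<lambda>z. z * \<gamma> x) = (*) (\<gamma> x)" by (simp add: fun_eq_iff mult.commute)
      ultimately show "distr \<nu> \<nu> (\<lambda>z. z * \<gamma> x) = \<nu>" by (simp add: left_invariant)
    qed
    fix u :: complex assume u: "cmod u = 1"
    show "rotate_fibre u \<in> measurable (circle \<Otimes>\<^sub>M \<nu>) (circle \<Otimes>\<^sub>M \<nu>)"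
      unfolding rotate_fibre_def by (rule fibre_measurable[OF idc F3[OF u]])
    show "distr (circle \<Otimes>\<^sub>M \<nu>) (circle \<Otimes>\<^sub>M \<nu>) (rotate_fibre u) = circle \<Otimes>\<^sub>M \<nu>"
      unfolding rotate_fibre_def
      by (rule distr_fibre_preserving[OF prob_space_circle prob_space_axioms idc _ F3[OF u]])
         (simp_all add: distr_id2 left_invariant br_norm u)
  next
    fix y assume y: "y \<in> space (circle \<Otimes>\<^sub>M \<nu>)"
    show "skew_inv (skew_product (*) \<alpha> \<gamma> y) = y" "skew_product (*) \<alpha> \<gamma> (skew_inv y) = y"
      using y g1 g1[OF rot_space, of "- \<alpha>"]
      by (auto simp: space_pair_measure skew_inv_def sk rot_inverse mult.assoc mult.commute[of "cnj _" "\<gamma> _"])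
    show "rotate_fibre u (skew_product (*) \<alpha> \<gamma> y) = skew_product (*) \<alpha> \<gamma> (rotate_fibre u y)" for u
      by (cases y) (simp add: rotate_fibre_def sk mult.assoc)
  qed
qed

sublocale Sk: circle_symmetric_automorphism "circle \<Otimes>\<^sub>M \<nu>" "skew_product (*) \<alpha> \<gamma>" skew_inv rotate_fibre
  by (rule symmetric_automorphism)

text \<open>Reduction modulo 1 is explicit here, as \<open>\<gamma>\<close> is meaningful only on
  [0,1), in contrast to the periodic \<open>\<phi>\<close>.\<close>

definition \<gamma>n :: "nat \<Rightarrow> real \<Rightarrow> complex" where
  "\<gamma>n n x = (\<Prod>k<n. \<gamma> (frac (x + real k * \<alpha>)))"

lemma \<gamma>n_norm: "cmod (\<gamma>n n x) = 1"
  unfolding \<gamma>n_def by (simp add: prod_norm[symmetric] \<gamma>_norm frac_lt_1)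

lemma skew_funpow:
  assumes "x \<in> {0..<1}"
  shows "(skew_product (*) \<alpha> \<gamma> ^^ n) (x, z) = (frac (x + real n * \<alpha>), z * \<gamma>n n x)"
proof (induction n)
  case 0
  show ?case using assms by (simp add: frac_eq \<gamma>n_def)
next
  case (Suc n)
  have "skew_product (*) \<alpha> \<gamma> (y, w) = (rot \<alpha> y, w * \<gamma> y)" for y w by (simp add: skew_product_def)
  thus ?case using rot_frac[of \<alpha> x n] by (simp add: Suc.IH \<gamma>n_def mult.assoc)
qed

text \<open>The relation is iterated along the orbit; its exceptional null set is pulled back by the
  rotation at each step.\<close>

lemma \<Phi>_\<sigma>: "AE x in circle. \<Phi> n x *v \<sigma> (frac (x + real n * \<alpha>)) = br (\<gamma>n n x) *s \<sigma> x"
proof (induction n)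
  case 0
  show ?case by (rule AE_I2) (simp add: frac_eq \<gamma>n_def br_def vec_eq_iff)
next
  case (Suc n)
  have "AE x in circle. \<phi> (rot (real n * \<alpha>) x) *v \<sigma> (rot \<alpha> (rot (real n * \<alpha>) x))
      = br (\<gamma> (rot (real n * \<alpha>) x)) *s \<sigma> (rot (real n * \<alpha>) x)"
    using AE_circle_rot[OF \<phi>_\<sigma>, of "real n * \<alpha>"] by (simp add: br_def)
  with Suc AE_space show ?case
  proof eventually_elim
    case (elim x)
    hence x: "x \<in> {0..<1}" by simp
    let ?y = "frac (x + real n * \<alpha>)"
    have "\<Phi> (Suc n) x *v \<sigma> (frac (x + real (Suc n) * \<alpha>)) = \<Phi> n x *v (\<phi> ?y *v \<sigma> (rot \<alpha> ?y))"
      using rot_frac[of \<alpha> x n] by (simp add: matrix_vector_mul_assoc \<phi>_frac)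
    also have "\<phi> ?y *v \<sigma> (rot \<alpha> ?y) = br (\<gamma> ?y) *s \<sigma> ?y" using elim(3) by (simp add: rot_def)
    also have "\<Phi> n x *v (br (\<gamma> ?y) *s \<sigma> ?y) = br (\<gamma> ?y) *s (br (\<gamma>n n x) *s \<sigma> x)"
      unfolding smult_mat2_vec elim(1) ..
    also have "\<dots> = br (\<gamma>n (Suc n) x) *s \<sigma> x"
      by (simp add: \<gamma>n_def br_mult vec_eq_iff mult_ac)
    finally show ?case .
  qed
qed

text \<open>The function whose coboundary relates \<open>\<Gamma>\<close> to
  \<open>br (\<gamma>n n x)\<close>, on points with unit sections where the inner product is
  nonzero.\<close>

definition phase :: "complex ^ 2 \<Rightarrow> real \<Rightarrow> complex" where
  "phase e x = sgn (cin (sec e x) (\<sigma> x))"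

text \<open>A vector orthogonal to the eigenline is an eigenvector for the opposite eigenvalue.\<close>
lemma phase_norm:
  assumes ns: "norm (sec e x) = 1" and p: "eig_proj d (\<sigma> x) (\<psi> x) \<noteq> 0"
  shows "cmod (phase e x) = 1"
proof -
  let ?s = "sec e x" and ?q = "eig_proj d (\<sigma> x) (\<psi> x)"
  have "cin (\<sigma> x) ?s \<noteq> 0"
  proof
    assume 0: "cin (\<sigma> x) ?s = 0"
    have "?q = cin ?q ?s *s ?s"
      by (rule su2_eigenline[OF \<psi>_su2 _ sec_eigenvector eig_proj_eigenvector[OF \<psi>_su2 \<psi>_norm d_pos] ns])
         (use d_pos in simp)
    moreover have "cin ?q ?s = 0"
      by (simp add: eig_proj_def cin_diff_left cin_smult_left cin_su2[OF \<psi>_su2] sec_eigenvector cin_smult_right 0)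
    ultimately show False using p by (simp add: vec_eq_iff)
  qed
  hence "cin ?s (\<sigma> x) \<noteq> 0" by (subst cin_commute) simp
  thus ?thesis by (simp add: phase_def norm_sgn)
qed

lemma phase_le: "cmod (phase e x) \<le> 1" by (simp add: phase_def norm_sgn)

lemma sec_circle: "sec e \<in> borel_measurable circle"
  by (rule borel_measurable_circle[OF sec_measurable])

lemma borel_measurable_cin:
  assumes "f \<in> borel_measurable M" "g \<in> borel_measurable M"
  shows "(\<lambda>x. cin (f x) (g x)) \<in> borel_measurable M"
  by (rule borel_measurable_continuous_Pair[OF assms])
     (intro continuous_on_cin continuous_on_fst continuous_on_snd continuous_on_id)

lemma phase_measurable: "phase e \<in> borel_measurable circle"
proof -
  have [measurable]: "(\<lambda>x. cin (sec e x) (\<sigma> x)) \<in> borel_measurable circle"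
    by (intro borel_measurable_cin sec_circle \<sigma>(1))
  show ?thesis unfolding phase_def[abs_def] sgn_div_norm by measurable
qed

definition packet :: "(real \<Rightarrow> real) \<Rightarrow> complex ^ 2 \<Rightarrow> nat \<Rightarrow> real \<times> complex \<Rightarrow> complex" where
  "packet v e m = (\<lambda>(x, z). of_real (v x) * (br z * phase e x) ^ m)"

lemma packet_measurable:
  assumes "v \<in> borel_measurable borel"
  shows "packet v e m \<in> borel_measurable (circle \<Otimes>\<^sub>M \<nu>)"
proof -
  have [measurable]: "(\<lambda>y. v (fst y)) \<in> borel_measurable (circle \<Otimes>\<^sub>M \<nu>)"
    by (intro measurable_compose[OF measurable_fst] borel_measurable_circle assms)
  have [measurable]: "(\<lambda>y. phase e (fst y)) \<in> borel_measurable (circle \<Otimes>\<^sub>M \<nu>)"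
    by (intro measurable_compose[OF measurable_fst] phase_measurable)
  have 1 [measurable]: "snd \<in> borel_measurable (circle \<Otimes>\<^sub>M \<nu>)"
    by (rule measurable_compose[OF measurable_snd id_\<nu>, simplified])
  have [measurable]: "(\<lambda>y. br (snd y)) \<in> borel_measurable (circle \<Otimes>\<^sub>M \<nu>)"
    unfolding br_def using borel_measurable_cnj[OF 1] 1 by (cases b) simp_all
  show ?thesis unfolding packet_def split_beta by measurable
qed

lemma packet_bound:
  assumes "\<And>x. 0 \<le> v x" "\<And>x. v x \<le> 1" "y \<in> space (circle \<Otimes>\<^sub>M \<nu>)"
  shows "cmod (packet v e m y) \<le> 1"
proof -
  obtain x z where y: "y = (x, z)" "cmod z = 1" using assms(3) by (auto simp: space_pair_measure)
  have "cmod (packet v e m y) = v x * cmod (phase e x) ^ m"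
    using assms(1) y(2) by (simp add: y(1) packet_def norm_mult norm_power br_norm)
  also have "\<dots> \<le> 1" using assms phase_le by (intro mult_le_one power_le_one) auto
  finally show ?thesis .
qed

text \<open>\<open>\<Phi>\<close> preserves \<open>cin\<close>; comparing the inner products of
  \<open>sec e\<close> and \<open>\<sigma>\<close> at both ends of the orbit yields the
  transformation of \<open>phase\<close>, while \<open>sgn\<close> discards their modulus. The
  packet is thus multiplied by \<open>\<Gamma>\<close>^m, and no moment appears because the fibre
  variable is unimodular.\<close>

lemma corr_packet:
  assumes vm: "v \<in> borel_measurable borel"
    and sec: "\<And>x. v x \<noteq> 0 \<Longrightarrow> norm (sec e x) = 1"
  shows "Sk.corr (packet v e m) n =
    (LINT x|circle. of_real (v x * v (frac (x + real n * \<alpha>))) * cin (\<Phi> n x *v sec e (x + real n * \<alpha>)) (sec e x) ^ m)"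
proof -
  let ?S = "skew_product (*) \<alpha> \<gamma>" and ?F = "packet v e m"
  let ?\<Gamma> = "\<lambda>x. cin (\<Phi> n x *v sec e (x + real n * \<alpha>)) (sec e x)"
  let ?G = "\<lambda>x. of_real (v x * v (frac (x + real n * \<alpha>))) * ?\<Gamma> x ^ m"
  note [measurable] = packet_measurable[OF vm, of e m]
  have "AE x in circle. \<forall>z. cmod z = 1 \<longrightarrow> ?F ((?S ^^ n) (x, z)) * cnj (?F (x, z)) = ?G x"
    using \<Phi>_\<sigma>[of n] proj AE_space
  proof eventually_elim
    case (elim x)
    hence x: "x \<in> {0..<1}" by simp
    let ?y = "frac (x + real n * \<alpha>)"
    show ?case
    proof (intro allI impI)
      fix z :: complex assume z: "cmod z = 1"
      have Fx: "?F (x, z) = of_real (v x) * (br z * phase e x) ^ m" by (simp add: packet_def)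
      have FS: "?F ((?S ^^ n) (x, z)) = of_real (v ?y) * (br z * br (\<gamma>n n x) * phase e ?y) ^ m"
        by (simp add: packet_def skew_funpow[OF x] br_mult)
      show "?F ((?S ^^ n) (x, z)) * cnj (?F (x, z)) = ?G x"
      \<comment> \<open>If one end lies outside the support of v, both sides vanish. Otherwise both
        sections are unit vectors, which makes \<open>\<Gamma>\<close> unimodular.\<close>
      proof (cases "v x = 0 \<or> v ?y = 0")
        case True
        thus ?thesis unfolding Fx FS by auto
      next
        case False
        hence ns: "norm (sec e x) = 1" "norm (sec e ?y) = 1" using sec by auto
        have gs: "\<Phi> n x *v sec e ?y = ?\<Gamma> x *s sec e x" using \<Phi>_sec[OF ns(1), of n] by (simp add: sec_frac)
        have "cmod (?\<Gamma> x) * norm (sec e x) = norm (\<Phi> n x *v sec e ?y)" unfolding gs norm_smult_vec2 ..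
        hence G1: "cmod (?\<Gamma> x) = 1" using ns by (simp add: norm_SU2_vec[OF \<Phi>_SU2])
        have bg: "cmod (br (\<gamma>n n x)) = 1" by (simp add: br_norm \<gamma>n_norm)
        have "cin (sec e ?y) (\<sigma> ?y) = cin (\<Phi> n x *v sec e ?y) (\<Phi> n x *v \<sigma> ?y)"
          by (rule cin_SU2[OF \<Phi>_SU2, symmetric])
        also have "\<dots> = ?\<Gamma> x * cnj (br (\<gamma>n n x)) * cin (sec e x) (\<sigma> x)"
          unfolding gs elim(1) by (simp add: cin_smult_left cin_smult_right)
        finally have "phase e ?y = sgn (?\<Gamma> x) * sgn (cnj (br (\<gamma>n n x))) * phase e x"
          by (simp add: phase_def sgn_mult)
        also have "sgn (?\<Gamma> x) = ?\<Gamma> x" using G1 by (simp add: sgn_div_norm)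
        also have "sgn (cnj (br (\<gamma>n n x))) = cnj (br (\<gamma>n n x))" using bg by (simp add: sgn_div_norm)
        finally have ph: "br (\<gamma>n n x) * phase e ?y = (br (\<gamma>n n x) * cnj (br (\<gamma>n n x))) * ?\<Gamma> x * phase e x"
          by (simp only: mult_ac)
        have "br (\<gamma>n n x) * cnj (br (\<gamma>n n x)) = 1" using complex_norm_square[of "br (\<gamma>n n x)"] bg by simp
        hence FS': "?F ((?S ^^ n) (x, z)) = of_real (v ?y) * (?\<Gamma> x * (br z * phase e x)) ^ m"
          unfolding FS using ph by (simp add: mult_ac)
        define w where "w = br z * phase e x"
        have "cmod w = 1" using z phase_norm[OF ns(1) elim(2)] by (simp add: w_def norm_mult br_norm)
        hence "w ^ m * cnj (w ^ m) = 1" using complex_norm_square[of "w ^ m"] by (simp add: norm_power)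
        thus ?thesis unfolding FS' Fx w_def[symmetric] power_mult_distrib by (simp add: mult_ac)
      qed
    qed
  qed
  \<comment> \<open>The exceptional set depends on the base point only, and the product measure
    projects to \<open>circle\<close>.\<close>
  hence "AE y in circle \<Otimes>\<^sub>M \<nu>. \<forall>z. cmod z = 1 \<longrightarrow> ?F ((?S ^^ n) (fst y, z)) * cnj (?F (fst y, z)) = ?G (fst y)"
    by (intro AE_distrD[OF measurable_fst]) (simp only: distr_pair_fst)
  hence AE: "AE y in circle \<Otimes>\<^sub>M \<nu>. ?F ((?S ^^ n) y) * cnj (?F y) = ?G (fst y)"
    using AE_space
  proof eventually_elim
    case (elim y)
    have "cmod (snd y) = 1" using elim(2) by (auto simp: space_pair_measure)
    with elim(1) have "?F ((?S ^^ n) (fst y, snd y)) * cnj (?F (fst y, snd y)) = ?G (fst y)" by blast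
    thus ?case by simp
  qed
  have Gm: "?G \<in> borel_measurable circle"
  proof (rule borel_measurable_circle)
    have [measurable]: "v \<in> borel_measurable borel" by (rule vm)
    have s: "(\<lambda>x. sec e (x + real n * \<alpha>)) \<in> borel_measurable borel"
      by (rule measurable_compose[OF _ sec_measurable]) measurable
    have [measurable]: "?\<Gamma> \<in> borel_measurable borel"
      by (rule borel_measurable_cin[OF borel_measurable_mat2_vec[OF borel_measurable_continuous_onI[OF C2_continuous(1)[OF \<Phi>_C2]] s] sec_measurable])
    have [measurable]: "(\<lambda>x. frac (x + real n * \<alpha>)) \<in> borel_measurable borel" unfolding frac_def by measurable
    have [measurable]: "(\<lambda>x. v (frac (x + real n * \<alpha>))) \<in> borel_measurable borel"
      by (rule measurable_compose[OF _ vm]) measurable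
    show "?G \<in> borel_measurable borel" by measurable
  qed
  have "Sk.corr ?F n = (\<integral>y. ?G (fst y) \<partial>(circle \<Otimes>\<^sub>M \<nu>))"
    unfolding Sk.corr_def
  proof (rule integral_cong_AE)
    show "(\<lambda>y. ?F ((?S ^^ n) y) * cnj (?F y)) \<in> borel_measurable (circle \<Otimes>\<^sub>M \<nu>)" by measurable
    show "(\<lambda>y. ?G (fst y)) \<in> borel_measurable (circle \<Otimes>\<^sub>M \<nu>)"
      by (rule measurable_compose[OF measurable_fst Gm])
  qed (rule AE)
  also have "\<dots> = (\<integral>x. ?G x \<partial>distr (circle \<Otimes>\<^sub>M \<nu>) circle fst)"
    by (rule integral_distr[OF measurable_fst Gm, symmetric])
  also have "\<dots> = (LINT x|circle. ?G x)" by (simp only: distr_pair_fst)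
  finally show ?thesis .
qed

theorem lebesgue_multiplicity:
  "lebesgue_countable_multiplicity (circle \<Otimes>\<^sub>M \<nu>) (koopman (circle \<Otimes>\<^sub>M \<nu>) (skew_product (*) \<alpha> \<gamma>))"
proof (rule Sk.lebesgue_countable_multiplicity_of_packets)
  fix \<epsilon> :: real assume \<epsilon>: "\<epsilon> > 0"
  obtain N v e where vm: "v \<in> borel_measurable borel" and v: "\<And>x. 0 \<le> v x" "\<And>x. v x \<le> 1"
    and pos: "0 < (LINT x|circle. (v x)\<^sup>2)" and sec: "\<And>x. v x \<noteq> 0 \<Longrightarrow> norm (sec e x) = 1"
    and decay: "\<And>m n. m \<ge> N \<Longrightarrow> n \<ge> 1 \<Longrightarrow>
      cmod (LINT x|circle. of_real (v x * v (frac (x + real n * \<alpha>))) * cin (\<Phi> n x *v sec e (x + real n * \<alpha>)) (sec e x) ^ m)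
        \<le> \<epsilon> * (LINT x|circle. (v x)\<^sup>2) / real n"
    by (rule localized_correlation_decay[OF \<epsilon>]) (rule that; assumption)
  note corr = corr_packet[OF vm sec]
  have sq: "(\<integral>y. (cmod (packet v e m y))\<^sup>2 \<partial>(circle \<Otimes>\<^sub>M \<nu>)) = (LINT x|circle. (v x)\<^sup>2)" for m
  proof -
    have "complex_of_real (\<integral>y. (cmod (packet v e m y))\<^sup>2 \<partial>(circle \<Otimes>\<^sub>M \<nu>))
      = (LINT x|circle. of_real (v x * v (frac (x + real 0 * \<alpha>))) * cin (\<Phi> 0 x *v sec e (x + real 0 * \<alpha>)) (sec e x) ^ m)"
      unfolding Sk.corr_0[symmetric] by (rule corr)
    also have "\<dots> = (LINT x|circle. complex_of_real ((v x)\<^sup>2))"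
    proof (rule Bochner_Integration.integral_cong[OF refl])
      fix x assume "x \<in> space circle"
      hence "frac x = x" by (simp add: frac_eq)
      thus "of_real (v x * v (frac (x + real 0 * \<alpha>))) * cin (\<Phi> 0 x *v sec e (x + real 0 * \<alpha>)) (sec e x) ^ m = complex_of_real ((v x)\<^sup>2)"
        using sec[of x] by (cases "v x = 0") (simp_all add: cin_self power2_eq_square)
    qed
    also have "\<dots> = of_real (LINT x|circle. (v x)\<^sup>2)" by (rule integral_complex_of_real)
    finally show ?thesis by (simp only: of_real_eq_iff)
  qed
  show "\<exists>N. \<forall>m\<ge>N. \<exists>F. Sk.equivariant_packet \<epsilon> m F"
  proof (intro exI allI impI)
    fix m assume m: "N \<le> m"
    show "Sk.equivariant_packet \<epsilon> m (packet v e m)"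
      unfolding Sk.equivariant_packet_def
    proof (intro conjI ballI allI impI)
      show "packet v e m \<in> borel_measurable (circle \<Otimes>\<^sub>M \<nu>)" by (rule packet_measurable[OF vm])
      show "cmod (packet v e m y) \<le> 1" if "y \<in> space (circle \<Otimes>\<^sub>M \<nu>)" for y by (rule packet_bound[OF v that])
      show "packet v e m (rotate_fibre u y) = u ^ m * packet v e m y" for u y
        by (cases y) (simp add: packet_def rotate_fibre_def br_mult br_br power_mult_distrib)
      show "0 < (\<integral>y. (cmod (packet v e m y))\<^sup>2 \<partial>(circle \<Otimes>\<^sub>M \<nu>))"
        unfolding sq by (rule pos)
      fix n :: nat assume n: "1 \<le> n"
      show "cmod (Sk.corr (packet v e m) n) \<le> \<epsilon> * (\<integral>y. (cmod (packet v e m y))\<^sup>2 \<partial>(circle \<Otimes>\<^sub>M \<nu>)) / real n"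
        unfolding sq using decay[OF m n] by (subst corr) simp_all
    qed
  qed
qed

end

text \<open>\<open>\<phi>\<close> carries the projected section at \<open>rot \<alpha> x\<close> to
  a nonzero multiple of the one at x. So the set where it is nonzero is invariant, and ergodicity
  decides its measure.\<close>

lemma (in positive_degree_cocycle) eig_proj_rot_AE:
  assumes \<sigma>: "\<sigma> \<in> borel_measurable circle"
    and g: "\<And>x. x \<in> {0..<1} \<Longrightarrow> g x \<noteq> 0"
    and \<phi>_\<sigma>: "AE x in circle. \<phi> x *v \<sigma> (rot \<alpha> x) = g x *s \<sigma> x"
  shows "(AE x in circle. eig_proj d (\<sigma> x) (\<psi> x) \<noteq> 0) \<or> (AE x in circle. eig_proj d (\<sigma> x) (\<psi> x) = 0)"
proof -
  interpret prob_space circle by (rule prob_space_circle)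
  define q where "q x = eig_proj d (\<sigma> x) (\<psi> x)" for x
  define E where "E = {x \<in> space circle. q x \<noteq> 0}"
  have "\<psi> \<in> borel_measurable circle"
    by (intro borel_measurable_circle borel_measurable_continuous_onI \<psi>_cont)
  hence "(\<lambda>x. (\<i> / of_real d) *s (\<psi> x *v \<sigma> x)) \<in> borel_measurable circle"
    by (intro borel_measurable_continuous_on[OF linear_continuous_on[OF bounded_linear_smult_vec2]] borel_measurable_mat2_vec \<sigma>)
  hence qm: "q \<in> borel_measurable circle"
    unfolding q_def[abs_def] eig_proj_def using \<sigma> by (intro borel_measurable_diff)
  have "E = q -` (- {0}) \<inter> space circle" by (auto simp: E_def)
  hence E: "E \<in> sets circle"
    using measurable_sets[OF qm borel_open[OF open_Compl[OF closed_singleton[of 0]]]] by (simp only:)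
  have "AE x in circle. rot \<alpha> x \<in> E \<longleftrightarrow> x \<in> E"
    using \<phi>_\<sigma> AE_space
  proof eventually_elim
    case (elim x)
    have x: "x \<in> {0..<1}" using elim(2) by simp
    have \<psi>r: "\<psi> (rot \<alpha> x) = \<psi> (x + \<alpha>)"
      unfolding rot_def by (rule periodic_frac) (rule \<psi>_periodic)
    have "\<phi> x *v q (rot \<alpha> x) = \<phi> x *v \<sigma> (rot \<alpha> x) - (\<i> / of_real d) *s ((\<phi> x ** \<psi> (x + \<alpha>)) *v \<sigma> (rot \<alpha> x))"
      by (simp add: q_def eig_proj_def \<psi>r matrix_vector_mult_diff_distrib smult_mat2_vec matrix_vector_mul_assoc)
    also have "\<dots> = g x *s \<sigma> x - (\<i> / of_real d) *s (\<psi> x *v (g x *s \<sigma> x))"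
      unfolding \<psi>_\<phi>[symmetric] matrix_vector_mul_assoc[symmetric] elim(1) ..
    also have "\<dots> = g x *s q x"
      by (simp add: q_def eig_proj_def smult_mat2_vec vec_eq_iff algebra_simps)
    finally have eq: "\<phi> x *v q (rot \<alpha> x) = g x *s q x" .
    have "norm (q (rot \<alpha> x)) = cmod (g x) * norm (q x)"
      using norm_SU2_vec[OF \<phi>_SU2, of x "q (rot \<alpha> x)"] unfolding eq norm_smult_vec2 by simp
    hence "q (rot \<alpha> x) = 0 \<longleftrightarrow> q x = 0" using g[OF x] by (metis mult_eq_0_iff norm_eq_zero)
    thus ?case using x rot_space by (simp add: E_def)
  qed
  from rot_ergodic[OF irrational E this] show ?thesis
  proof
    assume "measure circle E = 0"
    hence "E \<in> null_sets circle" using E by (intro null_setsI) (simp_all add: emeasure_eq_measure)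
    hence "AE x in circle. x \<notin> E" by (rule AE_not_in)
    hence "AE x in circle. q x = 0" using AE_space by eventually_elim (simp add: E_def)
    thus ?thesis by (simp add: q_def)
  next
    assume "measure circle E = 1"
    hence "AE x in circle. x \<in> E" by (rule AE_prob_1)
    hence "AE x in circle. q x \<noteq> 0" by eventually_elim (simp add: E_def)
    thus ?thesis by (simp add: q_def)
  qed
qed

text \<open>The columns of the adjoint of p are sections with multipliers \<open>\<gamma>\<close>
  and its conjugate. They span C^2, so at no point are both orthogonal to the eigenline, and by the
  zero-one law one of them is almost nowhere orthogonal.\<close>

lemma (in positive_degree_cocycle) cohomologous_lebesgue_multiplicity:
  assumes haar: "normalized_haar (*) (sphere 0 1) \<nu>"
    and \<gamma>: "\<gamma> \<in> measurable circle (restrict_space borel (sphere 0 1))"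
    and coh: "cohomologous \<alpha> \<phi> (diag_cocycle \<gamma>)"
  shows "lebesgue_countable_multiplicity (circle \<Otimes>\<^sub>M \<nu>) (koopman (circle \<Otimes>\<^sub>M \<nu>) (skew_product (*) \<alpha> \<gamma>))"
proof -
  interpret prob_space circle by (rule prob_space_circle)
  obtain p where p: "p \<in> measurable circle (restrict_space borel SU2)"
    and \<phi>p: "AE x in circle. \<phi> x = matrix_inv (p x) ** diag_cocycle \<gamma> x ** p (rot \<alpha> x)"
    using coh unfolding cohomologous_def by blast
  have pS: "p x \<in> SU2" if "x \<in> {0..<1}" for x
    using measurable_space[OF p, of x] that by (simp add: space_restrict_space)
  have pb: "p \<in> borel_measurable circle"
    using p by (rule measurable_restrict_space2_iff[THEN iffD1, THEN conjunct1])
  have g1: "cmod (\<gamma> x) = 1" if "x \<in> {0..<1}" for x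
    using measurable_space[OF \<gamma>, of x] that by (simp add: space_restrict_space)
  define ix :: "bool \<Rightarrow> 2" where "ix b = (if b then 1 else 2)" for b
  define \<sigma> where "\<sigma> b x = adjoint_mat (p x) *v axis (ix b) 1" for b x
  have \<sigma>m: "\<sigma> b \<in> borel_measurable circle" for b
    unfolding \<sigma>_def[abs_def] by (intro borel_measurable_mat2_vec borel_measurable_adjoint_mat pb borel_measurable_const)
  have \<sigma>n: "norm (\<sigma> b x) = 1" if "x \<in> {0..<1}" for b x
    unfolding \<sigma>_def using norm_SU2_vec[OF SU2_adjoint[OF pS[OF that]]] by (simp add: norm_axis_vec2)
  have \<phi>_\<sigma>: "AE x in circle. \<phi> x *v \<sigma> b (rot \<alpha> x) = (if b then \<gamma> x else cnj (\<gamma> x)) *s \<sigma> b x" for b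
    using \<phi>p AE_space
  proof eventually_elim
    case (elim x)
    have x: "x \<in> {0..<1}" using elim(2) by simp
    have inv: "inverse (\<gamma> x) = cnj (\<gamma> x)"
      using complex_norm_square[of "\<gamma> x"] g1[OF x] by (intro inverse_unique) simp
    have "\<phi> x *v \<sigma> b (rot \<alpha> x) = adjoint_mat (p x) *v (diag_cocycle \<gamma> x *v (p (rot \<alpha> x) *v (adjoint_mat (p (rot \<alpha> x)) *v axis (ix b) 1)))"
      unfolding elim(1) \<sigma>_def matrix_inv_SU2[OF pS[OF x]] by (simp only: matrix_vector_mul_assoc matrix_mul_assoc)
    also have "p (rot \<alpha> x) *v (adjoint_mat (p (rot \<alpha> x)) *v axis (ix b) 1) = axis (ix b) 1"
      by (rule SU2_cancel(5)[OF pS[OF rot_space]])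
    also have "diag_cocycle \<gamma> x *v axis (ix b) 1 = (if b then \<gamma> x else cnj (\<gamma> x)) *s axis (ix b) 1"
      by (simp add: diag_cocycle_def vec_eq_iff forall_2 mat2_vec_component axis_def ix_def inv)
    finally show ?case by (simp only: smult_mat2_vec \<sigma>_def)
  qed
  have both: "\<not> (eig_proj d (\<sigma> True x) (\<psi> x) = 0 \<and> eig_proj d (\<sigma> False x) (\<psi> x) = 0)" if x: "x \<in> {0..<1}" for x
  proof
    assume "eig_proj d (\<sigma> True x) (\<psi> x) = 0 \<and> eig_proj d (\<sigma> False x) (\<psi> x) = 0"
    hence z: "eig_proj d (\<sigma> b x) (\<psi> x) = 0" for b by (cases b) auto
    have lin: "eig_proj d (c *s u + c' *s w) A = c *s eig_proj d u A + c' *s eig_proj d w A" for c c' u w A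
      by (simp add: eig_proj_def vec_eq_iff mat2_vec_component algebra_simps)
    obtain e where e: "norm e = 1" "\<psi> x *v e = (\<i> * of_real d) *s e"
      using su2_eigenvector_exists[OF \<psi>_su2 \<psi>_norm d_pos] by blast
    \<comment> \<open>The eigenvector e itself is expanded in the two sections: its projection would
      be zero by linearity, yet it equals 2 e.\<close>
    define w where "w = p x *v e"
    have "e = adjoint_mat (p x) *v w" by (simp add: w_def SU2_cancel[OF pS[OF x]])
    also have "w = (w $ 1) *s axis 1 1 + (w $ 2) *s axis 2 1"
      by (simp add: vec_eq_iff forall_2 axis_def)
    also have "adjoint_mat (p x) *v \<dots> = (w $ 1) *s \<sigma> True x + (w $ 2) *s \<sigma> False x"
      by (simp only: matrix_vector_right_distrib smult_mat2_vec \<sigma>_def ix_def if_True if_False)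
    finally have "eig_proj d e (\<psi> x) = (w $ 1) *s eig_proj d (\<sigma> True x) (\<psi> x) + (w $ 2) *s eig_proj d (\<sigma> False x) (\<psi> x)"
      using lin by metis
    hence "eig_proj d e (\<psi> x) = 0" by (simp add: z vec_eq_iff)
    moreover have "eig_proj d e (\<psi> x) = 2 *s e"
      unfolding eig_proj_def e(2) using d_pos by (simp add: vec_eq_iff)
    ultimately have "norm (2 *s e) = 0" by simp
    thus False by (simp add: norm_smult_vec2 e(1))
  qed
  obtain b where b: "AE x in circle. eig_proj d (\<sigma> b x) (\<psi> x) \<noteq> 0"
  proof -
    have g0: "(if b then \<gamma> x else cnj (\<gamma> x)) \<noteq> 0" if "x \<in> {0..<1}" for b x
      using g1[OF that] by auto
    have alt: "(AE x in circle. eig_proj d (\<sigma> b x) (\<psi> x) \<noteq> 0) \<or> (AE x in circle. eig_proj d (\<sigma> b x) (\<psi> x) = 0)" for b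
      using \<sigma>m g0 \<phi>_\<sigma> by (rule eig_proj_rot_AE)
    show thesis
    proof (cases "AE x in circle. eig_proj d (\<sigma> True x) (\<psi> x) \<noteq> 0")
      case False
      hence "AE x in circle. eig_proj d (\<sigma> True x) (\<psi> x) = 0" using alt by blast
      hence "AE x in circle. eig_proj d (\<sigma> False x) (\<psi> x) \<noteq> 0"
        using AE_space by eventually_elim (use both in auto)
      thus thesis by (rule that)
    qed (rule that)
  qed
  interpret K: circle_skew_product \<alpha> \<phi> \<nu> \<gamma> "\<sigma> b" b
    by unfold_locales (use haar \<gamma> \<sigma>m \<sigma>n \<phi>_\<sigma> b in auto)
  show ?thesis by (rule K.lebesgue_multiplicity)
qed

theorem theorem6p1:
  fixes \<alpha> :: real
    and \<phi> :: "real \<Rightarrow> complex ^ 2 ^ 2"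
    and \<mu> :: "(complex ^ 2 ^ 2) measure"
    and \<nu> :: "complex measure"
  assumes irrational: "\<alpha> \<notin> \<rat>"
    and haar_SU2: "normalized_haar (**) SU2 \<mu>"
    and haar_S1: "normalized_haar (*) (sphere 0 1) \<nu>"
    and cocycle: "Ck_cocycle 2 \<phi>"
    and degree: "cocycle_degree \<alpha> \<phi> \<noteq> 0"
    and uniform: "uniformly_convergent_on UNIV (mean_log_deriv \<alpha> \<phi>)"
    and bounded: "\<exists>B. \<forall>n\<ge>1. su2_L1_norm (D (mean_log_deriv \<alpha> \<phi> n)) \<le> B"
  shows "lebesgue_countable_multiplicity (circle \<Otimes>\<^sub>M \<mu>)
           (koopman (circle \<Otimes>\<^sub>M \<mu>) (skew_product (**) \<alpha> \<phi>)) \<and>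
         (\<forall>\<gamma>. \<gamma> \<in> measurable circle (restrict_space borel (sphere 0 1)) \<longrightarrow>
            cohomologous \<alpha> \<phi> (diag_cocycle \<gamma>) \<longrightarrow>
            lebesgue_countable_multiplicity (circle \<Otimes>\<^sub>M \<nu>)
              (koopman (circle \<Otimes>\<^sub>M \<nu>) (skew_product (*) \<alpha> \<gamma>)))"
proof (intro conjI allI impI)
  interpret positive_degree_cocycle \<alpha> \<phi>
    by standard fact+
  show "lebesgue_countable_multiplicity (circle \<Otimes>\<^sub>M \<nu>) (koopman (circle \<Otimes>\<^sub>M \<nu>) (skew_product (*) \<alpha> \<gamma>))"
    if "\<gamma> \<in> measurable circle (restrict_space borel (sphere 0 1))" "cohomologous \<alpha> \<phi> (diag_cocycle \<gamma>)" for \<gamma>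
    using haar_S1 that by (rule cohomologous_lebesgue_multiplicity)
  interpret su2_skew_product \<alpha> \<phi> \<mu>
    by standard (fact haar_SU2)
  show "lebesgue_countable_multiplicity (circle \<Otimes>\<^sub>M \<mu>) (koopman (circle \<Otimes>\<^sub>M \<mu>) (skew_product (**) \<alpha> \<phi>))"
    by (rule lebesgue_multiplicity)
qed

end
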